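(* Let $\gamma_n=\gamma n^{-\beta}$ with $\gamma>0$, $\beta\in(0,1)$. For any $p\ge1$: (i) Assume that $f$ satisfies $(\mathbf{H}_\phi)$ and that the martingale increments satisfy $(\mathbf{H}^\phi_{\Sigma_p})$ (both defined in the context). Then a constant $C_p$ exists such that, for all $n\ge1$, $$\mathbb{E}\left[f^p(\theta_n)e^{\phi(f(\theta_n))}\right]\le C_p\{\gamma_n\}^p.$$ (ii) If, furthermore, $\liminf_{|x|\to+\infty}|x|^{-2p}f^p(x)e^{\phi(f(x))}>0$, then $(\theta_n)_{n\ge1}$ is $(L^{2p},\sqrt{\gamma_n})$-consistent: a constant $C_p$ exists such that, for all $n\ge1$, $$\mathbb{E}|\theta_n-\theta^\star|^{2p}\le C_p\{\gamma_n\}^p.$$ (iii) In particular, $(\theta_n)_{n\ge1}$ is $(L^{2p},\sqrt{\gamma_n})$-consistent if $(\mathbf{H}_{KL}^r)$ (defined in the context) holds for a given $r\in[0,1/2]$ and $(\mathbf{H}^\phi_{\Sigma_p})$ holds with $\phi(t)=(1+t^2)^{(1-2r)/2}$.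
   Context: Setting. $f:\mathbb{R}^d\to\mathbb{R}$ is of class $\mathcal{C}^2$, $\lim_{|x|\to+\infty}f(x)=+\infty$, $\{x:\nabla f(x)=0\}=\{\theta^\star\}$ (so $\theta^\star$ is the unique minimizer of $f$), and $f(\theta^\star)=0$. There are a measurable function $\Lambda:\mathbb{R}^d\times\mathbb{R}^{k}\to\mathbb{R}^d$ and an i.i.d. sequence $(Z_n)_{n\ge1}$ of $\mathbb{R}^{k}$-valued random variables such that $\nabla f(\theta)=\mathbb{E}[\Lambda(\theta,Z_1)]$ for all $\theta\in\mathbb{R}^d$. Given $\theta_0\in\mathbb{R}^d$ and positive step sizes $(\gamma_n)_{n\ge1}$, the stochastic gradient sequence is $\theta_{n+1}=\theta_n-\gamma_{n+1}\Lambda(\theta_n,Z_{n+1})$, $n\ge0$. Set $\Delta M_{n+1}=\nabla f(\theta_n)-\Lambda(\theta_n,Z_{n+1})$, so that $\theta_{n+1}=\theta_n-\gamma_{n+1}\nabla f(\theta_n)+\gamma_{n+1}\Delta M_{n+1}$. The filtration is $\mathcal{F}_n=\sigma(\theta_1,\dots,\theta_n)$ ($\mathcal{F}_0$ trivial). $|\cdot|$ is the Euclidean norm and $D^2f$ the Hessian of $f$. Assumption $(\mathbf{H}_\phi)$: $f$ is $\mathcal{C}^2(\mathbb{R}^d,\mathbb{R})$ with $D^2f$ bounded and Lipschitz and $D^2f(\theta^\star)$ invertible, and (a) $\phi\in\mathcal{C}^2(\mathbb{R}_+,\mathbb{R}_+)$ is non-decreasing and there is $x_0\ge0$ such that $\phi''(x)\le0$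 for all $x\ge x_0$; (b) there are two positive numbers $m,M$ such that for all $x\in\mathbb{R}^d\setminus\{\theta^\star\}$, $0<m\le\phi'(f(x))|\nabla f(x)|^2+\frac{|\nabla f(x)|^2}{f(x)}\le M$. Assumption $(\mathbf{H}^\phi_{\Sigma_p})$: a locally bounded deterministic function $\rho_p:\mathbb{R}_+\to\mathbb{R}_+$ exists such that for all $u\ge0$ and all $n\ge0$, $\mathbb{E}\left[|\Delta M_{n+1}|^{2p+2}e^{\phi(u|\Delta M_{n+1}|^2)}\mid\mathcal{F}_n\right]\le\rho_p(u)$ a.s. Assumption $(\mathbf{H}_{KL}^r)$, $r\in[0,1/2]$: $f$ is $\mathcal{C}^2(\mathbb{R}^d,\mathbb{R})$ with $D^2f$ bounded and Lipschitz and $D^2f(\theta^\star)$ invertible, $\liminf_{|x|\to+\infty}f(x)^{-r}|\nabla f(x)|>0$ and $\limsup_{|x|\to+\infty}f(x)^{-r}|\nabla f(x)|<+\infty$. *)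

theory Defs
  imports "HOL-Probability.Probability"
begin

definition grad :: "(real ^ 'd \<Rightarrow> real) \<Rightarrow> real ^ 'd \<Rightarrow> real ^ 'd" where
  "grad f x = (THE g. GDERIV f x :> g)"

lemma GDERIV_grad:
  assumes "f differentiable (at x)"
  shows "GDERIV f x :> grad f x"
proof -
  from assms obtain D where D: "(f has_derivative D) (at x)"
    by (auto simp: differentiable_def)
  interpret bounded_linear D by (rule has_derivative_bounded_linear[OF D])
  have "D h = h \<bullet> (\<Sum>b\<in>Basis. D b *\<^sub>R b)" for h
  proof -
    have "D h = D (\<Sum>b\<in>Basis. (h \<bullet> b) *\<^sub>R b)" by (simp add: euclidean_representation)
    also have "\<dots> = (\<Sum>b\<in>Basis. (h \<bullet> b) * D b)" by (simp add: sum scale)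
    also have "\<dots> = h \<bullet> (\<Sum>b\<in>Basis. D b *\<^sub>R b)"
      by (simp add: inner_sum_right mult.commute)
    finally show ?thesis .
  qed
  then have "D = (\<lambda>h. h \<bullet> (\<Sum>b\<in>Basis. D b *\<^sub>R b))" by blast
  with D have G: "GDERIV f x :> (\<Sum>b\<in>Basis. D b *\<^sub>R b)"
    by (simp add: gderiv_def)
  have uniq: "g = g'" if "GDERIV f x :> g" "GDERIV f x :> g'" for g g'
  proof -
    have "(\<lambda>h. h \<bullet> g) = (\<lambda>h. h \<bullet> g')"
      using that has_derivative_unique unfolding gderiv_def by blast
    then show ?thesis by (metis vector_eq_ldot)
  qed
  show ?thesis unfolding grad_def by (rule theI2[where P = "\<lambda>g. GDERIV f x :> g" and Q = "\<lambda>g. GDERIV f x :> g"]) (use G uniq in blast)+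
qed

definition hess :: "(real ^ 'd \<Rightarrow> real) \<Rightarrow> real ^ 'd \<Rightarrow> real ^ 'd ^ 'd" where
  "hess f x = jacobian (grad f) (at x)"

definition C2 :: "(real ^ 'd \<Rightarrow> real) \<Rightarrow> bool" where
  "C2 f \<longleftrightarrow> (\<forall>x. f differentiable (at x)) \<and> (\<forall>x. grad f differentiable (at x)) \<and>
     continuous_on UNIV (hess f)"

text \<open>Matrices carry the Euclidean norm of their entries. All matrix norms being equivalent,
  boundedness and Lipschitz continuity of the Hessian do not depend on this choice.\<close>

definition hess_regular :: "(real ^ 'd \<Rightarrow> real) \<Rightarrow> real ^ 'd \<Rightarrow> bool" where
  "hess_regular f \<theta>s \<longleftrightarrow> C2 f \<and> bounded (range (hess f)) \<and>
     (\<exists>L. L-lipschitz_on UNIV (hess f)) \<and> invertible (hess f \<theta>s)"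

text \<open>Derivatives of functions on the half-line are one-sided at \<open>0\<close>.\<close>

definition half_deriv :: "(real \<Rightarrow> real) \<Rightarrow> real \<Rightarrow> real" where
  "half_deriv \<phi> x = vector_derivative \<phi> (at x within {0..})"

definition C2_half_line :: "(real \<Rightarrow> real) \<Rightarrow> bool" where
  "C2_half_line \<phi> \<longleftrightarrow> \<phi> differentiable_on {0..} \<and> half_deriv \<phi> differentiable_on {0..} \<and>
     continuous_on {0..} (half_deriv (half_deriv \<phi>))"

definition H_phi :: "(real ^ 'd \<Rightarrow> real) \<Rightarrow> real ^ 'd \<Rightarrow> (real \<Rightarrow> real) \<Rightarrow> bool" where
  "H_phi f \<theta>s \<phi> \<longleftrightarrow> hess_regular f \<theta>s \<and>
     C2_half_line \<phi> \<and> (\<forall>x\<ge>0. \<phi> x \<ge> 0) \<and> mono_on {0..} \<phi> \<and>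
     (\<exists>x0\<ge>0. \<forall>x\<ge>x0. half_deriv (half_deriv \<phi>) x \<le> 0) \<and>
     (\<exists>m M. 0 < m \<and> 0 < M \<and> (\<forall>x. x \<noteq> \<theta>s \<longrightarrow>
        m \<le> half_deriv \<phi> (f x) * (norm (grad f x))\<^sup>2 + (norm (grad f x))\<^sup>2 / f x \<and>
        half_deriv \<phi> (f x) * (norm (grad f x))\<^sup>2 + (norm (grad f x))\<^sup>2 / f x \<le> M))"

definition H_KL :: "(real ^ 'd \<Rightarrow> real) \<Rightarrow> real ^ 'd \<Rightarrow> real \<Rightarrow> bool" where
  "H_KL f \<theta>s r \<longleftrightarrow> hess_regular f \<theta>s \<and>
     Liminf at_infinity (\<lambda>x. ereal (f x powr (- r) * norm (grad f x))) > 0 \<and>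
     Limsup at_infinity (\<lambda>x. ereal (f x powr (- r) * norm (grad f x))) < \<infinity>"

text \<open>The sigma-algebra generated by \<open>\<theta> 1, \<dots>, \<theta> n\<close>; it is trivial for \<open>n = 0\<close>. The
  conditional expectations below only use its sets, the measure being that of the ambient space.\<close>

definition past :: "'w measure \<Rightarrow> (nat \<Rightarrow> 'w \<Rightarrow> real ^ 'd) \<Rightarrow> nat \<Rightarrow> 'w measure" where
  "past P \<theta> n = sigma (space P) (\<Union>i\<in>{1..n}. {\<theta> i -` A \<inter> space P |A. A \<in> sets borel})"

text \<open>\<open>\<Delta>M n\<close> is used only for \<open>n \<ge> 1\<close>. The conditional expectation is that of a nonnegative
  random variable, so no integrability is presupposed.\<close>

definition H_Sigma ::
  "'w measure \<Rightarrow> (nat \<Rightarrow> 'w \<Rightarrow> real ^ 'd) \<Rightarrow> (nat \<Rightarrow> 'w \<Rightarrow> real ^ 'd) \<Rightarrow>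
   (real \<Rightarrow> real) \<Rightarrow> real \<Rightarrow> bool" where
  "H_Sigma P \<theta> \<Delta>M \<phi> p \<longleftrightarrow> (\<exists>\<rho> :: real \<Rightarrow> real.
     (\<forall>u\<ge>0. \<rho> u \<ge> 0) \<and> (\<forall>K. compact K \<and> K \<subseteq> {0..} \<longrightarrow> bounded (\<rho> ` K)) \<and>
     (\<forall>u\<ge>0. \<forall>n. AE \<omega> in P.
        nn_cond_exp P (past P \<theta> n)
          (\<lambda>\<omega>. ennreal (norm (\<Delta>M (Suc n) \<omega>) powr (2 * p + 2) *
                          exp (\<phi> (u * (norm (\<Delta>M (Suc n) \<omega>))\<^sup>2)))) \<omega>
        \<le> ennreal (\<rho> u)))"

text \<open>\<open>(L\<^sup>2\<^sup>p, \<surd>\<gamma>\<^sub>n)\<close>-consistency; the bound entails that the moments are finite.\<close>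

definition L2p_consistent ::
  "'w measure \<Rightarrow> real \<Rightarrow> (nat \<Rightarrow> real) \<Rightarrow> (nat \<Rightarrow> 'w \<Rightarrow> real ^ 'd) \<Rightarrow> real ^ 'd \<Rightarrow> bool" where
  "L2p_consistent P p \<gamma> \<theta> \<theta>s \<longleftrightarrow> (\<exists>C. \<forall>n\<ge>1.
     (\<integral>\<^sup>+ \<omega>. ennreal (norm (\<theta> n \<omega> - \<theta>s) powr (2 * p)) \<partial>P) \<le> ennreal (C * \<gamma> n powr p))"

end

theory Submission
  imports Defs "HOL-Real_Asymp.Real_Asymp"
begin

text \<open>
Write \<open>\<gamma>\<close> for the current step size and let \<open>U x = (f x + \<gamma>) powr p * exp (\<phi> (f x))\<close>. The assumption
\<open>H_phi\<close> makes a gradient step multiply \<open>U\<close> by at most \<open>1 - m * \<gamma>\<close> to first order. Along the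
segment joining two iterates the second derivative of \<open>U\<close> only involves \<open>f\<close>, \<open>\<phi>' (f x) * |grad f x|\<^sup>2\<close> and
\<open>|grad f x|\<^sup>2 / f x\<close>, all controlled by \<open>H_phi\<close>, and eventual concavity makes \<open>\<phi>\<close> subadditive up to a
constant, so that the noise splits off as a factor whose conditional expectation is bounded by
\<open>H_Sigma\<close>. Since the martingale increments are centred, the expectations satisfy
\<open>a (n + 1) \<le> (1 - m / 2 * \<gamma>) * a n + C * \<gamma> powr (p + 1)\<close>, which forces \<open>a n = O(\<gamma> powr p)\<close> because \<open>\<beta> < 1\<close>.
\<close>

section \<open>Coercive functions with a single critical point\<close>

text \<open>The shift in \<open>U\<close> equals the step size because the claim puts
  \<open>f\<close> at level \<open>\<gamma>\<close>. The error it causes in the drift,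
  \<open>\<gamma>\<^sup>2 * (f x + \<gamma>) powr (p - 1) * exp (\<phi> (f x))\<close>, is then of
  the same kind as the second-order remainder. That term lacks one power of
  \<open>f x + \<gamma>\<close> compared with \<open>U\<close>. Where \<open>f x + \<gamma>\<close>
  is at least a large multiple of \<open>\<gamma>\<close>, the contraction absorbs it; elsewhere it
  is itself of order \<open>\<gamma> powr (p + 1)\<close>. The moment order \<open>2 * p + 2\<close>
  in \<open>H_Sigma\<close> is what the remainder costs. In powers of
  \<open>1 + |noise|\<^sup>2\<close> it needs \<open>p - 1\<close> from
  \<open>(y + \<gamma>) powr (p - 1)\<close>, one from a further factor \<open>y + \<gamma>\<close>,
  and one from the squared length of the step. The contraction requires small steps, so it says
  nothing about the first iterates. Finiteness of all expectations is proved separately, with the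
  fixed shift \<open>1\<close> and a bound without contraction that holds for every step size that
  occurs. Part (iii) rests on two facts: a concave profile satisfying \<open>H_phi\<close> lies
  below the given one, and the lower gradient bound forces \<open>f powr (1 - r)\<close> to grow at
  least linearly.\<close>

lemma matrix_vector_mult_norm_le:
  fixes A :: "real ^ 'n ^ 'm"
  shows "norm (A *v x) \<le> real CARD('m) * real CARD('n) * norm A * norm x"
proof -
  have "onorm ((*v) A) \<le> real CARD('m) * real CARD('n) * norm A"
    by (rule onorm_le_matrix_component)
       (use component_le_norm_cart Finite_Cartesian_Product.norm_nth_le order_trans in blast)
  moreover have "norm (A *v x) \<le> onorm ((*v) A) * norm x"
    by (intro onorm linear_linear[THEN iffD2] matrix_vector_mul_linear)
  ultimately show ?thesis
    by (meson mult_right_mono norm_ge_zero order_trans)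
qed

locale objective =
  fixes f :: "real ^ 'd \<Rightarrow> real" and \<theta>s :: "real ^ 'd" and L :: real
  assumes f_diff: "f differentiable (at x)"
    and grad_diff: "grad f differentiable (at x)"
    and coercive: "filterlim f at_top at_infinity"
    and crit: "grad f x = 0 \<longleftrightarrow> x = \<theta>s"
    and f_min: "f \<theta>s = 0"
    and L_pos: "0 < L"
    and hess_le: "norm (hess f x *v h) \<le> L * norm h"
    and hess_inv: "invertible (hess f \<theta>s)"
begin

lemma f_has_derivative: "(f has_derivative (\<lambda>h. h \<bullet> grad f x)) (at x)"
  using GDERIV_grad[OF f_diff] by (simp add: gderiv_def)

lemma grad_has_derivative: "(grad f has_derivative (\<lambda>h. hess f x *v h)) (at x)"
  using grad_diff[of x] unfolding hess_def by (simp add: jacobian_works)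

lemma f_cont [continuous_intros]: "continuous_on A g \<Longrightarrow> continuous_on A (\<lambda>x. f (g x))"
  by (rule continuous_on_compose2[of UNIV f])
     (auto simp: continuous_on_eq_continuous_at intro!: differentiable_imp_continuous_within f_diff)

lemma grad_cont [continuous_intros]: "continuous_on A g \<Longrightarrow> continuous_on A (\<lambda>x. grad f (g x))"
  by (rule continuous_on_compose2[of UNIV "grad f"])
     (auto simp: continuous_on_eq_continuous_at intro!: differentiable_imp_continuous_within grad_diff)

lemma grad_lipschitz: "norm (grad f x - grad f y) \<le> L * norm (x - y)"
proof (rule differentiable_bound[of UNIV "grad f" "\<lambda>x h. hess f x *v h"])
  show "(grad f has_derivative (*v) (hess f z)) (at z within UNIV)" for z
    using grad_has_derivative by simp
  show "onorm ((*v) (hess f z)) \<le> L" for z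
    using L_pos hess_le by (intro onorm_bound) (auto simp: mult.commute)
qed auto

lemma f_line_deriv:
  "((\<lambda>t. f (x + t *\<^sub>R h)) has_real_derivative (grad f (x + t *\<^sub>R h) \<bullet> h)) (at t)"
proof -
  have "((\<lambda>t. x + t *\<^sub>R h) has_derivative (\<lambda>s. s *\<^sub>R h)) (at t)"
    by (auto intro!: derivative_eq_intros)
  from has_derivative_compose[OF this f_has_derivative] show ?thesis
    by (simp add: has_field_derivative_def inner_commute mult.commute[of _ "_ \<bullet> _"] )
qed

lemma grad_line_deriv:
  "((\<lambda>t. grad f (x + t *\<^sub>R h) \<bullet> h) has_real_derivative ((hess f (x + t *\<^sub>R h) *v h) \<bullet> h)) (at t)"
proof -
  have "((\<lambda>t. x + t *\<^sub>R h) has_derivative (\<lambda>s. s *\<^sub>R h)) (at t)"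
    by (auto intro!: derivative_eq_intros)
  from has_derivative_inner_left[OF has_derivative_compose[OF this grad_has_derivative], of h] show ?thesis
    by (simp add: has_field_derivative_def matrix_vector_mul_linear linear_scale
        mult.commute[of _ "_ \<bullet> _"])
qed

lemma hess_quadratic: "\<bar>(hess f x *v h) \<bullet> h\<bar> \<le> L * (norm h)\<^sup>2"
proof -
  have "\<bar>(hess f x *v h) \<bullet> h\<bar> \<le> norm (hess f x *v h) * norm h" by (rule Cauchy_Schwarz_ineq2)
  also have "\<dots> \<le> (L * norm h) * norm h" by (intro mult_right_mono hess_le) auto
  finally show ?thesis by (simp add: power2_eq_square)
qed

text \<open>One application of the mean value theorem and the Lipschitz bound for the gradient. This
  costs a factor 2 against the sharp constant \<open>L / 2\<close>, which is harmless for all later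
  uses.\<close>

lemma f_descent: "f (x + h) \<le> f x + grad f x \<bullet> h + L * (norm h)\<^sup>2"
proof -
  obtain z where z: "0 < z" "z < 1"
    and eq: "f (x + 1 *\<^sub>R h) - f (x + 0 *\<^sub>R h) = (1 - 0) * (grad f (x + z *\<^sub>R h) \<bullet> h)"
    using MVT2[of 0 1 "\<lambda>t. f (x + t *\<^sub>R h)" "\<lambda>t. grad f (x + t *\<^sub>R h) \<bullet> h"] f_line_deriv by auto
  have "(grad f (x + z *\<^sub>R h) - grad f x) \<bullet> h \<le> norm (grad f (x + z *\<^sub>R h) - grad f x) * norm h"
    by (rule norm_cauchy_schwarz)
  also have "\<dots> \<le> (L * norm (z *\<^sub>R h)) * norm h"
    using grad_lipschitz[of "x + z *\<^sub>R h" x] by (intro mult_right_mono) auto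
  also have "\<dots> \<le> L * (norm h)\<^sup>2"
    using z L_pos by (auto simp: power2_eq_square intro!: mult_right_mono mult_left_le_one_le)
  finally show ?thesis using eq by (simp add: inner_diff_left)
qed

lemma f_ge_at_infinity: "\<exists>R. \<forall>x. norm x \<ge> R \<longrightarrow> f x \<ge> c"
  using coercive unfolding filterlim_at_top eventually_at_infinity by blast

text \<open>By coercivity the infimum over a large ball is a global minimum. A global minimiser is
  critical, hence equal to \<open>\<theta>s\<close>. The same argument applies to any zero of
  \<open>f\<close>, since a zero is then a global minimiser too.\<close>

lemma f_minimum: "f x \<ge> 0" and f_eq_0_iff: "f x = 0 \<longleftrightarrow> x = \<theta>s"
proof -
  obtain R where R: "\<And>x. norm x \<ge> R \<Longrightarrow> f x \<ge> f 0 + 1"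
    using f_ge_at_infinity by blast
  have "\<exists>z\<in>cball 0 \<bar>R\<bar>. \<forall>y\<in>cball 0 \<bar>R\<bar>. f z \<le> f y"
    by (rule continuous_attains_inf) (auto intro!: continuous_intros)
  then obtain z where z: "\<And>y. y \<in> cball 0 \<bar>R\<bar> \<Longrightarrow> f z \<le> f y" by blast
  have min: "f z \<le> f y" for y
  proof (cases "y \<in> cball 0 \<bar>R\<bar>")
    case False
    then have "f y \<ge> f 0 + 1" by (intro R) auto
    then show ?thesis using z[of 0] by auto
  qed (rule z)
  have critical: "x = \<theta>s" if "\<And>y. f x \<le> f y" for x
  proof -
    have "(\<lambda>h. h \<bullet> grad f x) = (\<lambda>h. 0)"
      by (rule differential_zero_maxmin[OF _ open_UNIV f_has_derivative]) (use that in auto)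
    then have "grad f x \<bullet> grad f x = 0" by metis
    then show ?thesis using crit by simp
  qed
  have "z = \<theta>s" using critical[OF min] .
  then have ge: "f x \<ge> 0" for x using min f_min by metis
  show "f x \<ge> 0" by (rule ge)
  show "f x = 0 \<longleftrightarrow> x = \<theta>s"
    using critical[of x] ge f_min by auto
qed

lemma f_pos: "x \<noteq> \<theta>s \<Longrightarrow> f x > 0"
  using f_minimum[of x] f_eq_0_iff[of x] by linarith

text \<open>Self-bounding of a nonnegative smooth function: the increment
  \<open>- grad f x / (2 * L)\<close> minimises the upper bound of \<open>f_descent\<close>, and the
  minimum must still be nonnegative.\<close>

lemma grad_sq_le: "(norm (grad f x))\<^sup>2 \<le> 4 * L * f x"
proof -
  define g where "g = grad f x"
  have "0 \<le> f x + grad f x \<bullet> (- (1 / (2 * L)) *\<^sub>R g) + L * (norm (- (1 / (2 * L)) *\<^sub>R g))\<^sup>2"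
    using f_minimum f_descent order_trans by blast
  also have "\<dots> = f x - (norm g)\<^sup>2 / (4 * L)"
    using L_pos unfolding g_def[symmetric]
    by (simp add: dot_square_norm power_mult_distrib power_divide divide_simps) (simp add: algebra_simps power2_eq_square)
  finally show ?thesis using L_pos by (simp add: g_def field_simps)
qed

lemma f_upper: "f x \<le> L * (norm (x - \<theta>s))\<^sup>2"
  using f_descent[of \<theta>s "x - \<theta>s"] f_min crit[of \<theta>s] by simp

text \<open>The linearisation of the gradient at \<open>\<theta>s\<close> is the invertible Hessian,
  which expands lengths by at least \<open>1 / b\<close>. A linearisation error of
  \<open>1 / (2 * b)\<close> leaves half of that.\<close>

lemma grad_lower_near: "\<exists>c>0. \<exists>\<delta>>0. \<forall>x. norm (x - \<theta>s) < \<delta> \<longrightarrow> c * norm (x - \<theta>s) \<le> norm (grad f x)"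
proof -
  define H where "H = hess f \<theta>s"
  obtain B where B: "B ** H = mat 1"
    using hess_inv unfolding invertible_def H_def by blast
  define b where "b = real CARD('d) * real CARD('d) * norm B"
  have Bb: "norm h \<le> b * norm (H *v h)" for h
  proof -
    have "h = B *v (H *v h)" by (simp add: matrix_vector_mul_assoc B)
    then show ?thesis using matrix_vector_mult_norm_le[of B "H *v h"] by (simp add: b_def)
  qed
  have b: "b > 0"
  proof (rule ccontr)
    assume "\<not> b > 0"
    moreover have "b \<ge> 0" by (auto simp: b_def)
    ultimately have "norm (axis undefined 1 :: real ^ 'd) \<le> 0" using Bb by force
    then show False by (simp add: axis_eq_0_iff)
  qed
  have "\<exists>d>0. \<forall>y. norm (y - \<theta>s) < d \<longrightarrow>
      norm (grad f y - grad f \<theta>s - H *v (y - \<theta>s)) \<le> 1 / (2 * b) * norm (y - \<theta>s)"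
  proof -
    have "\<forall>e>0. \<exists>d>0. \<forall>y. norm (y - \<theta>s) < d \<longrightarrow>
        norm (grad f y - grad f \<theta>s - H *v (y - \<theta>s)) \<le> e * norm (y - \<theta>s)"
      using grad_has_derivative[of \<theta>s] unfolding has_derivative_within_alt H_def by auto
    then show ?thesis using b by (elim allE[of _ "1 / (2 * b)"]) auto
  qed
  then obtain d where d: "d > 0" and near: "\<And>y. norm (y - \<theta>s) < d \<Longrightarrow>
      norm (grad f y - grad f \<theta>s - H *v (y - \<theta>s)) \<le> 1 / (2 * b) * norm (y - \<theta>s)" by blast
  have "1 / (2 * b) * norm (x - \<theta>s) \<le> norm (grad f x)" if "norm (x - \<theta>s) < d" for x
  proof -
    have "norm (H *v (x - \<theta>s)) \<le> norm (grad f x) + 1 / (2 * b) * norm (x - \<theta>s)"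
      using near[OF that] crit[of \<theta>s] norm_triangle_sub[of "H *v (x - \<theta>s)" "grad f x"]
      by (simp add: norm_minus_commute)
    moreover have "1 / b * norm (x - \<theta>s) \<le> norm (H *v (x - \<theta>s))"
      using Bb[of "x - \<theta>s"] b by (simp add: field_simps)
    moreover have "1 / b * norm (x - \<theta>s) = 1 / (2 * b) * norm (x - \<theta>s) + 1 / (2 * b) * norm (x - \<theta>s)"
      using b by (simp add: field_simps)
    ultimately show ?thesis by linarith
  qed
  then show ?thesis using d b by (intro exI[of _ "1 / (2 * b)"] conjI exI[of _ d]) auto
qed

end

lemma objective_exists:
  fixes f :: "real ^ 'd \<Rightarrow> real"
  assumes "hess_regular f \<theta>s" "filterlim f at_top at_infinity" "{x. grad f x = 0} = {\<theta>s}" "f \<theta>s = 0"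
  shows "\<exists>L. objective f \<theta>s L"
proof -
  obtain K where K: "K > 0" "\<And>x. norm (hess f x) \<le> K"
    using assms(1) unfolding hess_regular_def bounded_pos by auto
  define L where "L = real CARD('d) * real CARD('d) * K"
  have "norm (hess f x *v h) \<le> L * norm h" for x h
  proof -
    have "norm (hess f x *v h) \<le> real CARD('d) * real CARD('d) * norm (hess f x) * norm h"
      by (rule matrix_vector_mult_norm_le)
    also have "\<dots> \<le> L * norm h"
      unfolding L_def using K(2) by (intro mult_right_mono mult_left_mono) auto
    finally show ?thesis .
  qed
  moreover have "L > 0" using K by (auto simp: L_def)
  ultimately have "objective f \<theta>s L"
    using assms unfolding hess_regular_def C2_def by unfold_locales auto
  then show ?thesis ..
qed

section \<open>Profiles on the half-line\<close>

lemma at_half_line_neq_bot: "0 \<le> x \<Longrightarrow> at x within {0::real..} \<noteq> bot"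
proof -
  assume "0 \<le> x"
  then have "at_right x \<le> at x within {0..}" by (intro at_le) auto
  then show ?thesis using trivial_limit_at_right_real[of x] by (metis bot.extremum_uniqueI)
qed

text \<open>\<open>F\<close> has only a one-sided derivative at \<open>0\<close>, but
  \<open>k\<close> never leaves the half-line, so a derivative within \<open>{0..}\<close> suffices.
  The typical \<open>k\<close> is \<open>f\<close> along a line, which touches \<open>0\<close> when
  the line meets the minimiser.\<close>

lemma half_line_chain:
  fixes F k :: "real \<Rightarrow> real"
  assumes "\<And>x. 0 \<le> x \<Longrightarrow> (F has_real_derivative F' x) (at x within {0..})"
    and "(k has_real_derivative k') (at t within S)" "t \<in> S" "\<And>s. s \<in> S \<Longrightarrow> 0 \<le> k s"
  shows "((\<lambda>t. F (k t)) has_real_derivative (F' (k t) * k')) (at t within S)"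
proof -
  have "((\<lambda>t. F (k t)) has_derivative (\<lambda>y. F' (k t) * (k' * y))) (at t within S)"
    by (rule has_derivative_in_compose2[where t = "{0..}"])
       (use assms in \<open>auto simp: has_field_derivative_def\<close>)
  then show ?thesis by (simp add: has_field_derivative_def mult.assoc[abs_def] comp_def)
qed

lemma half_line_MVT:
  fixes F :: "real \<Rightarrow> real"
  assumes "\<And>x. x \<ge> 0 \<Longrightarrow> (F has_real_derivative F' x) (at x within {0..})" "0 \<le> a" "a < b"
  shows "\<exists>z. a < z \<and> z < b \<and> F b - F a = (b - a) * F' z"
proof -
  have "continuous_on {0..} F"
    using assms(1) by (intro DERIV_continuous_on) auto
  then have "continuous_on {a..b} F"
    by (rule continuous_on_subset) (use assms in auto)
  moreover have "(F has_derivative (*) (F' x)) (at x)" if "a < x" "x < b" for x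
  proof -
    have "at x within {0..} = at x"
      using that assms by (intro at_within_interior) auto
    then show ?thesis using assms(1)[of x] that assms(2) by (simp add: has_field_derivative_def)
  qed
  ultimately have "\<exists>z. a < z \<and> z < b \<and> F b - F a = F' z * (b - a)"
    using mvt[OF assms(3), of F "\<lambda>x. (*) (F' x)"] by auto
  then show ?thesis by (simp add: mult.commute)
qed

lemma half_deriv_works:
  assumes "F differentiable_on {0..}" "0 \<le> x"
  shows "(F has_real_derivative half_deriv F x) (at x within {0..})"
  using assms vector_derivative_works[of F "at x within {0..}"]
  unfolding half_deriv_def differentiable_on_def has_real_derivative_iff_has_vector_derivative by auto

lemma half_deriv_eqI:
  assumes "(F has_real_derivative D) (at x within {0..})" "0 \<le> x"
  shows "half_deriv F x = D"
proof -
  show ?thesis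
    using at_half_line_neq_bot[OF assms(2)] assms(1) unfolding half_deriv_def has_real_derivative_iff_has_vector_derivative
    by (rule vector_derivative_within)
qed

text \<open>Quantitative form of the conditions on \<open>\<phi>\<close>. For
  \<open>\<phi>''\<close> an upper bound is recorded because it enters the second derivative of the
  Lyapunov function with a nonnegative factor.\<close>

locale profile =
  fixes \<phi> :: "real \<Rightarrow> real" and \<phi>' \<phi>'' :: "real \<Rightarrow> real" and x0 \<Phi> K :: real
  assumes \<phi>_deriv: "0 \<le> x \<Longrightarrow> (\<phi> has_real_derivative \<phi>' x) (at x within {0..})"
    and \<phi>'_deriv: "0 \<le> x \<Longrightarrow> (\<phi>' has_real_derivative \<phi>'' x) (at x within {0..})"
    and \<phi>_nonneg: "0 \<le> x \<Longrightarrow> 0 \<le> \<phi> x"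
    and x0: "0 \<le> x0"
    and \<phi>'_bounds: "0 \<le> x \<Longrightarrow> 0 \<le> \<phi>' x" "0 \<le> x \<Longrightarrow> \<phi>' x \<le> \<Phi>"
    and K: "0 \<le> K"
    and \<phi>''_le: "0 \<le> x \<Longrightarrow> \<phi>'' x \<le> (if x < x0 then K else 0)"
begin

lemma \<Phi>_nonneg: "0 \<le> \<Phi>"
  using \<phi>'_bounds[of 0] by linarith

lemma \<phi>_incr:
  assumes "0 \<le> s" "s \<le> t"
  shows "\<phi> s \<le> \<phi> t" and "\<phi> t \<le> \<phi> s + \<Phi> * (t - s)"
proof -
  have "\<phi> s \<le> \<phi> t \<and> \<phi> t \<le> \<phi> s + \<Phi> * (t - s)"
  proof (cases "s = t")
    case False
    then obtain z where z: "s < z" "z < t" "\<phi> t - \<phi> s = (t - s) * \<phi>' z"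
      using half_line_MVT[of \<phi> \<phi>' s t] \<phi>_deriv assms by auto
    have "0 \<le> (t - s) * \<phi>' z" "(t - s) * \<phi>' z \<le> (t - s) * \<Phi>"
      using assms z \<phi>'_bounds[of z] by (auto intro!: mult_left_mono)
    then show ?thesis using z mult.commute[of \<Phi> "t - s"] by linarith
  qed auto
  then show "\<phi> s \<le> \<phi> t" and "\<phi> t \<le> \<phi> s + \<Phi> * (t - s)" by auto
qed

lemma \<phi>'_decr:
  assumes "x0 \<le> s" "s \<le> t"
  shows "\<phi>' t \<le> \<phi>' s"
proof (cases "s = t")
  case False
  then obtain z where z: "s < z" "z < t" "\<phi>' t - \<phi>' s = (t - s) * \<phi>'' z"
    using half_line_MVT[of \<phi>' \<phi>'' s t] \<phi>'_deriv assms x0 by auto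
  have "\<phi>'' z \<le> 0" using \<phi>''_le[of z] z x0 assms by auto
  then show ?thesis using z assms mult_nonneg_nonpos[of "t - s" "\<phi>'' z"] by auto
qed auto

text \<open>Beyond \<open>x0\<close> the derivative \<open>\<phi>'\<close> decreases, so
  \<open>\<phi> (s + x) - \<phi> x\<close> is nonincreasing there and may be compared with its value
  at \<open>x = x0\<close>. Any remaining increment has length at most \<open>x0\<close> and costs
  at most \<open>\<Phi> * x0\<close>. No normalisation of \<open>\<phi> 0\<close> is assumed;
  nonnegativity takes its place.\<close>

lemma \<phi>_subadd:
  assumes "0 \<le> s" "0 \<le> v"
  shows "\<phi> (s + v) \<le> \<phi> s + \<phi> v + \<Phi> * x0"
proof (cases "v \<le> x0")
  case True
  have "\<phi> (s + v) \<le> \<phi> s + \<Phi> * v" using \<phi>_incr(2)[of s "s + v"] assms by simp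
  also have "\<dots> \<le> \<phi> s + \<Phi> * x0" using True \<Phi>_nonneg by (auto intro: mult_left_mono)
  finally show ?thesis using \<phi>_nonneg[of v] assms by simp
next
  case False
  have der: "((\<lambda>x. \<phi> (s + x) - \<phi> x) has_real_derivative (\<phi>' (s + x) - \<phi>' x)) (at x within {0..})"
    if "0 \<le> x" for x
  proof -
    have "((\<lambda>x. \<phi> (s + x)) has_real_derivative \<phi>' (s + x) * 1) (at x within {0..})"
      by (rule half_line_chain) (use that assms \<phi>_deriv in \<open>auto intro!: derivative_eq_intros\<close>)
    then show ?thesis using \<phi>_deriv[OF that] by (auto intro!: derivative_eq_intros)
  qed
  obtain z where z: "x0 < z" "z < v"
    "(\<phi> (s + v) - \<phi> v) - (\<phi> (s + x0) - \<phi> x0) = (v - x0) * (\<phi>' (s + z) - \<phi>' z)"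
    using half_line_MVT[of "\<lambda>x. \<phi> (s + x) - \<phi> x" "\<lambda>x. \<phi>' (s + x) - \<phi>' x" x0 v] der False x0 by auto
  have "(v - x0) * (\<phi>' (s + z) - \<phi>' z) \<le> 0"
    using z \<phi>'_decr[of z "s + z"] assms by (intro mult_nonneg_nonpos) auto
  then have "\<phi> (s + v) \<le> \<phi> v + \<phi> (s + x0)" using z \<phi>_nonneg[OF x0] by linarith
  moreover have "\<phi> (s + x0) \<le> \<phi> s + \<Phi> * x0" using \<phi>_incr(2)[of s "s + x0"] assms x0 by simp
  ultimately show ?thesis by simp
qed

text \<open>Shows that the gradient part of a step changes \<open>\<phi> (f x)\<close> by a constant
  only; it is used with \<open>a = f x\<close> and \<open>b\<close> a multiple of the squared
  gradient. For \<open>a\<close> beyond \<open>x0\<close> the slope on \<open>[a, a + b]\<close> is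
  at most \<open>\<phi>' a\<close>; for smaller \<open>a\<close> the shift itself is at most
  \<open>c * x0\<close>.\<close>

lemma \<phi>_shift_bounded:
  assumes "0 \<le> a" "0 \<le> b" "\<phi>' a * b \<le> M" "b \<le> c * a" "0 \<le> c" "0 \<le> M"
  shows "\<phi> (a + b) \<le> \<phi> a + M + \<Phi> * c * x0"
proof (cases "x0 \<le> a")
  case True
  have "\<phi> (a + b) \<le> \<phi> a + M"
  proof (cases "b = 0")
    case False
    then obtain z where z: "a < z" "z < a + b" "\<phi> (a + b) - \<phi> a = (a + b - a) * \<phi>' z"
      using half_line_MVT[of \<phi> \<phi>' a "a + b"] \<phi>_deriv assms by auto
    have "b * \<phi>' z \<le> b * \<phi>' a" using z True assms by (intro mult_left_mono \<phi>'_decr) auto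
    also have "\<dots> \<le> M" using assms by (simp add: mult.commute)
    finally show ?thesis using z by simp
  qed (use assms in auto)
  moreover have "0 \<le> \<Phi> * c * x0" using \<Phi>_nonneg assms x0 by auto
  ultimately show ?thesis by linarith
next
  case False
  have "\<phi> (a + b) \<le> \<phi> a + \<Phi> * b" using \<phi>_incr(2)[of a "a + b"] assms by simp
  also have "\<Phi> * b \<le> \<Phi> * (c * x0)"
    using assms \<Phi>_nonneg False mult_left_mono[of a x0 c] by (intro mult_left_mono) auto
  finally show ?thesis using assms by (simp add: mult.assoc)
qed

end

text \<open>Continuity on the compact interval \<open>[0, x0]\<close> supplies both constants.
  Beyond \<open>x0\<close> the slope only decreases, so the bound at \<open>x0\<close>
  persists.\<close>

lemma profile_exists:
  assumes "C2_half_line \<phi>" "\<forall>x\<ge>0. \<phi> x \<ge> 0" "mono_on {0..} \<phi>"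
    and x0: "0 \<le> x0" "\<forall>x\<ge>x0. half_deriv (half_deriv \<phi>) x \<le> 0"
  shows "\<exists>\<Phi> K. profile \<phi> (half_deriv \<phi>) (half_deriv (half_deriv \<phi>)) x0 \<Phi> K"
proof -
  let ?d = "half_deriv \<phi>" and ?dd = "half_deriv (half_deriv \<phi>)"
  have d: "(\<phi> has_real_derivative ?d x) (at x within {0..})"
    "(?d has_real_derivative ?dd x) (at x within {0..})" if "0 \<le> x" for x
    using assms(1) that by (auto simp: C2_half_line_def intro!: half_deriv_works)
  have nonneg: "0 \<le> ?d x" if "0 \<le> x" for x
  proof -
    have lim: "((\<lambda>y. (\<phi> y - \<phi> x) / (y - x)) \<longlongrightarrow> ?d x) (at x within {0..})"
      using d(1)[OF that] by (simp add: has_field_derivative_iff)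
    have ev: "\<forall>\<^sub>F y in at x within {0..}. 0 \<le> (\<phi> y - \<phi> x) / (y - x)"
      unfolding eventually_at_filter
    proof (intro always_eventually allI impI)
      fix y assume "y \<noteq> x" "y \<in> {0..}"
      then show "0 \<le> (\<phi> y - \<phi> x) / (y - x)"
        using assms(3) that unfolding mono_on_def
        by (cases "x < y") (auto simp: zero_le_divide_iff)
    qed
    from tendsto_lowerbound[OF lim ev at_half_line_neq_bot[OF that]] show ?thesis .
  qed
  have "compact (?d ` {0..x0})" "compact (?dd ` {0..x0})"
  proof -
    have "continuous_on {0..} ?d" using d(2) by (intro DERIV_continuous_on) auto
    moreover have "continuous_on {0..} ?dd" using assms(1) by (simp add: C2_half_line_def)
    ultimately have "continuous_on {0..x0} ?d" "continuous_on {0..x0} ?dd"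
      by (auto elim!: continuous_on_subset)
    then show "compact (?d ` {0..x0})" "compact (?dd ` {0..x0})"
      by (auto intro!: compact_continuous_image)
  qed
  then obtain \<Phi> K where \<Phi>: "\<And>x. x \<in> {0..x0} \<Longrightarrow> \<bar>?d x\<bar> \<le> \<Phi>" and K: "\<And>x. x \<in> {0..x0} \<Longrightarrow> \<bar>?dd x\<bar> \<le> K"
    by (force dest!: compact_imp_bounded simp: bounded_iff)
  have le: "?d x \<le> \<Phi>" if "0 \<le> x" for x
  proof (cases "x \<le> x0")
    case True
    then show ?thesis using \<Phi>[of x] that by auto
  next
    case False
    then obtain z where z: "x0 < z" "z < x" "?d x - ?d x0 = (x - x0) * ?dd z"
      using half_line_MVT[of ?d ?dd x0 x] d(2) x0 by auto
    then have "?d x \<le> ?d x0" using x0(2) False mult_nonneg_nonpos[of "x - x0" "?dd z"] by auto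
    also have "\<dots> \<le> \<Phi>" using \<Phi>[of x0] x0 by auto
    finally show ?thesis .
  qed
  have "profile \<phi> ?d ?dd x0 \<Phi> K"
  proof
    show "?dd x \<le> (if x < x0 then K else 0)" if "0 \<le> x" for x
      using K[of x] x0(2) that by auto
    show "0 \<le> K" using K[of 0] x0 by force
  qed (use d nonneg le assms x0 in auto)
  then show ?thesis by blast
qed

section \<open>The one-step inequality\<close>

lemma le_one_plus_square: "(w::real) \<le> 1 + w\<^sup>2"
  using sum_squares_bound[of 1 w] zero_le_power2[of w] by (cases "0 \<le> w") (simp, linarith)

locale phi_regular = objective f \<theta>s L + profile \<phi> \<phi>' \<phi>'' x0 \<Phi> K
  for f :: "real ^ 'd \<Rightarrow> real" and \<theta>s L \<phi> \<phi>' \<phi>'' x0 \<Phi> K +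
  fixes m M p :: real
  assumes m_pos: "0 < m" and M_pos: "0 < M" and p_ge_1: "1 \<le> p"
    and H_phi_bounds: "x \<noteq> \<theta>s \<Longrightarrow> m \<le> \<phi>' (f x) * (norm (grad f x))\<^sup>2 + (norm (grad f x))\<^sup>2 / f x"
      "x \<noteq> \<theta>s \<Longrightarrow> \<phi>' (f x) * (norm (grad f x))\<^sup>2 + (norm (grad f x))\<^sup>2 / f x \<le> M"
begin

text \<open>Both summands in \<open>H_phi_bounds\<close> are nonnegative, so \<open>M\<close> bounds
  each of them. Multiplying by \<open>f x\<close> removes the quotient and makes the estimates valid
  at \<open>\<theta>s\<close> as well.\<close>

lemma grad_bounds:
  shows "\<phi>' (f x) * (norm (grad f x))\<^sup>2 \<le> M"
    and "(norm (grad f x))\<^sup>2 \<le> M * f x"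
    and "m * f x \<le> f x * \<phi>' (f x) * (norm (grad f x))\<^sup>2 + (norm (grad f x))\<^sup>2"
proof -
  have "\<phi>' (f x) * (norm (grad f x))\<^sup>2 \<le> M \<and> (norm (grad f x))\<^sup>2 \<le> M * f x \<and>
    m * f x \<le> f x * \<phi>' (f x) * (norm (grad f x))\<^sup>2 + (norm (grad f x))\<^sup>2"
  proof (cases "x = \<theta>s")
    case True
    then show ?thesis using crit[of \<theta>s] f_min M_pos by auto
  next
    case False
    have fx: "f x > 0" using f_pos[OF False] .
    define a where "a = \<phi>' (f x) * (norm (grad f x))\<^sup>2"
    define b where "b = (norm (grad f x))\<^sup>2 / f x"
    have nn: "0 \<le> a" "0 \<le> b" using fx \<phi>'_bounds[of "f x"] by (auto simp: a_def b_def)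
    have le: "m \<le> a + b" "a + b \<le> M" using H_phi_bounds[OF False] by (auto simp: a_def b_def)
    have bf: "(norm (grad f x))\<^sup>2 = b * f x" using fx by (simp add: b_def)
    have "b * f x \<le> M * f x" "m * f x \<le> (a + b) * f x" using le nn fx by (auto intro!: mult_right_mono)
    then have "a \<le> M \<and> b * f x \<le> M * f x \<and> m * f x \<le> f x * a + b * f x"
      using le nn by (simp add: algebra_simps)
    then show ?thesis by (simp add: bf[symmetric] a_def mult.assoc)
  qed
  then show "\<phi>' (f x) * (norm (grad f x))\<^sup>2 \<le> M"
    and "(norm (grad f x))\<^sup>2 \<le> M * f x"
    and "m * f x \<le> f x * \<phi>' (f x) * (norm (grad f x))\<^sup>2 + (norm (grad f x))\<^sup>2" by auto
qed

section \<open>The Lyapunov function in terms of the value of \<open>f\<close>, and its second-order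
  expansion along a segment\<close>

definition lyap :: "real \<Rightarrow> real \<Rightarrow> real" where
  "lyap \<epsilon> y = (y + \<epsilon>) powr p * exp (\<phi> y)"

definition lyap' :: "real \<Rightarrow> real \<Rightarrow> real" where
  "lyap' \<epsilon> y = exp (\<phi> y) * (p * (y + \<epsilon>) powr (p - 1) + \<phi>' y * (y + \<epsilon>) powr p)"

definition lyap'' :: "real \<Rightarrow> real \<Rightarrow> real" where
  "lyap'' \<epsilon> y = exp (\<phi> y) * (p * (p - 1) * (y + \<epsilon>) powr (p - 2) +
     2 * p * \<phi>' y * (y + \<epsilon>) powr (p - 1) + ((\<phi>' y)\<^sup>2 + \<phi>'' y) * (y + \<epsilon>) powr p)"

lemma lyap_nonneg: "0 \<le> lyap \<epsilon> y"
  by (simp add: lyap_def)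

lemma shifted_powr_deriv:
  assumes "0 \<le> y" "0 < \<epsilon>"
  shows "((\<lambda>y. (y + \<epsilon>) powr q) has_real_derivative (q * (y + \<epsilon>) powr (q - 1))) (at y within {0..})"
  using assms by (auto intro!: derivative_eq_intros)

lemma exp_\<phi>_deriv:
  assumes "0 \<le> y"
  shows "((\<lambda>y. exp (\<phi> y)) has_real_derivative (exp (\<phi> y) * \<phi>' y)) (at y within {0..})"
  by (rule DERIV_chain2[OF DERIV_exp \<phi>_deriv[OF assms]])

lemma lyap_deriv:
  assumes "0 \<le> y" "0 < \<epsilon>"
  shows "(lyap \<epsilon> has_real_derivative lyap' \<epsilon> y) (at y within {0..})"
  unfolding lyap_def[abs_def]
  by (rule DERIV_cong[OF DERIV_mult[OF shifted_powr_deriv[OF assms] exp_\<phi>_deriv[OF assms(1)]]])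
     (simp add: lyap'_def algebra_simps)

lemma lyap'_deriv:
  assumes "0 \<le> y" "0 < \<epsilon>"
  shows "(lyap' \<epsilon> has_real_derivative lyap'' \<epsilon> y) (at y within {0..})"
  unfolding lyap'_def[abs_def]
  by (rule DERIV_cong[OF DERIV_mult[OF exp_\<phi>_deriv[OF assms(1)]
        DERIV_add[OF DERIV_cmult[OF shifted_powr_deriv[OF assms]]
          DERIV_mult[OF \<phi>'_deriv[OF assms(1)] shifted_powr_deriv[OF assms]]]]])
     (simp add: lyap''_def algebra_simps power2_eq_square)

text \<open>One summand for each term of \<open>lyap''\<close>: the second derivative of the power,
  the mixed term, the square of \<open>\<phi>'\<close>, and \<open>\<phi>''\<close>. The last one
  can be positive only for \<open>y < x0\<close>, where
  \<open>y + \<epsilon> \<le> x0 + 1\<close>.\<close>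

definition C_lyap :: real where
  "C_lyap = p * (p - 1) * M + 2 * p * M + M + K * M * x0 * (x0 + 1)"

lemma C_lyap_nonneg: "0 \<le> C_lyap"
  using p_ge_1 M_pos K x0 by (auto simp: C_lyap_def intro!: add_nonneg_nonneg mult_nonneg_nonneg)

lemma powr_pred: "0 < (b::real) \<Longrightarrow> b powr q = b powr (q - 1) * b"
  by (simp add: powr_diff)

text \<open>\<open>G\<close> stands for the square of the directional derivative of \<open>f\<close>
  and \<open>S\<close> for the squared length of the direction; the last two hypotheses are then
  \<open>grad_bounds\<close> combined with Cauchy-Schwarz. The right-hand side has the form of the
  bound for \<open>lyap'\<close> in \<open>lyap'_bounds\<close>, so both second-order contributions
  can be added.\<close>

lemma lyap''_bound:
  assumes "0 \<le> y" "0 < \<epsilon>" "\<epsilon> \<le> 1" "0 \<le> G" "0 \<le> S" "\<phi>' y * G \<le> M * S" "G \<le> M * y * S"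
  shows "lyap'' \<epsilon> y * G \<le> C_lyap * exp (\<phi> y) * (y + \<epsilon>) powr (p - 1) * (1 + \<phi>' y * (y + \<epsilon>)) * S"
proof -
  let ?F = "y + \<epsilon>" and ?E = "exp (\<phi> y) * (y + \<epsilon>) powr (p - 1)"
  have F: "?F > 0" using assms by simp
  have \<phi>'0: "0 \<le> \<phi>' y" using \<phi>'_bounds assms by auto
  have e1: "?F powr p = ?F powr (p - 1) * ?F" by (rule powr_pred[OF F])
  have e2: "?F powr (p - 2) = ?F powr (p - 1) / ?F" using F powr_pred[of ?F "p - 1"] by (simp add: field_simps)
  have "lyap'' \<epsilon> y * G = ?E * (p * (p - 1) * (G / ?F) + 2 * p * (\<phi>' y * G) + \<phi>' y * ?F * (\<phi>' y * G) + \<phi>'' y * G * ?F)"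
    unfolding lyap''_def e1 e2 by (simp add: algebra_simps power2_eq_square)
  also have "\<dots> \<le> ?E * (C_lyap * (1 + \<phi>' y * ?F) * S)"
  proof (intro mult_left_mono)
    have "G / ?F \<le> M * S"
    proof -
      have "M * y * S \<le> M * ?F * S" using assms M_pos by (intro mult_right_mono mult_left_mono) auto
      then have "G \<le> M * ?F * S" using assms by linarith
      then show ?thesis using F by (simp add: field_simps)
    qed
    then have 1: "p * (p - 1) * (G / ?F) \<le> p * (p - 1) * (M * S)"
      using p_ge_1 by (intro mult_left_mono) auto
    have 2: "2 * p * (\<phi>' y * G) \<le> 2 * p * (M * S)"
      using p_ge_1 assms by (intro mult_left_mono) auto
    have 3: "\<phi>' y * ?F * (\<phi>' y * G) \<le> \<phi>' y * ?F * (M * S)"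
      using \<phi>'0 F assms by (intro mult_left_mono) auto
    have 4: "\<phi>'' y * G * ?F \<le> K * M * x0 * (x0 + 1) * S"
    proof (cases "y < x0")
      case True
      have "\<phi>'' y * G \<le> K * G" using True \<phi>''_le[of y] assms by (intro mult_right_mono) auto
      also have "\<dots> \<le> K * (M * x0 * S)"
      proof (intro mult_left_mono)
        have "M * y * S \<le> M * x0 * S" using assms M_pos True by (intro mult_right_mono mult_left_mono) auto
        then show "G \<le> M * x0 * S" using assms by linarith
      qed (rule K)
      finally have "\<phi>'' y * G * ?F \<le> K * (M * x0 * S) * ?F" using F by (intro mult_right_mono) auto
      also have "\<dots> \<le> K * (M * x0 * S) * (x0 + 1)"
        using K M_pos x0 assms True by (intro mult_left_mono) auto
      finally show ?thesis by (simp add: mult_ac)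
    next
      case False
      then have "\<phi>'' y * G * ?F \<le> 0"
        using \<phi>''_le[of y] assms by (simp add: mult_nonpos_nonneg)
      also have "0 \<le> K * M * x0 * (x0 + 1) * S" using K M_pos x0 assms by auto
      finally show ?thesis .
    qed
    have "p * (p - 1) * (G / ?F) + 2 * p * (\<phi>' y * G) + \<phi>' y * ?F * (\<phi>' y * G) + \<phi>'' y * G * ?F
      \<le> (C_lyap - M) * S + M * (\<phi>' y * ?F) * S"
      using 1 2 3 4 unfolding C_lyap_def by (simp add: algebra_simps)
    also have "\<dots> \<le> C_lyap * S + C_lyap * (\<phi>' y * ?F) * S"
    proof (intro add_mono mult_right_mono)
      show "M \<le> C_lyap" using K M_pos x0 p_ge_1 by (auto simp: C_lyap_def)
    qed (use M_pos assms \<phi>'0 F in auto)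
    finally show "p * (p - 1) * (G / ?F) + 2 * p * (\<phi>' y * G) + \<phi>' y * ?F * (\<phi>' y * G) + \<phi>'' y * G * ?F
      \<le> C_lyap * (1 + \<phi>' y * ?F) * S" by (simp add: algebra_simps)
  qed auto
  finally show ?thesis by (simp add: mult_ac)
qed

lemma lyap'_factor:
  assumes "0 \<le> y" "0 < \<epsilon>"
  shows "lyap' \<epsilon> y = exp (\<phi> y) * (y + \<epsilon>) powr (p - 1) * (p + \<phi>' y * (y + \<epsilon>))"
proof -
  have e1: "(y + \<epsilon>) powr p = (y + \<epsilon>) powr (p - 1) * (y + \<epsilon>)" using assms by (intro powr_pred) auto
  show ?thesis unfolding lyap'_def e1 by (simp add: algebra_simps)
qed

lemma lyap'_bounds:
  assumes "0 \<le> y" "0 < \<epsilon>"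
  shows "0 \<le> lyap' \<epsilon> y"
    and "lyap' \<epsilon> y \<le> p * exp (\<phi> y) * (y + \<epsilon>) powr (p - 1) * (1 + \<phi>' y * (y + \<epsilon>))"
proof -
  have nn: "0 \<le> \<phi>' y * (y + \<epsilon>)" using assms \<phi>'_bounds[of y] by auto
  show "0 \<le> lyap' \<epsilon> y" using nn p_ge_1 by (auto simp: lyap'_factor[OF assms])
  have "p + \<phi>' y * (y + \<epsilon>) \<le> p * (1 + \<phi>' y * (y + \<epsilon>))"
    using p_ge_1 mult_right_mono[OF p_ge_1 nn] by (simp add: algebra_simps)
  then have "lyap' \<epsilon> y \<le> exp (\<phi> y) * (y + \<epsilon>) powr (p - 1) * (p * (1 + \<phi>' y * (y + \<epsilon>)))"
    unfolding lyap'_factor[OF assms] by (intro mult_left_mono) auto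
  then show "lyap' \<epsilon> y \<le> p * exp (\<phi> y) * (y + \<epsilon>) powr (p - 1) * (1 + \<phi>' y * (y + \<epsilon>))"
    by (simp add: mult_ac)
qed

text \<open>The shift \<open>\<epsilon>\<close> keeps \<^term>\<open>lyap \<epsilon> (f x)\<close> twice differentiable at the minimiser even when
  \<^prop>\<open>p < 2\<close>.\<close>

lemma lyap_second_order:
  assumes \<epsilon>: "0 < \<epsilon>" "\<epsilon> \<le> 1" and "0 \<le> R"
    and R: "\<And>t. 0 \<le> t \<Longrightarrow> t \<le> 1 \<Longrightarrow> (let y = f (x + t *\<^sub>R D) in
      (C_lyap + p * L) * exp (\<phi> y) * (y + \<epsilon>) powr (p - 1) * ((1 + \<phi>' y * (y + \<epsilon>)) * (norm D)\<^sup>2)) \<le> R"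
  shows "lyap \<epsilon> (f (x + D)) \<le> lyap \<epsilon> (f x) + lyap' \<epsilon> (f x) * (grad f x \<bullet> D) + R"
proof -
  define k where "k t = f (x + t *\<^sub>R D)" for t
  define k' where "k' t = grad f (x + t *\<^sub>R D) \<bullet> D" for t
  define k'' where "k'' t = (hess f (x + t *\<^sub>R D) *v D) \<bullet> D" for t
  have k: "(k has_real_derivative k' t) (at t)" "(k' has_real_derivative k'' t) (at t)" for t
    unfolding k_def[abs_def] k'_def[abs_def] k''_def by (rule f_line_deriv grad_line_deriv)+
  have k0: "0 \<le> k t" for t by (simp add: k_def f_minimum)
  have u1: "((\<lambda>t. lyap \<epsilon> (k t)) has_real_derivative lyap' \<epsilon> (k t) * k' t) (at t)" for t
    using half_line_chain[of "lyap \<epsilon>" "lyap' \<epsilon>" k "k' t" t UNIV] lyap_deriv \<epsilon> k k0 by auto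
  have u2: "((\<lambda>t. lyap' \<epsilon> (k t) * k' t) has_real_derivative
      lyap'' \<epsilon> (k t) * (k' t)\<^sup>2 + lyap' \<epsilon> (k t) * k'' t) (at t)" for t
  proof -
    have "((\<lambda>t. lyap' \<epsilon> (k t)) has_real_derivative lyap'' \<epsilon> (k t) * k' t) (at t)"
      using half_line_chain[of "lyap' \<epsilon>" "lyap'' \<epsilon>" k "k' t" t UNIV] lyap'_deriv \<epsilon> k k0 by auto
    from DERIV_mult[OF this k(2)] show ?thesis by (simp add: algebra_simps power2_eq_square)
  qed
  \<comment> \<open>Two nested mean value theorems, for the function on \<open>[0, 1]\<close> and
    for its derivative on \<open>[0, z]\<close>, serve as a Taylor remainder. The surplus factor
    \<open>z < 1\<close> is dropped at the end because \<open>R\<close> is nonnegative.\<close>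
  obtain z where z: "0 < z" "z < 1"
    and eq1: "lyap \<epsilon> (k 1) - lyap \<epsilon> (k 0) = (1 - 0) * (lyap' \<epsilon> (k z) * k' z)"
    using MVT2[of 0 1 "\<lambda>t. lyap \<epsilon> (k t)" "\<lambda>t. lyap' \<epsilon> (k t) * k' t"] u1 by auto
  obtain s where s: "0 < s" "s < z"
    and eq2: "lyap' \<epsilon> (k z) * k' z - lyap' \<epsilon> (k 0) * k' 0 =
      (z - 0) * (lyap'' \<epsilon> (k s) * (k' s)\<^sup>2 + lyap' \<epsilon> (k s) * k'' s)"
    using MVT2[of 0 z "\<lambda>t. lyap' \<epsilon> (k t) * k' t"
        "\<lambda>t. lyap'' \<epsilon> (k t) * (k' t)\<^sup>2 + lyap' \<epsilon> (k t) * k'' t"] u2 z by auto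
  let ?g = "norm (grad f (x + s *\<^sub>R D))" and ?d = "norm D"
  let ?W = "exp (\<phi> (k s)) * (k s + \<epsilon>) powr (p - 1) * (1 + \<phi>' (k s) * (k s + \<epsilon>)) * ?d\<^sup>2"
  have k'le: "(k' s)\<^sup>2 \<le> ?g\<^sup>2 * ?d\<^sup>2"
    using Cauchy_Schwarz_ineq2[of "grad f (x + s *\<^sub>R D)" D] abs_le_square_iff[of "k' s" "?g * ?d"]
    by (simp add: k'_def power_mult_distrib)
  have \<phi>'0: "0 \<le> \<phi>' (k s)" using \<phi>'_bounds k0 by auto
  have W1: "lyap'' \<epsilon> (k s) * (k' s)\<^sup>2 \<le> C_lyap * ?W"
  proof -
    have "\<phi>' (k s) * (k' s)\<^sup>2 \<le> \<phi>' (k s) * (?g\<^sup>2 * ?d\<^sup>2)" using k'le \<phi>'0 by (rule mult_left_mono)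
    also have "\<dots> \<le> M * ?d\<^sup>2"
      using mult_right_mono[OF grad_bounds(1)[of "x + s *\<^sub>R D"], of "?d\<^sup>2"] by (simp add: k_def mult_ac)
    finally have "\<phi>' (k s) * (k' s)\<^sup>2 \<le> M * ?d\<^sup>2" .
    moreover have "(k' s)\<^sup>2 \<le> M * k s * ?d\<^sup>2"
      using k'le grad_bounds(2)[of "x + s *\<^sub>R D"] mult_right_mono[of "?g\<^sup>2" _ "?d\<^sup>2"]
      unfolding k_def by (meson order_trans zero_le_power2)
    ultimately show ?thesis
      using lyap''_bound[of "k s" \<epsilon> "(k' s)\<^sup>2" "?d\<^sup>2"] k0 \<epsilon> by (simp add: mult_ac)
  qed
  have W2: "lyap' \<epsilon> (k s) * k'' s \<le> p * L * ?W"
  proof -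
    have "lyap' \<epsilon> (k s) * k'' s \<le> lyap' \<epsilon> (k s) * (L * ?d\<^sup>2)"
      using hess_quadratic[of "x + s *\<^sub>R D" D] lyap'_bounds(1)[OF k0 \<epsilon>(1)]
      by (intro mult_left_mono) (auto simp: k''_def)
    also have "\<dots> \<le> (p * exp (\<phi> (k s)) * (k s + \<epsilon>) powr (p - 1) * (1 + \<phi>' (k s) * (k s + \<epsilon>))) * (L * ?d\<^sup>2)"
      using L_pos by (intro mult_right_mono lyap'_bounds(2) k0 \<epsilon>) auto
    finally show ?thesis by (simp add: mult_ac)
  qed
  have "(C_lyap + p * L) * ?W \<le> R"
    using R[of s] s z by (simp add: Let_def k_def mult.assoc)
  then have le: "lyap'' \<epsilon> (k s) * (k' s)\<^sup>2 + lyap' \<epsilon> (k s) * k'' s \<le> R"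
    using W1 W2 by (simp add: algebra_simps)
  have "(z - 0) * (lyap'' \<epsilon> (k s) * (k' s)\<^sup>2 + lyap' \<epsilon> (k s) * k'' s) \<le> (z - 0) * R"
    using le z by (intro mult_left_mono) auto
  also have "\<dots> \<le> 1 * R" using z \<open>0 \<le> R\<close> by (intro mult_right_mono) auto
  finally show ?thesis using eq1 eq2 by (simp add: k_def k'_def)
qed

section \<open>Effect of one noisy step: growth bounds and the drift inequality\<close>

context
  fixes \<Gamma> :: real
  assumes \<Gamma>: "1 \<le> \<Gamma>"
begin

text \<open>\<open>u_max\<close> is the largest coefficient with which the squared noise can enter
  \<open>f\<close> in a step of size at most \<open>\<Gamma>\<close>; it is the argument at which
  \<open>H_Sigma\<close> will be used. \<open>C_grow\<close> and \<open>C_exp\<close> are the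
  resulting constants for the power factor and for the exponent.\<close>

definition u_max :: real where "u_max = 2 * (1 + L) * \<Gamma>\<^sup>2"
definition C_grow :: real where "C_grow = 1 + (1 + u_max) * M + u_max"
definition C_exp :: real where "C_exp = (1 + u_max) * M + \<Phi> * ((1 + u_max) * M) * x0 + \<Phi> * x0"

lemma u_max_nonneg: "0 \<le> u_max" using L_pos by (simp add: u_max_def)

lemma C_grow_ge_1: "1 \<le> C_grow" using u_max_nonneg M_pos by (auto simp: C_grow_def)

lemma step_norm:
  fixes x e :: "real ^ 'd"
  shows "(norm (\<gamma> *\<^sub>R (e - grad f x)))\<^sup>2 \<le> 2 * \<gamma>\<^sup>2 * ((norm (grad f x))\<^sup>2 + (norm e)\<^sup>2)"
proof -
  have "(norm (e - grad f x))\<^sup>2 \<le> (norm e + norm (grad f x))\<^sup>2"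
    by (intro power_mono norm_triangle_ineq4) auto
  also have "\<dots> \<le> 2 * ((norm (grad f x))\<^sup>2 + (norm e)\<^sup>2)"
    using sum_squares_bound[of "norm e" "norm (grad f x)"] by (simp add: power2_sum)
  finally have "\<gamma>\<^sup>2 * (norm (e - grad f x))\<^sup>2 \<le> \<gamma>\<^sup>2 * (2 * ((norm (grad f x))\<^sup>2 + (norm e)\<^sup>2))"
    by (intro mult_left_mono) auto
  moreover have "(norm (\<gamma> *\<^sub>R (e - grad f x)))\<^sup>2 = \<gamma>\<^sup>2 * (norm (e - grad f x))\<^sup>2"
    by (simp add: power_mult_distrib)
  ultimately show ?thesis by (simp only: mult_ac)
qed

text \<open>Everything starts from \<open>f_descent\<close> at the intermediate point. In the second
  bound the noise is split off by \<open>\<phi>_subadd\<close> and the gradient part is absorbed by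
  \<open>\<phi>_shift_bounded\<close>. In the third, the hypothesis on \<open>\<epsilon>\<close>
  turns the additive noise term into a multiple of \<open>\<epsilon>\<close>, which makes the bound
  multiplicative. It is met by \<open>\<epsilon> = 1\<close> for all steps up to
  \<open>\<Gamma>\<close>, and by \<open>\<epsilon> = \<gamma>\<close> for steps at most
  \<open>1\<close>.\<close>

lemma segment_growth:
  fixes x e :: "real ^ 'd"
  assumes \<gamma>: "0 < \<gamma>" "\<gamma> \<le> \<Gamma>" and t: "0 \<le> t" "t \<le> 1"
  defines "y \<equiv> f (x + t *\<^sub>R (\<gamma> *\<^sub>R (e - grad f x)))"
  shows "y \<le> f x + (1 + u_max) * (norm (grad f x))\<^sup>2 + 2 * (1 + L) * \<gamma>\<^sup>2 * (norm e)\<^sup>2"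
    and "\<phi> y \<le> \<phi> (f x) + \<phi> (u_max * (norm e)\<^sup>2) + C_exp"
    and "\<gamma>\<^sup>2 \<le> \<Gamma>\<^sup>2 * \<epsilon> \<Longrightarrow> 0 \<le> \<epsilon> \<Longrightarrow> y + \<epsilon> \<le> C_grow * (f x + \<epsilon>) * (1 + (norm e)\<^sup>2)"
proof -
  let ?D = "\<gamma> *\<^sub>R (e - grad f x)" and ?g = "norm (grad f x)" and ?w = "norm e"
  have tD: "norm (t *\<^sub>R ?D) \<le> norm ?D"
  proof -
    have "norm (t *\<^sub>R ?D) = t * norm ?D" using t by (simp add: abs_mult)
    also have "\<dots> \<le> norm ?D" using t by (intro mult_left_le_one_le) auto
    finally show ?thesis .
  qed
  have \<gamma>2: "\<gamma>\<^sup>2 \<le> \<Gamma>\<^sup>2" using \<gamma> by (intro power_mono) auto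
  have "y \<le> f x + grad f x \<bullet> (t *\<^sub>R ?D) + L * (norm (t *\<^sub>R ?D))\<^sup>2"
    unfolding y_def by (rule f_descent)
  also have "grad f x \<bullet> (t *\<^sub>R ?D) \<le> ?g * norm ?D"
    using norm_cauchy_schwarz[of "grad f x" "t *\<^sub>R ?D"] mult_left_mono[OF tD, of ?g] by simp
  also have "\<dots> \<le> ?g\<^sup>2 + (norm ?D)\<^sup>2"
    using sum_squares_bound[of ?g "norm ?D"] mult_nonneg_nonneg[OF norm_ge_zero norm_ge_zero, of "grad f x" ?D] by linarith
  also have "L * (norm (t *\<^sub>R ?D))\<^sup>2 \<le> L * (norm ?D)\<^sup>2"
    using tD L_pos by (intro mult_left_mono power_mono) auto
  finally have "y \<le> f x + ?g\<^sup>2 + (1 + L) * (norm ?D)\<^sup>2" by (simp add: algebra_simps)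
  also have "(1 + L) * (norm ?D)\<^sup>2 \<le> (1 + L) * (2 * \<gamma>\<^sup>2 * (?g\<^sup>2 + ?w\<^sup>2))"
    using L_pos by (intro mult_left_mono step_norm) auto
  finally have y1: "y \<le> f x + ?g\<^sup>2 + 2 * (1 + L) * \<gamma>\<^sup>2 * ?g\<^sup>2 + 2 * (1 + L) * \<gamma>\<^sup>2 * ?w\<^sup>2"
    by (simp add: algebra_simps)
  have "2 * (1 + L) * \<gamma>\<^sup>2 \<le> u_max"
    unfolding u_max_def using \<gamma>2 L_pos by (intro mult_left_mono) auto
  then have "2 * (1 + L) * \<gamma>\<^sup>2 * ?g\<^sup>2 \<le> u_max * ?g\<^sup>2" "2 * (1 + L) * \<gamma>\<^sup>2 * ?w\<^sup>2 \<le> u_max * ?w\<^sup>2"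
    by (auto intro: mult_right_mono)
  then show y2: "y \<le> f x + (1 + u_max) * ?g\<^sup>2 + 2 * (1 + L) * \<gamma>\<^sup>2 * ?w\<^sup>2"
    using y1 by (simp add: algebra_simps)
  have y3: "y \<le> f x + (1 + u_max) * ?g\<^sup>2 + u_max * ?w\<^sup>2"
    using y2 \<open>2 * (1 + L) * \<gamma>\<^sup>2 * ?w\<^sup>2 \<le> u_max * ?w\<^sup>2\<close> by linarith
  have y0: "0 \<le> y" unfolding y_def by (rule f_minimum)
  have fx: "0 \<le> f x" by (rule f_minimum)
  have "\<phi> y \<le> \<phi> (f x + (1 + u_max) * ?g\<^sup>2 + u_max * ?w\<^sup>2)" by (rule \<phi>_incr(1)[OF y0 y3])
  also have "\<dots> \<le> \<phi> (f x + (1 + u_max) * ?g\<^sup>2) + \<phi> (u_max * ?w\<^sup>2) + \<Phi> * x0"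
    using fx u_max_nonneg by (intro \<phi>_subadd) auto
  also have "\<phi> (f x + (1 + u_max) * ?g\<^sup>2) \<le> \<phi> (f x) + (1 + u_max) * M + \<Phi> * ((1 + u_max) * M) * x0"
  proof (rule \<phi>_shift_bounded)
    show "\<phi>' (f x) * ((1 + u_max) * ?g\<^sup>2) \<le> (1 + u_max) * M"
      using mult_left_mono[OF grad_bounds(1)[of x], of "1 + u_max"] u_max_nonneg by (simp add: mult_ac)
    show "(1 + u_max) * ?g\<^sup>2 \<le> (1 + u_max) * M * f x"
      using mult_left_mono[OF grad_bounds(2)[of x], of "1 + u_max"] u_max_nonneg by (simp add: mult_ac)
  qed (use fx u_max_nonneg M_pos in auto)
  finally show "\<phi> y \<le> \<phi> (f x) + \<phi> (u_max * ?w\<^sup>2) + C_exp" by (simp add: C_exp_def)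
  assume \<epsilon>: "\<gamma>\<^sup>2 \<le> \<Gamma>\<^sup>2 * \<epsilon>" "0 \<le> \<epsilon>"
  let ?B = "f x + \<epsilon>"
  have B: "0 \<le> ?B" "f x \<le> ?B" "\<epsilon> \<le> ?B" using fx \<epsilon> by auto
  have "y + \<epsilon> \<le> ?B + (1 + u_max) * ?g\<^sup>2 + 2 * (1 + L) * \<gamma>\<^sup>2 * ?w\<^sup>2" using y2 by simp
  also have "(1 + u_max) * ?g\<^sup>2 \<le> (1 + u_max) * (M * ?B)"
  proof (rule mult_left_mono)
    have "M * f x \<le> M * ?B" by (intro mult_left_mono) (use B M_pos in linarith)+
    then show "?g\<^sup>2 \<le> M * ?B" using grad_bounds(2)[of x] by linarith
  qed (use u_max_nonneg in simp)
  also have "2 * (1 + L) * \<gamma>\<^sup>2 * ?w\<^sup>2 \<le> u_max * ?B * ?w\<^sup>2"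
  proof (intro mult_right_mono)
    have "2 * (1 + L) * \<gamma>\<^sup>2 \<le> 2 * (1 + L) * (\<Gamma>\<^sup>2 * \<epsilon>)" using \<epsilon> L_pos by (intro mult_left_mono) auto
    also have "\<dots> = u_max * \<epsilon>" by (simp add: u_max_def)
    also have "\<dots> \<le> u_max * ?B" using B u_max_nonneg by (intro mult_left_mono) auto
    finally show "2 * (1 + L) * \<gamma>\<^sup>2 \<le> u_max * ?B" .
  qed auto
  finally have "y + \<epsilon> \<le> (1 + (1 + u_max) * M) * ?B + u_max * ?B * ?w\<^sup>2" by (simp add: algebra_simps)
  also have "\<dots> \<le> C_grow * ?B + C_grow * ?B * ?w\<^sup>2"
    using B u_max_nonneg M_pos by (intro add_mono mult_right_mono) (auto simp: C_grow_def)
  finally show "y + \<epsilon> \<le> C_grow * ?B * (1 + ?w\<^sup>2)" by (simp add: algebra_simps)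
qed

definition noise :: "real ^ 'd \<Rightarrow> real" where
  "noise e = (1 + (norm e)\<^sup>2) powr (p + 1) * exp (\<phi> (u_max * (norm e)\<^sup>2))"

lemma noise_ge_1: "1 \<le> noise e"
proof -
  have "1 \<le> (1 + (norm e)\<^sup>2) powr (p + 1)" using p_ge_1 by (intro ge_one_powr_ge_zero) auto
  moreover have "1 \<le> exp (\<phi> (u_max * (norm e)\<^sup>2))" using u_max_nonneg by (auto intro!: \<phi>_nonneg)
  ultimately show ?thesis unfolding noise_def
    using mult_mono[of 1 _ 1] by fastforce
qed

text \<open>No contraction, but no smallness of the step beyond
  \<open>\<gamma> \<le> \<Gamma>\<close> either; this propagates integrability through the early
  iterations.\<close>

lemma lyap_crude_step:
  assumes "0 < \<gamma>" "\<gamma> \<le> \<Gamma>"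
  shows "lyap 1 (f (x + \<gamma> *\<^sub>R (e - grad f x))) \<le> C_grow powr p * exp C_exp * lyap 1 (f x) * noise e"
proof -
  let ?y = "f (x + \<gamma> *\<^sub>R (e - grad f x))" and ?w = "1 + (norm e)\<^sup>2"
  have g: "\<gamma>\<^sup>2 \<le> \<Gamma>\<^sup>2 * 1" using assms by (simp add: power_mono)
  have y: "\<phi> ?y \<le> \<phi> (f x) + \<phi> (u_max * (norm e)\<^sup>2) + C_exp" "?y + 1 \<le> C_grow * (f x + 1) * ?w"
    using segment_growth(2)[OF assms, of 1 x e] segment_growth(3)[OF assms, of 1 1 x e] g by auto
  have "lyap 1 ?y \<le> (C_grow * (f x + 1) * ?w) powr p * exp (\<phi> (f x) + \<phi> (u_max * (norm e)\<^sup>2) + C_exp)"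
    unfolding lyap_def using y p_ge_1 f_minimum[of "x + \<gamma> *\<^sub>R (e - grad f x)"]
    by (intro mult_mono powr_mono2) auto
  also have "\<dots> = C_grow powr p * exp C_exp * lyap 1 (f x) * (?w powr p * exp (\<phi> (u_max * (norm e)\<^sup>2)))"
    using C_grow_ge_1 f_minimum[of x] by (simp add: powr_mult exp_add lyap_def mult_ac)
  also have "\<dots> \<le> C_grow powr p * exp C_exp * lyap 1 (f x) * noise e"
    unfolding noise_def using lyap_nonneg by (intro mult_left_mono mult_right_mono powr_mono) auto
  finally show ?thesis .
qed

text \<open>The product collects the constants of the second-order term:
  \<open>C_lyap + p * L\<close> from the expansion, \<open>C_grow\<close> and \<open>C_exp\<close>
  from the growth along the segment, \<open>2\<close> from \<open>step_norm\<close>, and the bracket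
  from the gradient estimates. The summand \<open>m\<close> pays for the shift in the drift.\<close>

definition C_step :: real where
  "C_step = (C_lyap + p * L) * C_grow powr p * exp C_exp * 2 * (M + 1 + 8 * M + 3 * \<Phi>) + m"

text \<open>The first-order term splits into a drift, estimated by the third part of
  \<open>grad_bounds\<close>, and a term linear in the noise that is kept exactly, so that it
  vanishes in expectation.\<close>

lemma lyap_step:
  fixes x e :: "real ^ 'd"
  assumes \<gamma>: "0 < \<gamma>" "\<gamma> \<le> 1" "L * \<gamma> \<le> 1 / 2"
  defines "B \<equiv> f x + \<gamma>"
  shows "lyap \<gamma> (f (x + \<gamma> *\<^sub>R (e - grad f x))) \<le> (1 - m * \<gamma>) * lyap \<gamma> (f x)
    + \<gamma> * (lyap' \<gamma> (f x) * (grad f x \<bullet> e))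
    + C_step * \<gamma>\<^sup>2 * (B powr (p - 1) * (1 + B) * exp (\<phi> (f x))) * noise e"
proof -
  let ?D = "\<gamma> *\<^sub>R (e - grad f x)" and ?g = "norm (grad f x)" and ?w = "norm e"
  let ?N = "1 + ?w\<^sup>2" and ?C = "C_lyap + p * L" and ?Q = "B powr (p - 1) * (1 + B) * exp (\<phi> (f x))"
  define R where "R = (C_step - m) * \<gamma>\<^sup>2 * ?Q * noise e"
  have fx: "0 \<le> f x" by (rule f_minimum)
  have B: "0 < B" "f x \<le> B" using fx \<gamma> by (auto simp: B_def)
  have C: "0 \<le> ?C" using C_lyap_nonneg p_ge_1 L_pos by auto
  have N: "1 \<le> ?N" by simp
  have "0 \<le> C_step - m" using C M_pos \<Phi>_nonneg by (simp add: C_step_def)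
  then have R0: "0 \<le> R" using B noise_ge_1[of e] by (simp add: R_def)
  have "lyap \<gamma> (f (x + ?D)) \<le> lyap \<gamma> (f x) + lyap' \<gamma> (f x) * (grad f x \<bullet> ?D) + R"
  proof (rule lyap_second_order)
    fix t :: real assume t: "0 \<le> t" "t \<le> 1"
    define z where "z = x + t *\<^sub>R ?D"
    let ?y = "f z" and ?gz = "norm (grad f z)"
    have y0: "0 \<le> ?y" by (rule f_minimum)
    have \<phi>'0: "0 \<le> \<phi>' ?y" "\<phi>' ?y \<le> \<Phi>" using \<phi>'_bounds y0 by auto
    have "\<gamma>\<^sup>2 \<le> \<Gamma>\<^sup>2 * \<gamma>"
    proof -
      have "\<gamma>\<^sup>2 \<le> 1 * \<gamma>" using \<gamma> by (auto simp: power2_eq_square intro!: mult_right_mono)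
      also have "\<dots> \<le> \<Gamma>\<^sup>2 * \<gamma>" using \<Gamma> \<gamma> by (intro mult_right_mono) auto
      finally show ?thesis .
    qed
    then have F: "?y + \<gamma> \<le> C_grow * B * ?N" and E: "\<phi> ?y \<le> \<phi> (f x) + \<phi> (u_max * ?w\<^sup>2) + C_exp"
      using segment_growth(2)[of \<gamma> t x e] segment_growth(3)[of \<gamma> t \<gamma> x e] \<gamma> \<Gamma> t unfolding z_def B_def by auto
    have D2: "(norm ?D)\<^sup>2 \<le> 2 * \<gamma>\<^sup>2 * (?g\<^sup>2 + ?w\<^sup>2)" by (rule step_norm)
    \<comment> \<open>The derivative \<open>\<phi>'\<close> is evaluated at the intermediate point
      \<open>z\<close>, but the step contains the gradient at \<open>x\<close>. To use the bound on
      \<open>\<phi>' (f z)\<close> times the squared gradient at \<open>z\<close>, the two gradients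
      are compared; \<open>L * \<gamma> \<le> 1 / 2\<close> allows \<open>?g\<close> to be absorbed
      on the left.\<close>
    have gle: "?g \<le> 2 * ?gz + ?w"
    proof -
      have "?g \<le> ?gz + norm (grad f x - grad f z)"
        by (metis norm_triangle_sub)
      also have "norm (grad f x - grad f z) \<le> L * norm (x - z)" by (rule grad_lipschitz)
      also have "norm (x - z) = t * norm ?D" using t by (simp add: z_def abs_mult)
      also have "L * (t * norm ?D) \<le> L * norm ?D"
        using t L_pos by (intro mult_left_mono mult_left_le_one_le) auto
      also have "L * norm ?D = L * \<gamma> * norm (e - grad f x)" using \<gamma> by simp
      also have "\<dots> \<le> 1 / 2 * (?w + ?g)"
        using \<gamma> L_pos by (intro mult_mono norm_triangle_ineq4) auto
      finally show ?thesis by (simp add: field_simps)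
    qed
    have "?g\<^sup>2 \<le> (2 * ?gz + ?w)\<^sup>2" using gle by (intro power_mono) auto
    also have "\<dots> \<le> 8 * ?gz\<^sup>2 + 2 * ?w\<^sup>2"
      using sum_squares_bound[of "2 * ?gz" ?w] by (simp add: power2_sum power_mult_distrib)
    finally have "\<phi>' ?y * ?g\<^sup>2 \<le> \<phi>' ?y * (8 * ?gz\<^sup>2 + 2 * ?w\<^sup>2)" using \<phi>'0 by (intro mult_left_mono)
    then have "\<phi>' ?y * (?g\<^sup>2 + ?w\<^sup>2) \<le> 8 * (\<phi>' ?y * ?gz\<^sup>2) + 3 * (\<phi>' ?y * ?w\<^sup>2)" by (simp add: algebra_simps)
    also have "\<dots> \<le> 8 * M + 3 * (\<Phi> * ?w\<^sup>2)"
      using grad_bounds(1)[of z] \<phi>'0 by (intro add_mono mult_left_mono mult_right_mono) auto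
    also have "\<dots> \<le> (8 * M + 3 * \<Phi>) * ?N"
      using M_pos \<Phi>_nonneg by (simp add: algebra_simps)
    finally have A1: "\<phi>' ?y * (?g\<^sup>2 + ?w\<^sup>2) \<le> (8 * M + 3 * \<Phi>) * ?N" .
    have "M * f x \<le> M * B" using B M_pos by (intro mult_left_mono) auto
    then have "?g\<^sup>2 + ?w\<^sup>2 \<le> M * B + ?w\<^sup>2" using grad_bounds(2)[of x] by linarith
    also have "\<dots> \<le> (M + 1) * (1 + B) * ?N" using M_pos B by (simp add: algebra_simps)
    \<comment> \<open>A factor at least \<open>1\<close> is inserted to match the form of the other
      summand, the one multiplied by \<open>\<phi>' ?y * (?y + \<gamma>)\<close>.\<close>
    also have "\<dots> \<le> (M + 1) * (1 + B) * (C_grow * ?N * ?N)"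
    proof (intro mult_left_mono)
      have "1 * 1 \<le> C_grow * ?N" using C_grow_ge_1 N by (intro mult_mono) auto
      from mult_right_mono[OF this order_trans[OF zero_le_one N]] show "?N \<le> C_grow * ?N * ?N"
        by (simp only: mult_1)
    qed (use M_pos B in auto)
    finally have A2: "?g\<^sup>2 + ?w\<^sup>2 \<le> (M + 1) * (1 + B) * (C_grow * ?N * ?N)" .
    have "(?y + \<gamma>) * (\<phi>' ?y * (?g\<^sup>2 + ?w\<^sup>2)) \<le> (C_grow * B * ?N) * ((8 * M + 3 * \<Phi>) * ?N)"
      using y0 \<gamma> \<phi>'0 B C_grow_ge_1 by (intro mult_mono[OF F A1]) auto
    also have "\<dots> \<le> (8 * M + 3 * \<Phi>) * (1 + B) * (C_grow * ?N * ?N)"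
      using B C_grow_ge_1 M_pos \<Phi>_nonneg mult_right_mono[of B "1 + B" "(8 * M + 3 * \<Phi>) * (C_grow * ?N * ?N)"]
      by (simp add: mult_ac)
    finally have A3: "(1 + \<phi>' ?y * (?y + \<gamma>)) * (?g\<^sup>2 + ?w\<^sup>2) \<le> (M + 1 + 8 * M + 3 * \<Phi>) * (1 + B) * (C_grow * ?N * ?N)"
      using A2 by (simp add: algebra_simps)
    have "(1 + \<phi>' ?y * (?y + \<gamma>)) * (norm ?D)\<^sup>2 \<le> (1 + \<phi>' ?y * (?y + \<gamma>)) * (2 * \<gamma>\<^sup>2 * (?g\<^sup>2 + ?w\<^sup>2))"
      using D2 \<phi>'0 y0 \<gamma> by (intro mult_left_mono) auto
    also have "\<dots> \<le> 2 * \<gamma>\<^sup>2 * ((M + 1 + 8 * M + 3 * \<Phi>) * (1 + B) * (C_grow * ?N * ?N))"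
      using mult_left_mono[OF A3, of "2 * \<gamma>\<^sup>2"] by (simp add: mult_ac)
    finally have A4: "(1 + \<phi>' ?y * (?y + \<gamma>)) * (norm ?D)\<^sup>2 \<le>
      2 * \<gamma>\<^sup>2 * ((M + 1 + 8 * M + 3 * \<Phi>) * (1 + B) * (C_grow * ?N * ?N))" .
    have A5: "exp (\<phi> ?y) \<le> exp (\<phi> (f x)) * exp (\<phi> (u_max * ?w\<^sup>2)) * exp C_exp"
      using E by (simp flip: exp_add)
    have A6: "(?y + \<gamma>) powr (p - 1) \<le> C_grow powr (p - 1) * B powr (p - 1) * ?N powr (p - 1)"
    proof -
      have "(?y + \<gamma>) powr (p - 1) \<le> (C_grow * B * ?N) powr (p - 1)"
        using F y0 \<gamma> p_ge_1 by (intro powr_mono2) auto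
      then show ?thesis using B C_grow_ge_1 by (simp add: powr_mult)
    qed
    have "?C * exp (\<phi> ?y) * (?y + \<gamma>) powr (p - 1) * ((1 + \<phi>' ?y * (?y + \<gamma>)) * (norm ?D)\<^sup>2) \<le>
      ?C * (exp (\<phi> (f x)) * exp (\<phi> (u_max * ?w\<^sup>2)) * exp C_exp) * (C_grow powr (p - 1) * B powr (p - 1) * ?N powr (p - 1))
       * (2 * \<gamma>\<^sup>2 * ((M + 1 + 8 * M + 3 * \<Phi>) * (1 + B) * (C_grow * ?N * ?N)))"
      using C B y0 \<gamma> \<phi>'0 C_grow_ge_1 by (intro mult_mono[OF mult_mono[OF mult_left_mono[OF A5 C] A6] A4]) auto
    also have "\<dots> = ?C * (C_grow powr (p - 1) * C_grow) * exp C_exp * 2 * (M + 1 + 8 * M + 3 * \<Phi>) * \<gamma>\<^sup>2 * ?Q *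
        ((?N powr (p - 1) * ?N * ?N) * exp (\<phi> (u_max * ?w\<^sup>2)))"
      by (simp only: mult_ac)
    also have "C_grow powr (p - 1) * C_grow = C_grow powr p" using powr_pred[of C_grow p] C_grow_ge_1 by simp
    also have "?N powr (p - 1) * ?N * ?N = ?N powr (p + 1)"
      using powr_pred[of ?N p] powr_pred[of ?N "p + 1"] N by simp
    finally show "(let y = f (x + t *\<^sub>R ?D) in
      ?C * exp (\<phi> y) * (y + \<gamma>) powr (p - 1) * ((1 + \<phi>' y * (y + \<gamma>)) * (norm ?D)\<^sup>2)) \<le> R"
      by (simp add: Let_def z_def R_def C_step_def noise_def)
  qed (use \<gamma> R0 in auto)
  also have "lyap' \<gamma> (f x) * (grad f x \<bullet> ?D) = \<gamma> * (lyap' \<gamma> (f x) * (grad f x \<bullet> e)) - \<gamma> * (lyap' \<gamma> (f x) * ?g\<^sup>2)"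
    by (simp add: inner_diff_right power2_norm_eq_inner algebra_simps)
  finally have upper: "lyap \<gamma> (f (x + ?D)) \<le> lyap \<gamma> (f x) +
      (\<gamma> * (lyap' \<gamma> (f x) * (grad f x \<bullet> e)) - \<gamma> * (lyap' \<gamma> (f x) * ?g\<^sup>2)) + R" .
  have drift: "\<gamma> * (lyap' \<gamma> (f x) * ?g\<^sup>2) \<ge> \<gamma> * (m * lyap \<gamma> (f x) - m * \<gamma> * ?Q * noise e)"
  proof (rule mult_left_mono)
    have "lyap' \<gamma> (f x) = exp (\<phi> (f x)) * B powr (p - 1) * (p + \<phi>' (f x) * B)"
      using lyap'_factor[OF fx \<gamma>(1)] by (simp add: B_def)
    moreover have "m * f x \<le> (p + \<phi>' (f x) * B) * ?g\<^sup>2"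
    proof -
      have "m * f x \<le> (1 + \<phi>' (f x) * f x) * ?g\<^sup>2" using grad_bounds(3)[of x] by (simp add: algebra_simps)
      also have "\<dots> \<le> (p + \<phi>' (f x) * B) * ?g\<^sup>2"
        using p_ge_1 B \<phi>'_bounds(1)[OF fx] by (intro mult_right_mono add_mono mult_left_mono) auto
      finally show ?thesis .
    qed
    ultimately have "lyap' \<gamma> (f x) * ?g\<^sup>2 \<ge> exp (\<phi> (f x)) * B powr (p - 1) * (m * f x)"
      using mult_left_mono[of "m * f x" _ "exp (\<phi> (f x)) * B powr (p - 1)"] by (simp add: mult.assoc)
    \<comment> \<open>The drift controls \<open>f x\<close>, not \<open>B\<close>; writing
      \<open>f x = B - \<gamma>\<close> recovers the whole Lyapunov function. Since
      \<open>noise\<close> is at least \<open>1\<close>, the correction fits into the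
      remainder.\<close>
    moreover have "exp (\<phi> (f x)) * B powr (p - 1) * (m * f x) = m * lyap \<gamma> (f x) - m * \<gamma> * (B powr (p - 1) * exp (\<phi> (f x)))"
      using powr_pred[OF B(1), of p] by (simp add: lyap_def B_def algebra_simps)
    moreover have "m * \<gamma> * (B powr (p - 1) * exp (\<phi> (f x))) \<le> m * \<gamma> * (?Q * noise e)"
    proof (intro mult_left_mono)
      have "B powr (p - 1) * 1 * exp (\<phi> (f x)) * 1 \<le> B powr (p - 1) * (1 + B) * exp (\<phi> (f x)) * noise e"
        using B noise_ge_1[of e] by (intro mult_mono mult_nonneg_nonneg) auto
      then show "B powr (p - 1) * exp (\<phi> (f x)) \<le> ?Q * noise e" by simp
    qed (use m_pos \<gamma> in auto)
    ultimately show "m * lyap \<gamma> (f x) - m * \<gamma> * ?Q * noise e \<le> lyap' \<gamma> (f x) * ?g\<^sup>2" by (simp add: mult.assoc)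
  qed (use \<gamma> in auto)
  show ?thesis using upper drift unfolding R_def by (simp add: algebra_simps power2_eq_square)
qed

end

section \<open>Estimates that feed the recursion for the expectations\<close>

lemma lyap_mono:
  assumes "0 \<le> y" "0 \<le> \<epsilon>" "\<epsilon> \<le> \<epsilon>'"
  shows "lyap \<epsilon> y \<le> lyap \<epsilon>' y"
  using assms p_ge_1 by (auto simp: lyap_def intro!: powr_mono2)

lemma lyap_le_lyap_1:
  assumes "0 \<le> y" "0 \<le> \<epsilon>" "\<epsilon> \<le> \<Gamma>" "1 \<le> \<Gamma>"
  shows "lyap \<epsilon> y \<le> \<Gamma> powr p * lyap 1 y"
proof -
  have "y \<le> \<Gamma> * y" using assms mult_right_mono[of 1 \<Gamma> y] by simp
  then have "y + \<epsilon> \<le> \<Gamma> * (y + 1)" using assms by (simp add: algebra_simps)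
  then have "(y + \<epsilon>) powr p \<le> (\<Gamma> * (y + 1)) powr p" using assms p_ge_1 by (intro powr_mono2) auto
  also have "\<dots> = \<Gamma> powr p * (y + 1) powr p" using assms by (simp add: powr_mult)
  finally show ?thesis by (simp add: lyap_def mult.assoc[symmetric])
qed

text \<open>The deterministic factor of the \<open>\<gamma>\<^sup>2\<close> term in
  \<open>lyap_step\<close>. Expanding \<open>1 + (y + \<gamma>)\<close> gives
  \<open>lyap \<gamma> y\<close> plus a term with one power of \<open>y + \<gamma>\<close>
  less.\<close>

definition remainder :: "real \<Rightarrow> real \<Rightarrow> real" where
  "remainder \<gamma> y = (y + \<gamma>) powr (p - 1) * (1 + (y + \<gamma>)) * exp (\<phi> y)"

lemma remainder_nonneg: "0 \<le> y \<Longrightarrow> 0 \<le> \<gamma> \<Longrightarrow> 0 \<le> remainder \<gamma> y"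
  by (auto simp: remainder_def)

lemma remainder_le_lyap_1:
  assumes "0 \<le> y" "0 < \<gamma>" "\<gamma> \<le> 1"
  shows "remainder \<gamma> y \<le> 2 * lyap 1 y"
proof -
  have "(y + \<gamma>) powr (p - 1) * (1 + (y + \<gamma>)) \<le> (y + 1) powr (p - 1) * (2 * (y + 1))"
    using assms p_ge_1 by (intro mult_mono powr_mono2) auto
  also have "\<dots> = 2 * (y + 1) powr p" using powr_pred[of "y + 1" p] assms by simp
  finally show ?thesis unfolding remainder_def lyap_def by (simp add: mult.assoc[symmetric])
qed

text \<open>The part equal to \<open>lyap \<gamma> y\<close> is absorbed because
  \<open>C * \<gamma> \<le> m / 4\<close>. For the lower-order part, with
  \<open>B = y + \<gamma>\<close>: if \<open>B \<ge> \<kappa> * \<gamma>\<close>, one factor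
  \<open>\<gamma>\<close> is traded for \<open>B\<close>; otherwise \<open>B powr (p - 1)\<close> is
  of order \<open>\<gamma> powr (p - 1)\<close> and \<open>\<phi> y\<close> is bounded by
  \<open>\<phi> \<kappa>\<close>.\<close>

lemma remainder_absorb:
  assumes C: "0 \<le> C"
  shows "\<exists>C'\<ge>0. \<forall>\<gamma> y. 0 < \<gamma> \<longrightarrow> \<gamma> \<le> 1 \<longrightarrow> 4 * C * \<gamma> \<le> m \<longrightarrow> 0 \<le> y \<longrightarrow>
    C * \<gamma>\<^sup>2 * remainder \<gamma> y \<le> m / 2 * \<gamma> * lyap \<gamma> y + C' * \<gamma> powr (p + 1)"
proof -
  \<comment> \<open>Chosen so that \<open>4 * C \<le> m * \<kappa>\<close>; the summand
    \<open>1\<close> keeps \<open>\<kappa>\<close> positive when \<open>C = 0\<close>.\<close>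
  define \<kappa> where "\<kappa> = 4 * C / m + 1"
  have \<kappa>: "1 \<le> \<kappa>" "4 * C \<le> m * \<kappa>" using C m_pos by (auto simp: \<kappa>_def field_simps)
  define C' where "C' = C * \<kappa> powr (p - 1) * exp (\<phi> \<kappa>)"
  have C': "0 \<le> C'" using C by (auto simp: C'_def)
  have "C * \<gamma>\<^sup>2 * remainder \<gamma> y \<le> m / 2 * \<gamma> * lyap \<gamma> y + C' * \<gamma> powr (p + 1)"
    if \<gamma>: "0 < \<gamma>" "\<gamma> \<le> 1" "4 * C * \<gamma> \<le> m" and y: "0 \<le> y" for \<gamma> y
  proof -
    define B where "B = y + \<gamma>"
    define E where "E = exp (\<phi> y)"
    have B: "0 < B" "y \<le> B" and E: "0 \<le> E" using \<gamma> y by (auto simp: B_def E_def)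
    have Bp: "B powr p = B powr (p - 1) * B" by (rule powr_pred[OF B(1)])
    have lyap: "lyap \<gamma> y = B powr p * E" by (simp add: lyap_def B_def E_def)
    have split: "C * \<gamma>\<^sup>2 * remainder \<gamma> y = C * \<gamma>\<^sup>2 * (B powr (p - 1) * E) + (C * \<gamma>) * \<gamma> * (B powr p * E)"
      unfolding remainder_def B_def[symmetric] E_def[symmetric] Bp by (simp add: algebra_simps power2_eq_square)
    have "(C * \<gamma>) * \<gamma> * (B powr p * E) \<le> m / 4 * \<gamma> * (B powr p * E)"
      using \<gamma> E by (intro mult_right_mono) auto
    moreover have "C * \<gamma>\<^sup>2 * (B powr (p - 1) * E) \<le> m / 4 * \<gamma> * (B powr p * E) + C' * \<gamma> powr (p + 1)"
    proof (cases "\<kappa> * \<gamma> \<le> B")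
      case True
      have "4 * C * \<gamma> \<le> m * \<kappa> * \<gamma>" using \<kappa> \<gamma> by (intro mult_right_mono) auto
      also have "\<dots> \<le> m * B" using True m_pos by (simp add: mult.assoc)
      finally have "C * \<gamma> \<le> m / 4 * B" by simp
      then have "C * \<gamma> * (\<gamma> * (B powr (p - 1) * E)) \<le> m / 4 * B * (\<gamma> * (B powr (p - 1) * E))"
        using \<gamma> E by (intro mult_right_mono) auto
      moreover have "0 \<le> C' * \<gamma> powr (p + 1)" using C' by simp
      ultimately show ?thesis unfolding Bp by (simp add: power2_eq_square mult_ac)
    next
      case False
      have "B powr (p - 1) \<le> (\<kappa> * \<gamma>) powr (p - 1)" using False B p_ge_1 by (intro powr_mono2) auto
      moreover have "E \<le> exp (\<phi> \<kappa>)"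
      proof -
        have "\<kappa> * \<gamma> \<le> \<kappa>" using \<kappa> \<gamma> by simp
        then show ?thesis using False B y by (auto simp: E_def intro!: \<phi>_incr)
      qed
      ultimately have "C * \<gamma>\<^sup>2 * (B powr (p - 1) * E) \<le> C * \<gamma>\<^sup>2 * ((\<kappa> * \<gamma>) powr (p - 1) * exp (\<phi> \<kappa>))"
        using C E by (intro mult_left_mono mult_mono) auto
      also have "\<dots> = C' * \<gamma> powr (p + 1)"
        using \<kappa> \<gamma> powr_add[of \<gamma> "p - 1" 2] by (simp add: C'_def powr_mult add.commute)
      finally show ?thesis using \<gamma> E m_pos by (auto intro: add_increasing)
    qed
    ultimately show ?thesis unfolding split lyap by (simp add: algebra_simps)
  qed
  with C' show ?thesis by blast
qed

text \<open>Gives the martingale term an integrable majorant. The gradient occurs to the first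
  power, so \<open>le_one_plus_square\<close> reduces it to the quadratic bounds of
  \<open>grad_bounds\<close>.\<close>

lemma lyap'_grad_bound:
  assumes "0 < \<gamma>" "\<gamma> \<le> 1" and "1 \<le> \<Gamma>"
  shows "\<bar>lyap' \<gamma> (f x) * (grad f x \<bullet> e)\<bar> \<le> p * (1 + M + \<Phi> + M) * (remainder \<gamma> (f x) * noise \<Gamma> e)"
proof -
  let ?g = "norm (grad f x)" and ?y = "f x"
  let ?B = "?y + \<gamma>"
  have y: "0 \<le> ?y" by (rule f_minimum)
  have \<phi>'0: "0 \<le> \<phi>' ?y" "\<phi>' ?y \<le> \<Phi>" using \<phi>'_bounds y by auto
  have g: "?g \<le> 1 + ?g\<^sup>2" by (rule le_one_plus_square)
  have "?g \<le> 1 + M * ?B"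
  proof -
    have "M * ?y \<le> M * ?B" using assms M_pos by (intro mult_left_mono) auto
    then show ?thesis using g grad_bounds(2)[of x] by linarith
  qed
  moreover have "\<phi>' ?y * ?g \<le> \<Phi> + M"
  proof -
    have "\<phi>' ?y * ?g \<le> \<phi>' ?y * (1 + ?g\<^sup>2)" using \<phi>'0 g by (intro mult_left_mono)
    then show ?thesis using grad_bounds(1)[of x] \<phi>'0 by (simp add: algebra_simps)
  qed
  then have "(\<phi>' ?y * ?g) * ?B \<le> (\<Phi> + M) * ?B" using y assms by (intro mult_right_mono) auto
  ultimately have "?g + \<phi>' ?y * ?B * ?g \<le> 1 + M * ?B + (\<Phi> + M) * ?B" by (simp add: mult_ac)
  also have "\<dots> \<le> (1 + M + \<Phi> + M) * (1 + ?B)" using M_pos \<Phi>_nonneg y assms by (simp add: algebra_simps)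
  finally have gb: "(1 + \<phi>' ?y * ?B) * ?g \<le> (1 + M + \<Phi> + M) * (1 + ?B)" by (simp add: algebra_simps)
  have en: "norm e \<le> noise \<Gamma> e"
  proof -
    have "norm e \<le> 1 + (norm e)\<^sup>2" by (rule le_one_plus_square)
    also have "\<dots> = (1 + (norm e)\<^sup>2) powr 1 * 1" by simp
    also have "\<dots> \<le> noise \<Gamma> e" unfolding noise_def[OF assms(3)]
      using p_ge_1 u_max_nonneg[OF assms(3)] by (intro mult_mono powr_mono) (auto intro!: \<phi>_nonneg)
    finally show ?thesis .
  qed
  have "\<bar>lyap' \<gamma> ?y * (grad f x \<bullet> e)\<bar> = lyap' \<gamma> ?y * \<bar>grad f x \<bullet> e\<bar>"
    using lyap'_bounds(1)[OF y assms(1)] by (simp add: abs_mult)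
  also have "\<dots> \<le> lyap' \<gamma> ?y * (?g * norm e)"
    using lyap'_bounds(1)[OF y assms(1)] by (intro mult_left_mono Cauchy_Schwarz_ineq2)
  also have "\<dots> \<le> (p * exp (\<phi> ?y) * ?B powr (p - 1) * (1 + \<phi>' ?y * ?B)) * (?g * noise \<Gamma> e)"
    using p_ge_1 \<phi>'0 y assms(1) by (intro mult_mono mult_left_mono lyap'_bounds(2) en) auto
  also have "\<dots> = p * exp (\<phi> ?y) * ?B powr (p - 1) * ((1 + \<phi>' ?y * ?B) * ?g) * noise \<Gamma> e"
    by (simp only: mult_ac)
  also have "\<dots> \<le> p * exp (\<phi> ?y) * ?B powr (p - 1) * ((1 + M + \<Phi> + M) * (1 + ?B)) * noise \<Gamma> e"
    using p_ge_1 noise_ge_1[OF assms(3), of e] gb by (intro mult_right_mono mult_left_mono) auto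
  finally show ?thesis by (simp only: remainder_def mult_ac)
qed

text \<open>\<open>H_Sigma\<close> controls a quantity that degenerates for small noise. When
  \<open>norm e \<le> 1\<close>, the factor \<open>noise\<close> is bounded by a constant
  instead.\<close>

lemma noise_le:
  assumes "1 \<le> \<Gamma>"
  shows "noise \<Gamma> e \<le> 2 powr (p + 1) * (exp (\<phi> (u_max \<Gamma>)) +
    norm e powr (2 * p + 2) * exp (\<phi> (u_max \<Gamma> * (norm e)\<^sup>2)))"
proof (cases "norm e \<le> 1")
  case True
  then have w: "(norm e)\<^sup>2 \<le> 1" by (simp add: power_le_one)
  have "noise \<Gamma> e \<le> 2 powr (p + 1) * exp (\<phi> (u_max \<Gamma>))"
    unfolding noise_def[OF assms] using w p_ge_1 u_max_nonneg[OF assms]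
    by (intro mult_mono powr_mono2) (auto intro!: \<phi>_incr mult_left_le)
  also have "\<dots> \<le> 2 powr (p + 1) * (exp (\<phi> (u_max \<Gamma>)) +
    norm e powr (2 * p + 2) * exp (\<phi> (u_max \<Gamma> * (norm e)\<^sup>2)))"
    by (intro mult_left_mono) auto
  finally show ?thesis .
next
  case False
  then have "1 \<le> (norm e)\<^sup>2" by (simp add: one_le_power)
  then have "(1 + (norm e)\<^sup>2) powr (p + 1) \<le> (2 * (norm e)\<^sup>2) powr (p + 1)"
    using p_ge_1 by (intro powr_mono2) auto
  also have "\<dots> = 2 powr (p + 1) * norm e powr (2 * p + 2)"
    using False by (simp add: powr_mult powr_powr algebra_simps flip: powr_numeral)
  finally have "noise \<Gamma> e \<le> 2 powr (p + 1) * norm e powr (2 * p + 2) * exp (\<phi> (u_max \<Gamma> * (norm e)\<^sup>2))"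
    unfolding noise_def[OF assms] by (intro mult_right_mono) auto
  also have "\<dots> \<le> 2 powr (p + 1) * (exp (\<phi> (u_max \<Gamma>)) +
    norm e powr (2 * p + 2) * exp (\<phi> (u_max \<Gamma> * (norm e)\<^sup>2)))"
    by (simp add: mult.assoc)
  finally show ?thesis .
qed

end

section \<open>A recursive inequality with polynomial steps\<close>

text \<open>Induction on \<open>a n \<le> K * \<gamma> n powr p\<close>. The ratio of consecutive
  values of \<open>\<gamma> n powr p\<close> is at most \<open>exp (\<beta> * p / n)\<close>, and
  \<open>1 / n\<close> is negligible against \<open>\<gamma> (Suc n)\<close>. Hence lowering the
  target costs less than half of the contraction, and the other half pays for the forcing
  term.\<close>

lemma powr_step_recursion:
  fixes a \<gamma> :: "nat \<Rightarrow> real"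
  assumes \<gamma>: "\<And>n. n \<ge> 1 \<Longrightarrow> \<gamma> n = \<gamma>0 * real n powr (- \<beta>)" "0 < \<gamma>0" "0 < \<beta>" "\<beta> < 1"
    and p: "0 \<le> p" and \<mu>: "0 < \<mu>" and C: "0 \<le> C"
    and a: "\<And>n. 0 \<le> a n"
    and rec: "\<And>n. n \<ge> n0 \<Longrightarrow> a (Suc n) \<le> (1 - \<mu> * \<gamma> (Suc n)) * a n + C * \<gamma> (Suc n) powr (p + 1)"
  shows "\<exists>C'. \<forall>n\<ge>1. a n \<le> C' * \<gamma> n powr p"
proof -
  have \<gamma>_pos: "0 < \<gamma> n" if "n \<ge> 1" for n using that \<gamma>(1)[OF that] \<gamma>(2) by simp
  \<comment> \<open>The place where \<open>\<beta> < 1\<close> is decisive. The threshold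
    \<open>4 * \<beta> * p / \<mu>\<close> below gives \<open>\<beta> * p / n \<le> x / 4\<close>
    with \<open>x = \<mu> * \<gamma> (Suc n)\<close>, and \<open>2 / (3 * \<mu>)\<close> gives
    \<open>x < 2 / 3\<close>, which is what \<open>1 / (1 + 3 * x / 4) \<le> 1 - x / 2\<close>
    requires.\<close>
  have "filterlim (\<lambda>n. real n * (\<gamma>0 * real (Suc n) powr (- \<beta>))) at_top sequentially"
    using \<gamma>(2-4) by real_asymp
  then have ev1: "\<forall>\<^sub>F n in sequentially. real n * (\<gamma>0 * real (Suc n) powr (- \<beta>)) \<ge> 4 * \<beta> * p / \<mu>"
    by (auto simp: filterlim_at_top)
  have "(\<lambda>n. \<gamma>0 * real (Suc n) powr (- \<beta>)) \<longlonglongrightarrow> 0" using \<gamma>(2-4) by real_asymp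
  then have ev2: "\<forall>\<^sub>F n in sequentially. \<gamma>0 * real (Suc n) powr (- \<beta>) < 2 / (3 * \<mu>)"
    by (rule order_tendstoD) (use \<mu> in auto)
  obtain N where N: "N \<ge> n0" "N \<ge> 1"
    "\<And>n. n \<ge> N \<Longrightarrow> 4 * \<beta> * p / \<mu> \<le> real n * \<gamma> (Suc n)" "\<And>n. n \<ge> N \<Longrightarrow> \<gamma> (Suc n) < 2 / (3 * \<mu>)"
  proof -
    obtain N1 N2 where "\<And>n. n \<ge> N1 \<Longrightarrow> real n * (\<gamma>0 * real (Suc n) powr (- \<beta>)) \<ge> 4 * \<beta> * p / \<mu>"
      "\<And>n. n \<ge> N2 \<Longrightarrow> \<gamma>0 * real (Suc n) powr (- \<beta>) < 2 / (3 * \<mu>)"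
      using ev1 ev2 unfolding eventually_sequentially by blast
    then show ?thesis using \<gamma>(1) by (intro that[of "Max {n0, 1, N1, N2}"]) auto
  qed
  have ratio: "\<gamma> n powr p * (1 - \<mu> * \<gamma> (Suc n)) \<le> \<gamma> (Suc n) powr p * (1 - \<mu> / 2 * \<gamma> (Suc n))"
    if "n \<ge> N" for n
  proof -
    have n: "n \<ge> 1" using that N by simp
    define x where "x = \<mu> * \<gamma> (Suc n)"
    have x: "0 < x" "x < 2 / 3" using \<gamma>_pos[of "Suc n"] N(4)[OF that] \<mu> by (auto simp: x_def field_simps)
    have "real (Suc n) / real n = 1 + 1 / real n" using n by (simp add: field_simps)
    also have "\<dots> \<le> exp (1 / real n)" by (rule exp_ge_add_one_self)
    finally have "(real (Suc n) / real n) powr (\<beta> * p) \<le> exp (1 / real n) powr (\<beta> * p)"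
      using p \<gamma> by (intro powr_mono2) auto
    also have "\<dots> = exp (\<beta> * p / real n)" by (simp add: powr_def)
    also have "\<dots> \<le> exp (x / 4)"
      using N(3)[OF that] \<mu> n by (simp add: x_def field_simps)
    finally have r: "(real (Suc n) / real n) powr (\<beta> * p) \<le> exp (x / 4)" .
    have "\<gamma> n = \<gamma> (Suc n) * (real (Suc n) / real n) powr \<beta>"
      using n \<gamma>(1)[of n] \<gamma>(1)[of "Suc n"] by (simp add: powr_divide powr_minus field_simps)
    then have "\<gamma> n powr p = \<gamma> (Suc n) powr p * (real (Suc n) / real n) powr (\<beta> * p)"
      using \<gamma>_pos[of "Suc n"] by (simp add: powr_mult powr_powr)
    also have "\<dots> \<le> \<gamma> (Suc n) powr p * exp (x / 4)" using r by (intro mult_left_mono) auto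
    finally have "\<gamma> n powr p * (1 - x) \<le> \<gamma> (Suc n) powr p * exp (x / 4) * (1 - x)"
      using x by (intro mult_right_mono) auto
    also have "\<dots> \<le> \<gamma> (Suc n) powr p * exp (x / 4) * exp (- x)"
      using exp_ge_add_one_self[of "- x"] by (intro mult_left_mono) auto
    also have "\<dots> = \<gamma> (Suc n) powr p * inverse (exp (3 * x / 4))"
      by (simp flip: exp_add exp_minus add: mult.assoc)
    also have "inverse (exp (3 * x / 4)) \<le> inverse (1 + 3 * x / 4)"
      using x by (intro le_imp_inverse_le exp_ge_add_one_self) auto
    also have "inverse (1 + 3 * x / 4) \<le> 1 - x / 2"
    proof -
      have "3 * x * x \<le> 2 * x" using x by auto
      then have "1 \<le> (1 - x / 2) * (1 + 3 * x / 4)" by (simp add: algebra_simps)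
      then show ?thesis using x by (simp add: field_simps)
    qed
    finally show ?thesis by (simp add: x_def mult_left_mono)
  qed
  \<comment> \<open>The first entry starts the induction at \<open>N\<close>; the second lets the
    spare contraction \<open>\<mu> / 2\<close> dominate \<open>C\<close>.\<close>
  define K where "K = max (a N / \<gamma> N powr p) (2 * C / \<mu>)"
  have K: "0 \<le> K" "2 * C / \<mu> \<le> K" "a N \<le> K * \<gamma> N powr p"
  proof -
    have "0 \<le> 2 * C / \<mu>" using C \<mu> by simp
    then show "0 \<le> K" "2 * C / \<mu> \<le> K" by (auto simp: K_def)
    have "a N / \<gamma> N powr p \<le> K" by (simp add: K_def)
    moreover have "0 < \<gamma> N powr p" using \<gamma>_pos[OF N(2)] by simp
    ultimately show "a N \<le> K * \<gamma> N powr p" by (simp add: pos_divide_le_eq)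
  qed
  have large: "a n \<le> K * \<gamma> n powr p" if "n \<ge> N" for n
    using that
  proof (induction n rule: dec_induct)
    case base
    show ?case by (rule K)
  next
    case (step n)
    define g where "g = \<gamma> (Suc n)"
    have g: "0 < g" "\<mu> * g \<le> 1" using \<gamma>_pos[of "Suc n"] N(4)[of n] \<mu> step by (auto simp: g_def field_simps)
    have "a (Suc n) \<le> (1 - \<mu> * g) * a n + C * g powr (p + 1)"
      using rec[of n] step N by (simp add: g_def)
    also have "(1 - \<mu> * g) * a n \<le> (1 - \<mu> * g) * (K * \<gamma> n powr p)"
      using step g by (intro mult_left_mono) auto
    also have "\<dots> = K * (\<gamma> n powr p * (1 - \<mu> * g))" by simp
    also have "\<dots> \<le> K * (g powr p * (1 - \<mu> / 2 * g))"
      using ratio[of n] step K by (intro mult_left_mono) (auto simp: g_def)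
    also have "C * g powr (p + 1) = g powr p * (C * g)" using g by (simp add: powr_add)
    also have "g powr p * (C * g) \<le> g powr p * (K * (\<mu> / 2 * g))"
    proof (intro mult_left_mono)
      have "C \<le> K * (\<mu> / 2)" using K(2) \<mu> by (simp add: field_simps)
      then have "C * g \<le> (K * (\<mu> / 2)) * g" using g by (intro mult_right_mono) auto
      then show "C * g \<le> K * (\<mu> / 2 * g)" by (simp only: mult.assoc)
    qed auto
    finally show ?case by (simp add: g_def algebra_simps)
  qed
  \<comment> \<open>The finite sum covers the indices below \<open>N\<close>, where no recursion is
    available.\<close>
  define C' where "C' = K + (\<Sum>n\<in>{1..N}. a n / \<gamma> n powr p)"
  have "a n \<le> C' * \<gamma> n powr p" if n: "n \<ge> 1" for n
  proof -
    have gp: "0 < \<gamma> n powr p" using \<gamma>_pos[OF n] by simp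
    have nonneg: "0 \<le> (\<Sum>n\<in>{1..N}. a n / \<gamma> n powr p)" using a by (intro sum_nonneg) auto
    have "a n / \<gamma> n powr p \<le> C'"
    proof (cases "n \<ge> N")
      case True
      then have "a n / \<gamma> n powr p \<le> K" using large gp by (simp add: pos_divide_le_eq)
      then show ?thesis using nonneg by (simp add: C'_def)
    next
      case False
      then have "a n / \<gamma> n powr p \<le> (\<Sum>n\<in>{1..N}. a n / \<gamma> n powr p)"
        using n a by (intro member_le_sum) auto
      then show ?thesis using K by (simp add: C'_def)
    qed
    then show ?thesis using gp by (simp add: pos_divide_le_eq)
  qed
  then show ?thesis by blast
qed

section \<open>Stochastic gradient sequences\<close>

text \<open>The iterate as a deterministic function of the noise sequence. It reads only the
  coordinates \<open>1\<close> to \<open>n\<close>, so independence of the noise variables passes to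
  the iterates.\<close>

primrec sgd_iterate ::
  "((real ^ 'd) \<times> (real ^ 'k) \<Rightarrow> real ^ 'd) \<Rightarrow> (nat \<Rightarrow> real) \<Rightarrow> real ^ 'd \<Rightarrow> nat \<Rightarrow>
    (nat \<Rightarrow> real ^ 'k) \<Rightarrow> real ^ 'd" where
  "sgd_iterate \<Lambda> \<gamma> a 0 z = a"
| "sgd_iterate \<Lambda> \<gamma> a (Suc n) z =
    sgd_iterate \<Lambda> \<gamma> a n z - \<gamma> (Suc n) *\<^sub>R \<Lambda> (sgd_iterate \<Lambda> \<gamma> a n z, z (Suc n))"

lemma sgd_iterate_measurable:
  assumes [measurable]: "\<Lambda> \<in> borel_measurable (borel \<Otimes>\<^sub>M borel)"
  shows "n \<le> N \<Longrightarrow> sgd_iterate \<Lambda> \<gamma> a n \<in> borel_measurable (PiM {1..N} (\<lambda>_. borel))"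
proof (induction n)
  case 0
  have "sgd_iterate \<Lambda> \<gamma> a 0 = (\<lambda>_. a)" by auto
  then show ?case by (simp del: sgd_iterate.simps)
next
  case (Suc n)
  have [measurable]: "sgd_iterate \<Lambda> \<gamma> a n \<in> borel_measurable (PiM {1..N} (\<lambda>_. borel))"
    "(\<lambda>z. z (Suc n)) \<in> borel_measurable (PiM {1..N} (\<lambda>_. borel))"
    using Suc by (auto intro!: measurable_component_singleton)
  show ?case unfolding sgd_iterate.simps by measurable
qed

lemma sgd_iterate_restrict: "n \<le> N \<Longrightarrow> sgd_iterate \<Lambda> \<gamma> a n (restrict z {1..N}) = sgd_iterate \<Lambda> \<gamma> a n z"
  by (induction n) auto

locale sgd = prob_space P
  for P :: "'w measure" +
  fixes f :: "real ^ 'd \<Rightarrow> real" and \<Lambda> :: "(real ^ 'd) \<times> (real ^ 'k) \<Rightarrow> real ^ 'd"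
    and Z :: "nat \<Rightarrow> 'w \<Rightarrow> real ^ 'k" and \<gamma> :: "nat \<Rightarrow> real"
    and \<theta> \<Delta>M :: "nat \<Rightarrow> 'w \<Rightarrow> real ^ 'd" and \<theta>0 :: "real ^ 'd"
  assumes \<Lambda>_measurable [measurable]: "\<Lambda> \<in> borel_measurable (borel \<Otimes>\<^sub>M borel)"
    and Z_indep: "indep_vars (\<lambda>_. borel) Z {1..}"
    and Z_ident: "n \<ge> 1 \<Longrightarrow> distr P borel (Z n) = distr P borel (Z 1)"
    and \<Lambda>_integrable: "integrable P (\<lambda>\<omega>. \<Lambda> (x, Z 1 \<omega>))"
    and \<Lambda>_mean: "grad f x = (\<integral>\<omega>. \<Lambda> (x, Z 1 \<omega>) \<partial>P)"
    and \<theta>_init: "\<omega> \<in> space P \<Longrightarrow> \<theta> 0 \<omega> = \<theta>0"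
    and \<theta>_rec: "\<omega> \<in> space P \<Longrightarrow>
      \<theta> (Suc n) \<omega> = \<theta> n \<omega> - \<gamma> (Suc n) *\<^sub>R \<Lambda> (\<theta> n \<omega>, Z (Suc n) \<omega>)"
    and \<Delta>M: "\<omega> \<in> space P \<Longrightarrow>
      \<Delta>M (Suc n) \<omega> = grad f (\<theta> n \<omega>) - \<Lambda> (\<theta> n \<omega>, Z (Suc n) \<omega>)"
    and f_measurable [measurable]: "f \<in> borel_measurable borel"
    and grad_measurable [measurable]: "grad f \<in> borel_measurable borel"
begin

lemma Z_measurable [measurable]: "Z (Suc n) \<in> borel_measurable P"
  using Z_indep unfolding indep_vars_def by auto

lemma \<theta>_eq: "\<omega> \<in> space P \<Longrightarrow> \<theta> n \<omega> = sgd_iterate \<Lambda> \<gamma> \<theta>0 n (\<lambda>i. Z i \<omega>)"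
  by (induction n) (auto simp: \<theta>_init \<theta>_rec)

lemma \<theta>_measurable [measurable]: "\<theta> n \<in> borel_measurable P"
proof (induction n)
  case 0
  then show ?case using measurable_cong[of P "\<theta> 0" "\<lambda>_. \<theta>0" borel] \<theta>_init by auto
next
  case (Suc n)
  note [measurable] = this
  have "(\<lambda>\<omega>. \<theta> n \<omega> - \<gamma> (Suc n) *\<^sub>R \<Lambda> (\<theta> n \<omega>, Z (Suc n) \<omega>)) \<in> borel_measurable P" by measurable
  then show ?case by (subst measurable_cong[OF \<theta>_rec])
qed

lemma \<Delta>M_measurable [measurable]: "\<Delta>M (Suc n) \<in> borel_measurable P"
proof -
  have "(\<lambda>\<omega>. grad f (\<theta> n \<omega>) - \<Lambda> (\<theta> n \<omega>, Z (Suc n) \<omega>)) \<in> borel_measurable P" by measurable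
  then show ?thesis by (subst measurable_cong[OF \<Delta>M])
qed

lemma \<theta>_step: "\<omega> \<in> space P \<Longrightarrow>
    \<theta> (Suc n) \<omega> = \<theta> n \<omega> + \<gamma> (Suc n) *\<^sub>R (\<Delta>M (Suc n) \<omega> - grad f (\<theta> n \<omega>))"
  by (simp add: \<theta>_rec \<Delta>M)

text \<open>\<open>\<theta> n\<close> is a measurable function of the block
  \<open>Z 1, ..., Z n\<close>, which is independent of the block consisting of
  \<open>Z (Suc n)\<close>. The product law of the blocks is pushed forward, and identical
  distribution replaces \<open>Z (Suc n)\<close> by \<open>Z 1\<close>. For \<open>n = 0\<close> the
  first block is empty and \<open>\<theta> 0\<close> is constant.\<close>

lemma joint_distr:
  "distr P (borel \<Otimes>\<^sub>M borel) (\<lambda>\<omega>. (\<theta> n \<omega>, Z (Suc n) \<omega>)) = distr P borel (\<theta> n) \<Otimes>\<^sub>M distr P borel (Z 1)"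
proof -
  define \<theta>' where "\<theta>' \<omega> = sgd_iterate \<Lambda> \<gamma> \<theta>0 n (\<lambda>i. Z i \<omega>)" for \<omega>
  let ?S = "PiM {1..n} (\<lambda>_. borel :: (real ^ 'k) measure)" and ?T = "PiM {Suc n} (\<lambda>_. borel :: (real ^ 'k) measure)"
  let ?X = "\<lambda>\<omega>. restrict (\<lambda>i. Z i \<omega>) {1..n}" and ?Y = "\<lambda>\<omega>. restrict (\<lambda>i. Z i \<omega>) {Suc n}"
  let ?F = "sgd_iterate \<Lambda> \<gamma> \<theta>0 n" and ?G = "\<lambda>z. z (Suc n) :: real ^ 'k"
  have indep: "indep_var ?S ?X ?T ?Y"
    by (rule indep_var_restrict[OF Z_indep]) auto
  have F: "?F \<in> measurable ?S borel" by (rule sgd_iterate_measurable[OF \<Lambda>_measurable order_refl])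
  have G: "?G \<in> measurable ?T borel" by (rule measurable_component_singleton) simp
  have X: "?X \<in> measurable P ?S" and Y: "?Y \<in> measurable P ?T"
    using indep indep_var_rv1 indep_var_rv2 by blast+
  have FX: "?F \<circ> ?X = \<theta>'" by (auto simp: \<theta>'_def fun_eq_iff sgd_iterate_restrict simp del: One_nat_def)
  have GY: "?G \<circ> ?Y = Z (Suc n)" by (auto simp: fun_eq_iff)
  have "distr P borel \<theta>' \<Otimes>\<^sub>M distr P borel (Z (Suc n)) =
      distr (distr P ?S ?X) borel ?F \<Otimes>\<^sub>M distr (distr P ?T ?Y) borel ?G"
    by (simp only: distr_distr[OF F X] distr_distr[OF G Y] FX GY)
  also have "\<dots> = distr (distr P ?S ?X \<Otimes>\<^sub>M distr P ?T ?Y) (borel \<Otimes>\<^sub>M borel) (\<lambda>(x, y). (?F x, ?G y))"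
  proof (rule pair_measure_distr)
    have "prob_space (distr (distr P ?T ?Y) borel ?G)"
      by (intro prob_space.prob_space_distr[OF prob_space_distr[OF Y]]) (use G in simp)
    then show "sigma_finite_measure (distr (distr P ?T ?Y) borel ?G)"
      by (rule prob_space_imp_sigma_finite)
  qed (use F G in simp_all)
  also have "distr P ?S ?X \<Otimes>\<^sub>M distr P ?T ?Y = distr P (?S \<Otimes>\<^sub>M ?T) (\<lambda>\<omega>. (?X \<omega>, ?Y \<omega>))"
    using indep by (simp add: indep_var_distribution_eq)
  also have "distr \<dots> (borel \<Otimes>\<^sub>M borel) (\<lambda>(x, y). (?F x, ?G y)) =
      distr P (borel \<Otimes>\<^sub>M borel) (\<lambda>\<omega>. (\<theta>' \<omega>, Z (Suc n) \<omega>))"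
    by (subst distr_distr) (use F G X Y FX GY in \<open>auto simp: fun_eq_iff comp_def simp del: One_nat_def\<close>)
  finally have "distr P borel \<theta>' \<Otimes>\<^sub>M distr P borel (Z (Suc n)) =
      distr P (borel \<Otimes>\<^sub>M borel) (\<lambda>\<omega>. (\<theta>' \<omega>, Z (Suc n) \<omega>))" .
  moreover have "distr P borel \<theta>' = distr P borel (\<theta> n)"
    by (rule distr_cong) (auto simp: \<theta>_eq \<theta>'_def)
  moreover have "distr P (borel \<Otimes>\<^sub>M borel) (\<lambda>\<omega>. (\<theta>' \<omega>, Z (Suc n) \<omega>)) =
      distr P (borel \<Otimes>\<^sub>M borel) (\<lambda>\<omega>. (\<theta> n \<omega>, Z (Suc n) \<omega>))"
    by (rule distr_cong) (auto simp: \<theta>_eq \<theta>'_def)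
  ultimately show ?thesis using Z_ident[of "Suc n"] by simp
qed

text \<open>Fubini under the product law of \<open>joint_distr\<close>, in place of a conditional
  expectation: for fixed \<open>x\<close> the inner integral is \<open>h x\<close> times the mean of
  \<open>grad f x - \<Lambda> (x, Z 1)\<close>, which is zero.\<close>

lemma martingale_increment:
  assumes [measurable]: "h \<in> borel_measurable borel"
    and int: "integrable P (\<lambda>\<omega>. h (\<theta> n \<omega>) \<bullet> \<Delta>M (Suc n) \<omega>)"
  shows "(\<integral>\<omega>. h (\<theta> n \<omega>) \<bullet> \<Delta>M (Suc n) \<omega> \<partial>P) = 0"
proof -
  define q where "q = (\<lambda>(x, z). h x \<bullet> (grad f x - \<Lambda> (x, z)))"
  have q_meas [measurable]: "q \<in> borel_measurable (borel \<Otimes>\<^sub>M borel)" unfolding q_def by measurable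
  have pair [measurable]: "(\<lambda>\<omega>. (\<theta> n \<omega>, Z (Suc n) \<omega>)) \<in> measurable P (borel \<Otimes>\<^sub>M borel)" by measurable
  have [measurable]: "Z 1 \<in> borel_measurable P" using Z_measurable[of 0] by simp
  have q: "h (\<theta> n \<omega>) \<bullet> \<Delta>M (Suc n) \<omega> = q (\<theta> n \<omega>, Z (Suc n) \<omega>)" if "\<omega> \<in> space P" for \<omega>
    using that by (simp add: q_def \<Delta>M)
  interpret T: prob_space "distr P borel (\<theta> n)" by (rule prob_space_distr) simp
  interpret D: prob_space "distr P borel (Z 1)" by (rule prob_space_distr) simp
  interpret TD: pair_sigma_finite "distr P borel (\<theta> n)" "distr P borel (Z 1)" ..
  have "integrable P (\<lambda>\<omega>. q (\<theta> n \<omega>, Z (Suc n) \<omega>))"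
    using int by (rule Bochner_Integration.integrable_cong[THEN iffD1, rotated 2]) (auto simp: q)
  then have int': "integrable (distr P borel (\<theta> n) \<Otimes>\<^sub>M distr P borel (Z 1)) q"
    unfolding joint_distr[symmetric] by (subst integrable_distr_eq) auto
  have "(\<integral>\<omega>. h (\<theta> n \<omega>) \<bullet> \<Delta>M (Suc n) \<omega> \<partial>P) = (\<integral>\<omega>. q (\<theta> n \<omega>, Z (Suc n) \<omega>) \<partial>P)"
    by (rule Bochner_Integration.integral_cong) (auto simp: q)
  also have "\<dots> = integral\<^sup>L (distr P borel (\<theta> n) \<Otimes>\<^sub>M distr P borel (Z 1)) q"
    unfolding joint_distr[symmetric] by (subst integral_distr) auto
  also have "\<dots> = (\<integral>x. (\<integral>z. q (x, z) \<partial>distr P borel (Z 1)) \<partial>distr P borel (\<theta> n))"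
    using TD.integral_fst'[OF int'] by simp
  also have "\<dots> = (\<integral>x. 0 \<partial>distr P borel (\<theta> n))"
  proof (rule Bochner_Integration.integral_cong[OF refl])
    fix x
    have "(\<integral>z. q (x, z) \<partial>distr P borel (Z 1)) = (\<integral>\<omega>. h x \<bullet> (grad f x - \<Lambda> (x, Z 1 \<omega>)) \<partial>P)"
      by (subst integral_distr) (auto simp: q_def)
    also have "\<dots> = h x \<bullet> (\<integral>\<omega>. grad f x - \<Lambda> (x, Z 1 \<omega>) \<partial>P)"
      using \<Lambda>_integrable by (intro integral_inner_right) auto
    also have "(\<integral>\<omega>. grad f x - \<Lambda> (x, Z 1 \<omega>) \<partial>P) = 0"
      using \<Lambda>_integrable by (simp add: \<Lambda>_mean prob_space)
    finally show "(\<integral>z. q (x, z) \<partial>distr P borel (Z 1)) = 0" by simp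
  qed
  finally show ?thesis by simp
qed

section \<open>Conditional expectations given the past\<close>

lemma past_subalgebra: "subalgebra P (past P \<theta> n)"
proof -
  let ?G = "\<Union>i\<in>{1..n}. {\<theta> i -` A \<inter> space P |A. A \<in> sets borel}"
  have "?G \<subseteq> sets P" by (auto intro!: measurable_sets)
  moreover from this have "?G \<subseteq> Pow (space P)" using sets.sets_into_space by blast
  ultimately show ?thesis unfolding past_def subalgebra_def
    by (auto intro!: sets.sigma_sets_subset)
qed

lemma \<theta>_past_measurable: "\<theta> n \<in> borel_measurable (past P \<theta> n)"
proof (cases "n = 0")
  \<comment> \<open>No generator of the past refers to \<open>\<theta> 0\<close>; it is measurable
    because it is constant.\<close>
  case True
  have "space (past P \<theta> n) = space P" using past_subalgebra by (auto simp: subalgebra_def)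
  then show ?thesis
    using True measurable_cong[of "past P \<theta> n" "\<theta> 0" "\<lambda>_. \<theta>0" borel] \<theta>_init by auto
next
  case False
  let ?G = "\<Union>i\<in>{1..n}. {\<theta> i -` A \<inter> space P |A. A \<in> sets borel}"
  have G: "?G \<subseteq> Pow (space P)" by auto
  have sp: "space (past P \<theta> n) = space P" using past_subalgebra by (auto simp: subalgebra_def)
  show ?thesis
  proof (rule measurableI)
    fix A :: "(real ^ 'd) set" assume "A \<in> sets borel"
    then have "\<theta> n -` A \<inter> space P \<in> ?G" using False by (intro UN_I[of n]) auto
    then show "\<theta> n -` A \<inter> space (past P \<theta> n) \<in> sets (past P \<theta> n)"
      unfolding sp unfolding past_def using G by (auto simp: sets_measure_of)
  qed auto
qed

lemma cond_exp_bound: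
  assumes [measurable]: "g \<in> borel_measurable P" "\<psi> \<in> borel_measurable borel"
    and "AE \<omega> in P. nn_cond_exp P (past P \<theta> n) g \<omega> \<le> c"
  shows "(\<integral>\<^sup>+\<omega>. \<psi> (\<theta> n \<omega>) * g \<omega> \<partial>P) \<le> c * (\<integral>\<^sup>+\<omega>. \<psi> (\<theta> n \<omega>) \<partial>P)"
proof -
  interpret S: finite_measure_subalgebra P "past P \<theta> n"
    by unfold_locales (rule past_subalgebra)
  have "(\<lambda>\<omega>. \<psi> (\<theta> n \<omega>)) \<in> borel_measurable (past P \<theta> n)"
    using \<theta>_past_measurable assms(2) by (rule measurable_compose)
  then have "(\<integral>\<^sup>+\<omega>. \<psi> (\<theta> n \<omega>) * g \<omega> \<partial>P) = (\<integral>\<^sup>+\<omega>. \<psi> (\<theta> n \<omega>) * nn_cond_exp P (past P \<theta> n) g \<omega> \<partial>P)"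
    using S.nn_cond_exp_intg[of "\<lambda>\<omega>. \<psi> (\<theta> n \<omega>)" g] by simp
  also have "\<dots> \<le> (\<integral>\<^sup>+\<omega>. c * \<psi> (\<theta> n \<omega>) \<partial>P)"
    using assms(3) by (intro nn_integral_mono_AE) (auto elim!: eventually_mono intro!: mult_mono simp: mult.commute[of c])
  also have "\<dots> = c * (\<integral>\<^sup>+\<omega>. \<psi> (\<theta> n \<omega>) \<partial>P)" by (rule nn_integral_cmult) measurable
  finally show ?thesis .
qed

text \<open>The same \<open>\<rho>\<close> serves the smaller profile, by monotonicity of
  conditional expectation. Continuity is there to make the integrands measurable. Part (iii) needs
  this to exchange its profile for a concave one.\<close>

lemma H_Sigma_antimono:
  assumes "H_Sigma P \<theta> \<Delta>M \<phi> p"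
    and le: "\<And>t. 0 \<le> t \<Longrightarrow> \<phi>1 t \<le> \<phi> t" and cont: "continuous_on {0..} \<phi>" "continuous_on {0..} \<phi>1"
  shows "H_Sigma P \<theta> \<Delta>M \<phi>1 p"
proof -
  have meas: "(\<lambda>\<omega>. ennreal (norm (\<Delta>M (Suc n) \<omega>) powr (2 * p + 2) *
        exp (\<psi> (u * (norm (\<Delta>M (Suc n) \<omega>))\<^sup>2)))) \<in> borel_measurable P"
    if "continuous_on {0..} \<psi>" "u \<ge> 0" for \<psi> :: "real \<Rightarrow> real" and u n
  proof -
    \<comment> \<open>Nothing is known about \<open>\<psi>\<close> at negative arguments, so it is
      extended continuously by its value at \<open>0\<close>. The arguments that occur are
      nonnegative and do not see the change.\<close>
    have "continuous_on UNIV (\<lambda>t. \<psi> (max 0 t))"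
      by (rule continuous_on_compose2[OF that(1)]) (auto intro!: continuous_intros)
    then have [measurable]: "(\<lambda>t. \<psi> (max 0 t)) \<in> borel_measurable borel"
      by (rule borel_measurable_continuous_onI)
    have "(\<lambda>\<omega>. ennreal (norm (\<Delta>M (Suc n) \<omega>) powr (2 * p + 2) *
        exp ((\<lambda>t. \<psi> (max 0 t)) (u * (norm (\<Delta>M (Suc n) \<omega>))\<^sup>2)))) \<in> borel_measurable P"
      by measurable
    then show ?thesis using that by (simp add: max_def)
  qed
  obtain \<rho> where \<rho>: "\<forall>u\<ge>0. \<rho> u \<ge> 0" "\<forall>K. compact K \<and> K \<subseteq> {0..} \<longrightarrow> bounded (\<rho> ` K)"
    "\<forall>u\<ge>0. \<forall>n. AE \<omega> in P.
        nn_cond_exp P (past P \<theta> n)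
          (\<lambda>\<omega>. ennreal (norm (\<Delta>M (Suc n) \<omega>) powr (2 * p + 2) *
                          exp (\<phi> (u * (norm (\<Delta>M (Suc n) \<omega>))\<^sup>2)))) \<omega>
        \<le> ennreal (\<rho> u)" (is "\<forall>u\<ge>0. \<forall>n. AE \<omega> in P. nn_cond_exp P (past P \<theta> n) (?g u n) \<omega> \<le> _")
    using assms(1) unfolding H_Sigma_def by blast
  have "AE \<omega> in P.
        nn_cond_exp P (past P \<theta> n)
          (\<lambda>\<omega>. ennreal (norm (\<Delta>M (Suc n) \<omega>) powr (2 * p + 2) *
                          exp (\<phi>1 (u * (norm (\<Delta>M (Suc n) \<omega>))\<^sup>2)))) \<omega>
        \<le> ennreal (\<rho> u)" (is "AE \<omega> in P. nn_cond_exp P (past P \<theta> n) ?g1 \<omega> \<le> _") if u: "u \<ge> 0" for u n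
  proof -
    interpret S: finite_measure_subalgebra P "past P \<theta> n"
      by unfold_locales (rule past_subalgebra)
    have "AE \<omega> in P. nn_cond_exp P (past P \<theta> n) ?g1 \<omega> \<le> nn_cond_exp P (past P \<theta> n) (?g u n) \<omega>"
      using u by (intro S.nn_cond_exp_mono meas cont AE_I2 ennreal_leI mult_left_mono) (auto intro!: le)
    then show ?thesis using \<rho>(3)[rule_format, OF u, of n] by eventually_elim auto
  qed
  with \<rho> show ?thesis unfolding H_Sigma_def by blast
qed

end

lemma (in phi_regular) noise_measurable [measurable]:
  assumes "1 \<le> \<Gamma>"
  shows "noise \<Gamma> \<in> borel_measurable borel"
proof -
  have "continuous_on {0..} \<phi>" using \<phi>_deriv by (intro DERIV_continuous_on) auto
  then have "continuous_on UNIV (\<lambda>t. \<phi> (max 0 t))"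
    by (rule continuous_on_compose2) (auto intro!: continuous_intros)
  then have [measurable]: "(\<lambda>t. \<phi> (max 0 t)) \<in> borel_measurable borel"
    by (rule borel_measurable_continuous_onI)
  have "(\<lambda>e :: real ^ 'd. (1 + (norm e)\<^sup>2) powr (p + 1) * exp ((\<lambda>t. \<phi> (max 0 t)) (u_max \<Gamma> * (norm e)\<^sup>2)))
      \<in> borel_measurable borel" by measurable
  then show ?thesis
    using u_max_nonneg[OF assms] by (simp add: noise_def[OF assms, abs_def] max_def)
qed

section \<open>Moments of the iterates under \<open>H_phi\<close> and \<open>H_Sigma\<close>\<close>

locale sgd_phi = sgd P f \<Lambda> Z \<gamma> \<theta> \<Delta>M \<theta>0 + phi_regular f \<theta>s L \<phi> \<phi>' \<phi>'' x0 \<Phi> K m M p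
  for P :: "'w measure" and f :: "real ^ 'd \<Rightarrow> real"
    and \<Lambda> :: "(real ^ 'd) \<times> (real ^ 'k) \<Rightarrow> real ^ 'd" and Z \<gamma> \<theta> \<Delta>M \<theta>0 \<theta>s
    and L :: real and \<phi> \<phi>' \<phi>'' :: "real \<Rightarrow> real" and x0 \<Phi> K m M p :: real +
  fixes \<gamma>0 \<beta> :: real
  assumes noise_moments: "H_Sigma P \<theta> \<Delta>M \<phi> p"
    and step: "n \<ge> 1 \<Longrightarrow> \<gamma> n = \<gamma>0 * real n powr (- \<beta>)"
    and step_const: "0 < \<gamma>0" and step_exp: "0 < \<beta>" "\<beta> < 1"
begin

definition \<Gamma> :: real where "\<Gamma> = max 1 \<gamma>0"

lemma \<Gamma>_ge_1: "1 \<le> \<Gamma>" by (simp add: \<Gamma>_def)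

lemma step_pos: "0 < \<gamma> (Suc n)"
  using step[of "Suc n"] step_const by simp

lemma step_decr: "\<gamma> (Suc (Suc n)) \<le> \<gamma> (Suc n)"
  using step[of "Suc n"] step[of "Suc (Suc n)"] step_const step_exp
  by (auto intro!: mult_left_mono powr_mono2')

lemma step_le_\<Gamma>: "\<gamma> (Suc n) \<le> \<Gamma>"
proof -
  have "\<gamma> (Suc n) \<le> \<gamma>0 * 1"
    unfolding step[of "Suc n", simplified] using step_const step_exp
    by (intro mult_left_mono) (auto simp: powr_minus_divide ge_one_powr_ge_zero)
  then show ?thesis by (simp add: \<Gamma>_def)
qed

lemma step_tendsto_0: "(\<lambda>n. \<gamma> (Suc n)) \<longlonglongrightarrow> 0"
proof -
  have "(\<lambda>n. \<gamma>0 * real (Suc n) powr (- \<beta>)) \<longlonglongrightarrow> 0" using step_exp by real_asymp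
  then show ?thesis by (simp add: step)
qed

lemma \<phi>_f_measurable [measurable]: "(\<lambda>x. \<phi> (f x)) \<in> borel_measurable borel"
  and \<phi>'_f_measurable [measurable]: "(\<lambda>x. \<phi>' (f x)) \<in> borel_measurable borel"
proof -
  have "continuous_on {0..} \<phi>" "continuous_on {0..} \<phi>'"
    using \<phi>_deriv \<phi>'_deriv by (auto intro!: DERIV_continuous_on)
  then have "continuous_on UNIV (\<lambda>x. \<phi> (f x))" "continuous_on UNIV (\<lambda>x. \<phi>' (f x))"
    by (auto intro!: continuous_intros f_minimum elim!: continuous_on_compose2)
  then show "(\<lambda>x. \<phi> (f x)) \<in> borel_measurable borel" "(\<lambda>x. \<phi>' (f x)) \<in> borel_measurable borel"
    by (auto intro!: borel_measurable_continuous_onI)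
qed

lemma lyap_measurable [measurable]: "(\<lambda>x. lyap \<epsilon> (f x)) \<in> borel_measurable borel"
  unfolding lyap_def by measurable

lemma lyap'_measurable [measurable]: "(\<lambda>x. lyap' \<epsilon> (f x)) \<in> borel_measurable borel"
  unfolding lyap'_def by measurable

lemma remainder_measurable [measurable]: "(\<lambda>x. remainder \<epsilon> (f x)) \<in> borel_measurable borel"
  unfolding remainder_def by measurable

lemma noise_\<Gamma>_measurable [measurable]: "noise \<Gamma> \<in> borel_measurable borel"
  by (rule noise_measurable[OF \<Gamma>_ge_1])

lemma noise_\<Gamma>_nonneg: "0 \<le> noise \<Gamma> e"
  using noise_ge_1[OF \<Gamma>_ge_1, of e] by simp

text \<open>Combines \<open>noise_le\<close> with \<open>H_Sigma\<close> at the single value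
  \<open>u_max \<Gamma>\<close> and pulls the function of \<open>\<theta> n\<close> out of the
  conditional expectation. Extended nonnegative \<open>\<psi>\<close> are allowed so that the bound
  can itself establish integrability; \<open>D\<close> depends neither on \<open>n\<close> nor on
  \<open>\<psi>\<close>.\<close>

lemma noise_bound:
  "\<exists>D\<ge>0. \<forall>n \<psi>. \<psi> \<in> borel_measurable borel \<longrightarrow>
    (\<integral>\<^sup>+\<omega>. \<psi> (\<theta> n \<omega>) * ennreal (noise \<Gamma> (\<Delta>M (Suc n) \<omega>)) \<partial>P) \<le> ennreal D * (\<integral>\<^sup>+\<omega>. \<psi> (\<theta> n \<omega>) \<partial>P)"
proof -
  define u where "u = u_max \<Gamma>"
  have u: "0 \<le> u" using u_max_nonneg[OF \<Gamma>_ge_1] by (simp add: u_def)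
  define g where "g n \<omega> = norm (\<Delta>M (Suc n) \<omega>) powr (2 * p + 2) * exp (\<phi> (u * (norm (\<Delta>M (Suc n) \<omega>))\<^sup>2))" for n \<omega>
  obtain \<rho> :: "real \<Rightarrow> real" where \<rho>': "\<forall>u\<ge>0. 0 \<le> \<rho> u"
    "\<forall>u\<ge>0. \<forall>n. AE \<omega> in P. nn_cond_exp P (past P \<theta> n)
      (\<lambda>\<omega>. ennreal (norm (\<Delta>M (Suc n) \<omega>) powr (2 * p + 2) * exp (\<phi> (u * (norm (\<Delta>M (Suc n) \<omega>))\<^sup>2)))) \<omega>
        \<le> ennreal (\<rho> u)"
    using noise_moments unfolding H_Sigma_def by (elim exE conjE) (rule that)
  have \<rho>: "0 \<le> \<rho> u"
    "AE \<omega> in P. nn_cond_exp P (past P \<theta> n) (\<lambda>\<omega>. ennreal (g n \<omega>)) \<omega> \<le> ennreal (\<rho> u)" for n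
    unfolding g_def by (rule \<rho>'[rule_format, OF u])+
  have g_meas [measurable]: "g n \<in> borel_measurable P" for n
  proof -
    have "continuous_on {0..} \<phi>" using \<phi>_deriv by (auto intro!: DERIV_continuous_on)
    then have "continuous_on UNIV (\<lambda>t. \<phi> (max 0 t))"
      by (rule continuous_on_compose2) (auto intro!: continuous_intros)
    then have [measurable]: "(\<lambda>t. \<phi> (max 0 t)) \<in> borel_measurable borel"
      by (rule borel_measurable_continuous_onI)
    have "(\<lambda>\<omega>. norm (\<Delta>M (Suc n) \<omega>) powr (2 * p + 2) *
        exp ((\<lambda>t. \<phi> (max 0 t)) (u * (norm (\<Delta>M (Suc n) \<omega>))\<^sup>2))) \<in> borel_measurable P" by measurable
    then show ?thesis using u by (simp add: g_def[abs_def] max_def)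
  qed
  define c where "c = (2::real) powr (p + 1)"
  define D where "D = c * exp (\<phi> u) + c * \<rho> u"
  have "(\<integral>\<^sup>+\<omega>. \<psi> (\<theta> n \<omega>) * ennreal (noise \<Gamma> (\<Delta>M (Suc n) \<omega>)) \<partial>P) \<le> ennreal D * (\<integral>\<^sup>+\<omega>. \<psi> (\<theta> n \<omega>) \<partial>P)"
    if [measurable]: "\<psi> \<in> borel_measurable borel" for n \<psi>
  proof -
    have "(\<integral>\<^sup>+\<omega>. \<psi> (\<theta> n \<omega>) * ennreal (noise \<Gamma> (\<Delta>M (Suc n) \<omega>)) \<partial>P) \<le>
      (\<integral>\<^sup>+\<omega>. ennreal (c * exp (\<phi> u)) * \<psi> (\<theta> n \<omega>) + ennreal c * (\<psi> (\<theta> n \<omega>) * ennreal (g n \<omega>)) \<partial>P)"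
    proof (rule nn_integral_mono)
      fix \<omega>
      have "ennreal (noise \<Gamma> (\<Delta>M (Suc n) \<omega>)) \<le> ennreal (c * exp (\<phi> u) + c * g n \<omega>)"
        using noise_le[OF \<Gamma>_ge_1, of "\<Delta>M (Suc n) \<omega>"]
        by (intro ennreal_leI) (simp add: c_def g_def u_def algebra_simps)
      also have "\<dots> = ennreal (c * exp (\<phi> u)) + ennreal c * ennreal (g n \<omega>)"
        by (subst ennreal_plus) (auto simp: c_def g_def ennreal_mult)
      finally have "\<psi> (\<theta> n \<omega>) * ennreal (noise \<Gamma> (\<Delta>M (Suc n) \<omega>)) \<le>
          \<psi> (\<theta> n \<omega>) * (ennreal (c * exp (\<phi> u)) + ennreal c * ennreal (g n \<omega>))"
        by (intro mult_left_mono) auto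
      then show "\<psi> (\<theta> n \<omega>) * ennreal (noise \<Gamma> (\<Delta>M (Suc n) \<omega>)) \<le>
          ennreal (c * exp (\<phi> u)) * \<psi> (\<theta> n \<omega>) + ennreal c * (\<psi> (\<theta> n \<omega>) * ennreal (g n \<omega>))"
        by (simp only: distrib_left mult_ac)
    qed
    also have "\<dots> = ennreal (c * exp (\<phi> u)) * (\<integral>\<^sup>+\<omega>. \<psi> (\<theta> n \<omega>) \<partial>P) +
        ennreal c * (\<integral>\<^sup>+\<omega>. \<psi> (\<theta> n \<omega>) * ennreal (g n \<omega>) \<partial>P)"
      by (simp add: nn_integral_add nn_integral_cmult)
    also have "\<dots> \<le> ennreal (c * exp (\<phi> u)) * (\<integral>\<^sup>+\<omega>. \<psi> (\<theta> n \<omega>) \<partial>P) +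
        ennreal c * (ennreal (\<rho> u) * (\<integral>\<^sup>+\<omega>. \<psi> (\<theta> n \<omega>) \<partial>P))"
      by (intro add_left_mono mult_left_mono cond_exp_bound \<rho>) auto
    also have "\<dots> = ennreal D * (\<integral>\<^sup>+\<omega>. \<psi> (\<theta> n \<omega>) \<partial>P)"
      using \<rho>(1) by (simp add: D_def c_def ennreal_plus ennreal_mult distrib_right mult.assoc)
    finally show ?thesis .
  qed
  moreover have "0 \<le> D" using \<rho>(1) by (auto simp: D_def c_def)
  ultimately show ?thesis by blast
qed

lemma integrable_noise:
  assumes [measurable]: "\<psi> \<in> borel_measurable borel" and \<psi>: "\<And>x. 0 \<le> \<psi> x"
    and int: "integrable P (\<lambda>\<omega>. \<psi> (\<theta> n \<omega>))"
  shows "integrable P (\<lambda>\<omega>. \<psi> (\<theta> n \<omega>) * noise \<Gamma> (\<Delta>M (Suc n) \<omega>))"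
proof -
  obtain D where D: "\<And>n \<psi>. \<psi> \<in> borel_measurable borel \<Longrightarrow>
    (\<integral>\<^sup>+\<omega>. \<psi> (\<theta> n \<omega>) * ennreal (noise \<Gamma> (\<Delta>M (Suc n) \<omega>)) \<partial>P) \<le> ennreal D * (\<integral>\<^sup>+\<omega>. \<psi> (\<theta> n \<omega>) \<partial>P)"
    using noise_bound by blast
  have "(\<integral>\<^sup>+\<omega>. ennreal (\<psi> (\<theta> n \<omega>) * noise \<Gamma> (\<Delta>M (Suc n) \<omega>)) \<partial>P) \<le>
      ennreal D * (\<integral>\<^sup>+\<omega>. ennreal (\<psi> (\<theta> n \<omega>)) \<partial>P)"
    using D[of "\<lambda>x. ennreal (\<psi> x)" n] by (simp add: ennreal_mult \<psi> noise_\<Gamma>_nonneg)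
  also have "\<dots> < \<infinity>"
    using int \<psi> by (auto simp: ennreal_mult_less_top nn_integral_eq_integral)
  finally show ?thesis
    using \<psi> noise_\<Gamma>_nonneg by (intro integrableI_nonneg) auto
qed

lemma lyap_1_integrable: "integrable P (\<lambda>\<omega>. lyap 1 (f (\<theta> n \<omega>)))"
proof (induction n)
  case 0
  have "integrable P (\<lambda>\<omega>. lyap 1 (f \<theta>0))" by simp
  then show ?case
    by (rule Bochner_Integration.integrable_cong[THEN iffD1, rotated 2]) (auto simp: \<theta>_init)
next
  case (Suc n)
  have "integrable P (\<lambda>\<omega>. C_grow \<Gamma> powr p * exp (C_exp \<Gamma>) *
      (lyap 1 (f (\<theta> n \<omega>)) * noise \<Gamma> (\<Delta>M (Suc n) \<omega>)))"
    by (intro integrable_mult_right integrable_noise[where \<psi> = "\<lambda>x. lyap 1 (f x)"] Suc lyap_nonneg) measurable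
  then show ?case
  proof (rule Bochner_Integration.integrable_bound)
    show "AE \<omega> in P. norm (lyap 1 (f (\<theta> (Suc n) \<omega>))) \<le> norm (C_grow \<Gamma> powr p * exp (C_exp \<Gamma>) *
      (lyap 1 (f (\<theta> n \<omega>)) * noise \<Gamma> (\<Delta>M (Suc n) \<omega>)))"
    proof (rule AE_I2)
      fix \<omega> assume "\<omega> \<in> space P"
      then have "lyap 1 (f (\<theta> (Suc n) \<omega>)) \<le>
          C_grow \<Gamma> powr p * exp (C_exp \<Gamma>) * lyap 1 (f (\<theta> n \<omega>)) * noise \<Gamma> (\<Delta>M (Suc n) \<omega>)"
        using lyap_crude_step[OF \<Gamma>_ge_1 step_pos step_le_\<Gamma>] by (simp add: \<theta>_step)
      then show "norm (lyap 1 (f (\<theta> (Suc n) \<omega>))) \<le> norm (C_grow \<Gamma> powr p * exp (C_exp \<Gamma>) *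
          (lyap 1 (f (\<theta> n \<omega>)) * noise \<Gamma> (\<Delta>M (Suc n) \<omega>)))"
        by (simp add: lyap_nonneg noise_\<Gamma>_nonneg mult.assoc)
    qed
  qed measurable
qed

lemma lyap_integrable:
  assumes "0 \<le> \<epsilon>" "\<epsilon> \<le> \<Gamma>"
  shows "integrable P (\<lambda>\<omega>. lyap \<epsilon> (f (\<theta> n \<omega>)))"
proof (rule Bochner_Integration.integrable_bound)
  show "integrable P (\<lambda>\<omega>. \<Gamma> powr p * lyap 1 (f (\<theta> n \<omega>)))"
    by (intro integrable_mult_right lyap_1_integrable)
  show "AE \<omega> in P. norm (lyap \<epsilon> (f (\<theta> n \<omega>))) \<le> norm (\<Gamma> powr p * lyap 1 (f (\<theta> n \<omega>)))"
    using lyap_le_lyap_1[OF f_minimum assms \<Gamma>_ge_1] by (auto simp: lyap_nonneg)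
qed measurable

lemma remainder_integrable:
  assumes "0 < \<epsilon>" "\<epsilon> \<le> 1"
  shows "integrable P (\<lambda>\<omega>. remainder \<epsilon> (f (\<theta> n \<omega>)))"
proof (rule Bochner_Integration.integrable_bound)
  show "integrable P (\<lambda>\<omega>. 2 * lyap 1 (f (\<theta> n \<omega>)))"
    by (intro integrable_mult_right lyap_1_integrable)
  show "AE \<omega> in P. norm (remainder \<epsilon> (f (\<theta> n \<omega>))) \<le> norm (2 * lyap 1 (f (\<theta> n \<omega>)))"
    using remainder_le_lyap_1[OF f_minimum assms] assms
    by (auto simp: lyap_nonneg remainder_nonneg f_minimum)
qed measurable

text \<open>The expectation of \<open>lyap_step\<close> once the steps are small: the martingale
  term vanishes, \<open>noise\<close> contributes the factor \<open>D\<close>, and absorbing the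
  remainder uses half of the contraction rate \<open>m\<close>.\<close>

lemma lyap_recursion:
  "\<exists>C\<ge>0. \<exists>n0\<ge>1. \<forall>n\<ge>n0. (\<integral>\<omega>. lyap (\<gamma> (Suc n)) (f (\<theta> (Suc n) \<omega>)) \<partial>P) \<le>
     (1 - m / 2 * \<gamma> (Suc n)) * (\<integral>\<omega>. lyap (\<gamma> n) (f (\<theta> n \<omega>)) \<partial>P) + C * \<gamma> (Suc n) powr (p + 1)"
proof -
  obtain D where D: "0 \<le> D" "\<And>n \<psi>. \<psi> \<in> borel_measurable borel \<Longrightarrow>
    (\<integral>\<^sup>+\<omega>. \<psi> (\<theta> n \<omega>) * ennreal (noise \<Gamma> (\<Delta>M (Suc n) \<omega>)) \<partial>P) \<le> ennreal D * (\<integral>\<^sup>+\<omega>. \<psi> (\<theta> n \<omega>) \<partial>P)"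
    using noise_bound by blast
  define A where "A = C_step \<Gamma>"
  have A: "0 \<le> A"
    unfolding A_def C_step_def[OF \<Gamma>_ge_1] using C_lyap_nonneg p_ge_1 L_pos M_pos \<Phi>_nonneg m_pos by auto
  obtain C where C: "0 \<le> C" "\<And>\<gamma> y. 0 < \<gamma> \<Longrightarrow> \<gamma> \<le> 1 \<Longrightarrow> 4 * (A * D) * \<gamma> \<le> m \<Longrightarrow> 0 \<le> y \<Longrightarrow>
    A * D * \<gamma>\<^sup>2 * remainder \<gamma> y \<le> m / 2 * \<gamma> * lyap \<gamma> y + C * \<gamma> powr (p + 1)"
    using remainder_absorb[of "A * D"] A D(1) by auto
  \<comment> \<open>The first two entries are the requirements of \<open>lyap_step\<close>, the
    third that of \<open>remainder_absorb\<close>, with \<open>+ 1\<close> against division by zero.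
    The last keeps the contraction factor nonnegative.\<close>
  define \<delta> where "\<delta> = min 1 (min (1 / (2 * L)) (min (m / (4 * (A * D) + 1)) (1 / m)))"
  have "\<delta> > 0" using L_pos m_pos A D(1) by (simp add: \<delta>_def add_nonneg_pos)
  then obtain n0 where n0: "\<And>n. n \<ge> n0 \<Longrightarrow> \<gamma> (Suc n) < \<delta>"
    using order_tendstoD(2)[OF step_tendsto_0, of \<delta>] by (auto simp: eventually_sequentially)
  have "(\<integral>\<omega>. lyap (\<gamma> (Suc n)) (f (\<theta> (Suc n) \<omega>)) \<partial>P) \<le>
     (1 - m / 2 * \<gamma> (Suc n)) * (\<integral>\<omega>. lyap (\<gamma> n) (f (\<theta> n \<omega>)) \<partial>P) + C * \<gamma> (Suc n) powr (p + 1)"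
    if n: "n \<ge> max 1 n0" for n
  proof -
    define g where "g = \<gamma> (Suc n)"
    have g: "0 < g" "g \<le> 1" "L * g \<le> 1 / 2" "4 * (A * D) * g \<le> m" "m * g \<le> 1" "g \<le> \<gamma> n"
    proof -
      have g\<delta>: "g < \<delta>" using n0[of n] n by (simp add: g_def)
      show "0 < g" using step_pos by (simp add: g_def)
      show "g \<le> 1" using g\<delta> by (simp add: \<delta>_def)
      show "L * g \<le> 1 / 2" using g\<delta> L_pos by (simp add: \<delta>_def field_simps)
      have "g < m / (4 * (A * D) + 1)" using g\<delta> by (simp add: \<delta>_def)
      then have "g * (4 * (A * D) + 1) < m" using A D(1) pos_less_divide_eq[of "4 * (A * D) + 1"] by (simp add: add_nonneg_pos)
      then show "4 * (A * D) * g \<le> m" using \<open>0 < g\<close> by (simp add: algebra_simps)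
      show "m * g \<le> 1" using g\<delta> m_pos by (simp add: \<delta>_def field_simps)
      show "g \<le> \<gamma> n" using step_decr[of "n - 1"] n by (simp add: g_def)
    qed
    let ?x = "\<lambda>\<omega>. \<theta> n \<omega>" and ?e = "\<lambda>\<omega>. \<Delta>M (Suc n) \<omega>"
    let ?R = "\<lambda>\<omega>. remainder g (f (?x \<omega>))"
    have g\<Gamma>: "g \<le> \<Gamma>" using step_le_\<Gamma> by (simp add: g_def)
    have intR: "integrable P ?R" by (rule remainder_integrable) (use g in auto)
    have intRN: "integrable P (\<lambda>\<omega>. ?R \<omega> * noise \<Gamma> (?e \<omega>))"
      by (rule integrable_noise[where \<psi> = "\<lambda>x. remainder g (f x)"])
         (use intR g remainder_nonneg f_minimum in auto)
    have intU: "integrable P (\<lambda>\<omega>. lyap g (f (\<theta> k \<omega>)))" for k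
      by (rule lyap_integrable) (use g g\<Gamma> in auto)
    define h where "h x = lyap' g (f x) *\<^sub>R grad f x" for x
    have [measurable]: "h \<in> borel_measurable borel" unfolding h_def by measurable
    have intM: "integrable P (\<lambda>\<omega>. h (?x \<omega>) \<bullet> ?e \<omega>)"
    proof (rule Bochner_Integration.integrable_bound)
      show "integrable P (\<lambda>\<omega>. p * (1 + M + \<Phi> + M) * (?R \<omega> * noise \<Gamma> (?e \<omega>)))"
        by (intro integrable_mult_right intRN)
      show "AE \<omega> in P. norm (h (?x \<omega>) \<bullet> ?e \<omega>) \<le> norm (p * (1 + M + \<Phi> + M) * (?R \<omega> * noise \<Gamma> (?e \<omega>)))"
      proof (rule AE_I2)
        fix \<omega>
        have "\<bar>h (?x \<omega>) \<bullet> ?e \<omega>\<bar> \<le> p * (1 + M + \<Phi> + M) * (?R \<omega> * noise \<Gamma> (?e \<omega>))"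
          using lyap'_grad_bound[OF g(1,2) \<Gamma>_ge_1, of "?x \<omega>" "?e \<omega>"] by (simp add: h_def)
        then show "norm (h (?x \<omega>) \<bullet> ?e \<omega>) \<le> norm (p * (1 + M + \<Phi> + M) * (?R \<omega> * noise \<Gamma> (?e \<omega>)))"
          by simp
      qed
    qed measurable
    have RN: "(\<integral>\<omega>. ?R \<omega> * noise \<Gamma> (?e \<omega>) \<partial>P) \<le> D * (\<integral>\<omega>. ?R \<omega> \<partial>P)"
    proof -
      have R0: "0 \<le> ?R \<omega>" for \<omega> using remainder_nonneg f_minimum g by auto
      have "ennreal (\<integral>\<omega>. ?R \<omega> * noise \<Gamma> (?e \<omega>) \<partial>P) = (\<integral>\<^sup>+\<omega>. ennreal (?R \<omega>) * ennreal (noise \<Gamma> (?e \<omega>)) \<partial>P)"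
        using R0 noise_\<Gamma>_nonneg nn_integral_eq_integral[OF intRN] by (simp add: ennreal_mult)
      also have "\<dots> \<le> ennreal D * (\<integral>\<^sup>+\<omega>. ennreal (?R \<omega>) \<partial>P)"
        using D(2)[of "\<lambda>x. ennreal (remainder g (f x))" n] by simp
      also have "\<dots> = ennreal (D * (\<integral>\<omega>. ?R \<omega> \<partial>P))"
        using R0 D(1) nn_integral_eq_integral[OF intR] by (simp add: ennreal_mult)
      finally show ?thesis using R0 D(1) by (subst (asm) ennreal_le_iff) auto
    qed
    have "(\<integral>\<omega>. lyap g (f (\<theta> (Suc n) \<omega>)) \<partial>P) \<le> (\<integral>\<omega>. (1 - m * g) * lyap g (f (?x \<omega>)) +
        g * (h (?x \<omega>) \<bullet> ?e \<omega>) + A * g\<^sup>2 * (?R \<omega> * noise \<Gamma> (?e \<omega>)) \<partial>P)"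
    proof (rule integral_mono)
      fix \<omega> assume "\<omega> \<in> space P"
      then show "lyap g (f (\<theta> (Suc n) \<omega>)) \<le> (1 - m * g) * lyap g (f (?x \<omega>)) +
        g * (h (?x \<omega>) \<bullet> ?e \<omega>) + A * g\<^sup>2 * (?R \<omega> * noise \<Gamma> (?e \<omega>))"
        using lyap_step[OF \<Gamma>_ge_1 g(1-3), of "?x \<omega>" "?e \<omega>"]
        by (simp add: \<theta>_step g_def h_def A_def remainder_def mult.assoc)
    qed (use intU intM intRN in \<open>auto intro!: Bochner_Integration.integrable_add integrable_mult_right\<close>)
    also have "\<dots> = (1 - m * g) * (\<integral>\<omega>. lyap g (f (?x \<omega>)) \<partial>P) + g * (\<integral>\<omega>. h (?x \<omega>) \<bullet> ?e \<omega> \<partial>P) +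
        A * g\<^sup>2 * (\<integral>\<omega>. ?R \<omega> * noise \<Gamma> (?e \<omega>) \<partial>P)"
      using intU intM intRN by simp
    also have "(\<integral>\<omega>. h (?x \<omega>) \<bullet> ?e \<omega> \<partial>P) = 0" by (rule martingale_increment[OF _ intM]) simp
    also have "A * g\<^sup>2 * (\<integral>\<omega>. ?R \<omega> * noise \<Gamma> (?e \<omega>) \<partial>P) \<le> A * g\<^sup>2 * (D * (\<integral>\<omega>. ?R \<omega> \<partial>P))"
      using A RN by (intro mult_left_mono) auto
    also have "\<dots> = (\<integral>\<omega>. A * D * g\<^sup>2 * ?R \<omega> \<partial>P)" by simp
    also have "\<dots> \<le> (\<integral>\<omega>. m / 2 * g * lyap g (f (?x \<omega>)) + C * g powr (p + 1) \<partial>P)"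
      by (rule integral_mono) (use intR intU C(2)[OF g(1,2,4) f_minimum] in auto)
    also have "\<dots> = m / 2 * g * (\<integral>\<omega>. lyap g (f (?x \<omega>)) \<partial>P) + C * g powr (p + 1)"
      using intU by (simp add: prob_space)
    finally have "(\<integral>\<omega>. lyap g (f (\<theta> (Suc n) \<omega>)) \<partial>P) \<le>
        (1 - m / 2 * g) * (\<integral>\<omega>. lyap g (f (?x \<omega>)) \<partial>P) + C * g powr (p + 1)"
      by (simp add: algebra_simps)
    \<comment> \<open>So far both sides carry the new shift \<open>\<gamma> (Suc n)\<close>. Steps
      decrease and \<open>lyap\<close> increases with its shift, so the old shift may be restored on
      the right.\<close>
    also have "(\<integral>\<omega>. lyap g (f (?x \<omega>)) \<partial>P) \<le> (\<integral>\<omega>. lyap (\<gamma> n) (f (?x \<omega>)) \<partial>P)"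
    proof (rule integral_mono)
      show "integrable P (\<lambda>\<omega>. lyap (\<gamma> n) (f (?x \<omega>)))"
        using n g step_le_\<Gamma>[of "n - 1"] by (intro lyap_integrable) auto
    qed (use intU g f_minimum in \<open>auto intro!: lyap_mono\<close>)
    finally show ?thesis using g m_pos by (simp add: g_def mult_left_mono)
  qed
  then show ?thesis using C(1) by (intro exI[of _ C] conjI exI[of _ "max 1 n0"]) auto
qed

lemma lyap_moment_bound:
  "\<exists>C. \<forall>n\<ge>1. (\<integral>\<^sup>+ \<omega>. ennreal (f (\<theta> n \<omega>) powr p * exp (\<phi> (f (\<theta> n \<omega>)))) \<partial>P) \<le> ennreal (C * \<gamma> n powr p)"
proof -
  define a where "a n = (\<integral>\<omega>. lyap (\<gamma> n) (f (\<theta> n \<omega>)) \<partial>P)" for n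
  have a: "0 \<le> a n" for n by (simp add: a_def lyap_nonneg)
  obtain C n0 where C: "0 \<le> C" and rec: "\<And>n. n \<ge> n0 \<Longrightarrow>
      a (Suc n) \<le> (1 - m / 2 * \<gamma> (Suc n)) * a n + C * \<gamma> (Suc n) powr (p + 1)"
    using lyap_recursion unfolding a_def by blast
  obtain C' where C': "\<And>n. n \<ge> 1 \<Longrightarrow> a n \<le> C' * \<gamma> n powr p"
    using powr_step_recursion[OF step step_const step_exp _ _ C a rec] p_ge_1 m_pos by auto
  have "(\<integral>\<^sup>+ \<omega>. ennreal (f (\<theta> n \<omega>) powr p * exp (\<phi> (f (\<theta> n \<omega>)))) \<partial>P) \<le> ennreal (C' * \<gamma> n powr p)"
    if n: "n \<ge> 1" for n
  proof -
    have g: "0 \<le> \<gamma> n" "\<gamma> n \<le> \<Gamma>" using step_pos[of "n - 1"] step_le_\<Gamma>[of "n - 1"] n by auto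
    have "(\<integral>\<^sup>+ \<omega>. ennreal (f (\<theta> n \<omega>) powr p * exp (\<phi> (f (\<theta> n \<omega>)))) \<partial>P) \<le>
        (\<integral>\<^sup>+ \<omega>. ennreal (lyap (\<gamma> n) (f (\<theta> n \<omega>))) \<partial>P)"
      using lyap_mono[OF f_minimum order_refl g(1)]
      by (intro nn_integral_mono ennreal_leI) (simp add: lyap_def)
    also have "\<dots> = ennreal (a n)"
      unfolding a_def by (rule nn_integral_eq_integral) (use g lyap_integrable lyap_nonneg in auto)
    also have "\<dots> \<le> ennreal (C' * \<gamma> n powr p)" by (rule ennreal_leI[OF C'[OF n]])
    finally show ?thesis .
  qed
  then show ?thesis by blast
qed

end

section \<open>Comparison with the Euclidean moments\<close>

context objective
begin

lemma compact_away: "compact {x. norm x \<le> R \<and> \<delta> \<le> norm (x - \<theta>s)}"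
proof -
  have "{x. norm x \<le> R \<and> \<delta> \<le> norm (x - \<theta>s)} = cball 0 R \<inter> {x. \<delta> \<le> norm (x - \<theta>s)}" by auto
  moreover have "closed {x. \<delta> \<le> norm (x - \<theta>s)}" by (intro closed_Collect_le continuous_intros)
  ultimately show ?thesis using compact_Int_closed[OF compact_cball] by metis
qed

lemma positive_lower_bound:
  fixes h :: "real ^ 'd \<Rightarrow> real"
  assumes "continuous_on UNIV h" "\<And>x. x \<noteq> \<theta>s \<Longrightarrow> 0 < h x" "0 < \<delta>"
  shows "\<exists>c>0. \<forall>x. norm x \<le> R \<longrightarrow> \<delta> \<le> norm (x - \<theta>s) \<longrightarrow> c \<le> h x"
proof (cases "{x. norm x \<le> R \<and> \<delta> \<le> norm (x - \<theta>s)} = {}")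
  case True
  then show ?thesis by (intro exI[of _ 1]) auto
next
  case False
  then obtain z where "\<delta> \<le> norm (z - \<theta>s)" "\<forall>x\<in>{x. norm x \<le> R \<and> \<delta> \<le> norm (x - \<theta>s)}. h z \<le> h x"
    using continuous_attains_inf[OF compact_away[of R \<delta>] False] continuous_on_subset[OF assms(1)] by blast
  moreover from this assms(3) have "z \<noteq> \<theta>s" by auto
  then have "0 < h z" by (rule assms(2))
  ultimately show ?thesis by (intro exI[of _ "h z"]) auto
qed

text \<open>Near \<open>\<theta>s\<close> the gradient is at least linear in the distance, and its
  square is at most \<open>4 * L * f x\<close>; this yields quadratic growth without a Taylor
  expansion of \<open>f\<close>. Elsewhere in the ball, compactness suffices.\<close>

lemma f_lower: "\<exists>c>0. \<forall>x. norm x \<le> R \<longrightarrow> c * (norm (x - \<theta>s))\<^sup>2 \<le> f x"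
proof -
  obtain c \<delta> where c: "0 < c" "0 < \<delta>"
    and near: "\<And>x. norm (x - \<theta>s) < \<delta> \<Longrightarrow> c * norm (x - \<theta>s) \<le> norm (grad f x)"
    using grad_lower_near by blast
  obtain \<mu> where \<mu>: "0 < \<mu>" "\<And>x. norm x \<le> R \<Longrightarrow> \<delta> \<le> norm (x - \<theta>s) \<Longrightarrow> \<mu> \<le> f x"
    using positive_lower_bound[of f \<delta> R, OF f_cont[OF continuous_on_id] f_pos c(2)] by blast
  define W where "W = (\<bar>R\<bar> + norm \<theta>s)\<^sup>2 + 1"
  have W: "0 < W" by (auto simp: W_def intro: add_nonneg_pos)
  define c' where "c' = min (c\<^sup>2 / (4 * L)) (\<mu> / W)"
  have "c' * (norm (x - \<theta>s))\<^sup>2 \<le> f x" if x: "norm x \<le> R" for x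
  proof (cases "norm (x - \<theta>s) < \<delta>")
    case True
    have "(c * norm (x - \<theta>s))\<^sup>2 \<le> (norm (grad f x))\<^sup>2"
      using near[OF True] c by (intro power_mono) auto
    also have "\<dots> \<le> 4 * L * f x" by (rule grad_sq_le)
    finally have "c\<^sup>2 / (4 * L) * (norm (x - \<theta>s))\<^sup>2 \<le> f x"
      using L_pos by (simp add: power_mult_distrib field_simps)
    moreover have "c' * (norm (x - \<theta>s))\<^sup>2 \<le> c\<^sup>2 / (4 * L) * (norm (x - \<theta>s))\<^sup>2"
      by (intro mult_right_mono) (auto simp: c'_def)
    ultimately show ?thesis by linarith
  next
    case False
    have "norm (x - \<theta>s) \<le> \<bar>R\<bar> + norm \<theta>s" using norm_triangle_ineq4[of x \<theta>s] x by linarith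
    then have "(norm (x - \<theta>s))\<^sup>2 \<le> (\<bar>R\<bar> + norm \<theta>s)\<^sup>2" by (intro power_mono) auto
    then have "(norm (x - \<theta>s))\<^sup>2 \<le> W" unfolding W_def by linarith
    then have "c' * (norm (x - \<theta>s))\<^sup>2 \<le> \<mu> / W * W"
      using \<mu>(1) W by (intro mult_mono) (auto simp: c'_def)
    then show ?thesis using \<mu>(2)[OF x] False W by simp
  qed
  moreover have "0 < c'" using c L_pos \<mu> W by (auto simp: c'_def)
  ultimately show ?thesis by blast
qed

text \<open>On a ball, \<open>f_lower\<close> and \<open>exp (\<phi> (f x)) \<ge> 1\<close> give the
  bound. Outside it the limit inferior does, after
  \<open>norm (x - \<theta>s) \<le> 2 * norm x\<close>, for which the radius is at least
  \<open>norm \<theta>s\<close>.\<close>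

lemma moment_comparison:
  assumes p: "0 < p" and \<phi>: "\<And>t. 0 \<le> t \<Longrightarrow> 0 \<le> \<phi> t"
    and lim: "Liminf at_infinity (\<lambda>x. ereal (norm x powr (- 2 * p) * (f x powr p * exp (\<phi> (f x))))) > 0"
  shows "\<exists>K\<ge>0. \<forall>x. norm (x - \<theta>s) powr (2 * p) \<le> K * (f x powr p * exp (\<phi> (f x)))"
proof -
  let ?V = "\<lambda>x. f x powr p * exp (\<phi> (f x))"
  obtain c where c: "0 < ereal c"
    "ereal c < Liminf at_infinity (\<lambda>x. ereal (norm x powr (- 2 * p) * ?V x))"
    using ereal_dense2[OF lim] by auto
  have "\<forall>\<^sub>F x in at_infinity. c < norm x powr (- 2 * p) * ?V x"
    using less_LiminfD[OF c(2)] by simp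
  then obtain R0 where R0: "\<And>x. norm x \<ge> R0 \<Longrightarrow> c < norm x powr (- 2 * p) * ?V x"
    unfolding eventually_at_infinity by blast
  define R where "R = max 1 (max R0 (norm \<theta>s))"
  obtain d where d: "0 < d" "\<And>x. norm x \<le> R \<Longrightarrow> d * (norm (x - \<theta>s))\<^sup>2 \<le> f x"
    using f_lower by blast
  define K where "K = max (2 powr (2 * p) / c) ((1 / d) powr p)"
  have c0: "0 < c" using c by simp
  have V0: "0 \<le> ?V x" for x by simp
  have "norm (x - \<theta>s) powr (2 * p) \<le> K * ?V x" for x
  proof (cases "norm x \<le> R")
    case True
    have "norm (x - \<theta>s) powr (2 * p) = ((norm (x - \<theta>s))\<^sup>2) powr p"
      by (cases "x = \<theta>s") (auto simp: powr_powr simp flip: powr_numeral)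
    also have "\<dots> \<le> (1 / d * f x) powr p"
      using d(1) d(2)[OF True] p by (intro powr_mono2) (auto simp: field_simps)
    also have "\<dots> = (1 / d) powr p * f x powr p" using d f_minimum[of x] by (simp only: powr_mult divide_nonneg_pos zero_le_one)
    also have "\<dots> \<le> K * ?V x"
    proof (rule mult_mono)
      have "f x powr p * 1 \<le> ?V x" using \<phi>[OF f_minimum[of x]] by (intro mult_left_mono) auto
      then show "f x powr p \<le> ?V x" by simp
    qed (auto simp: K_def le_max_iff_disj)
    finally show ?thesis .
  next
    case False
    then have x: "norm x > 1" "norm x > norm \<theta>s" "c < norm x powr (- 2 * p) * ?V x"
      using R0[of x] by (auto simp: R_def)
    have "norm (x - \<theta>s) \<le> 2 * norm x" using norm_triangle_ineq4[of x \<theta>s] x by linarith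
    then have "norm (x - \<theta>s) powr (2 * p) \<le> (2 * norm x) powr (2 * p)"
      using p by (intro powr_mono2) auto
    also have "\<dots> = 2 powr (2 * p) * norm x powr (2 * p)" by (simp add: powr_mult)
    also have "\<dots> \<le> 2 powr (2 * p) * (?V x / c)"
    proof (intro mult_left_mono)
      have "norm x powr (2 * p) * c \<le> norm x powr (2 * p) * (norm x powr (- 2 * p) * ?V x)"
        using x by (intro mult_left_mono) auto
      also have "norm x powr (2 * p) * (norm x powr (- 2 * p) * ?V x) = ?V x"
      proof -
        have "norm x powr (2 * p) \<noteq> 0" using x(1) by auto
        then show ?thesis by (simp add: powr_minus mult.assoc[symmetric])
      qed
      finally show "norm x powr (2 * p) \<le> ?V x / c" using c0 by (simp add: pos_le_divide_eq)
    qed auto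
    also have "\<dots> = 2 powr (2 * p) / c * ?V x" by simp
    also have "\<dots> \<le> K * ?V x" using V0 by (intro mult_right_mono) (auto simp: K_def)
    finally show ?thesis .
  qed
  moreover have "0 \<le> K" by (auto simp: K_def le_max_iff_disj)
  ultimately show ?thesis by blast
qed

text \<open>An Ekeland-type argument: if \<open>f powr (1 - r)\<close> were small at a far point \<open>x1\<close>, the sum of this
  function and a cone centred at \<open>x1\<close> would have a local minimum where the slope of the cone is too
  small to compensate the gradient.\<close>

lemma growth_from_gradient:
  assumes r: "0 \<le> r" "r < 1" and c1: "0 < c1"
    and R: "norm \<theta>s < R" "\<And>x. R \<le> norm x \<Longrightarrow> c1 * f x powr r \<le> norm (grad f x)"
    and x1: "R < norm x1"
  shows "(1 - r) * c1 / 2 * (norm x1 - R) \<le> f x1 powr (1 - r)"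
proof (rule ccontr)
  assume neg: "\<not> ?thesis"
  \<comment> \<open>Half of \<open>(1 - r) * c1\<close>, a lower bound for the gradient norm of
    \<open>f powr (1 - r)\<close> outside the ball of radius \<open>R\<close>; the gap makes the
    derivative of \<open>\<kappa>\<close> below strictly negative.\<close>
  define c where "c = (1 - r) * c1 / 2"
  define \<rho> where "\<rho> = norm x1 - R"
  define \<Psi> where "\<Psi> z = f z powr (1 - r) + c * norm (z - x1)" for z
  have c: "0 < c" using r c1 by (simp add: c_def)
  have \<rho>: "0 < \<rho>" using x1 by (simp add: \<rho>_def)
  have small: "f x1 powr (1 - r) < c * \<rho>" using neg by (simp add: c_def \<rho>_def)
  have "continuous_on (cball x1 \<rho>) \<Psi>"
    unfolding \<Psi>_def using r f_minimum by (intro continuous_intros continuous_on_powr') auto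
  then have "\<exists>z\<in>cball x1 \<rho>. \<forall>y\<in>cball x1 \<rho>. \<Psi> z \<le> \<Psi> y"
    using \<rho> by (intro continuous_attains_inf) auto
  then obtain z where z: "\<And>y. y \<in> cball x1 \<rho> \<Longrightarrow> \<Psi> z \<le> \<Psi> y" by blast
  have "c * norm (z - x1) \<le> \<Psi> z" by (simp add: \<Psi>_def)
  also have "\<dots> \<le> \<Psi> x1" using \<rho> by (intro z) auto
  also have "\<dots> < c * \<rho>" using small by (simp add: \<Psi>_def)
  \<comment> \<open>The minimiser is interior to the ball, which leaves room to move. The ball
    avoids the region \<open>norm z < R\<close>, so the gradient bound is available at
    \<open>z\<close>.\<close>
  finally have zx: "norm (z - x1) < \<rho>" using c by simp
  then have zR: "R \<le> norm z"
    using norm_triangle_ineq3[of z x1] by (simp add: \<rho>_def)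
  then have "z \<noteq> \<theta>s" using R(1) by auto
  define g where "g = grad f z"
  have fz: "0 < f z" using f_pos[OF \<open>z \<noteq> \<theta>s\<close>] .
  have g0: "0 < norm g" using \<open>z \<noteq> \<theta>s\<close> crit by (simp add: g_def)
  define \<kappa> where "\<kappa> s = f (z + s *\<^sub>R (- g)) powr (1 - r) + c * norm g * s" for s
  have "(\<kappa> has_real_derivative
      (1 - r) * f z powr (1 - r - 1) * (g \<bullet> (- g)) + c * norm g) (at 0)"
  proof -
    have "((\<lambda>s. f (z + s *\<^sub>R (- g))) has_real_derivative (grad f (z + 0 *\<^sub>R (- g)) \<bullet> (- g))) (at 0)"
      by (rule f_line_deriv)
    from DERIV_fun_powr[OF this, of "1 - r"] fz
    have "((\<lambda>s. f (z + s *\<^sub>R (- g)) powr (1 - r)) has_real_derivative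
        (1 - r) * f z powr (1 - r - 1) * (g \<bullet> (- g))) (at 0)"
      by (simp add: g_def)
    from DERIV_add[OF this DERIV_cmult_Id[of "c * norm g"]] show ?thesis
      by (simp add: \<kappa>_def[abs_def])
  qed
  moreover have "(1 - r) * f z powr (1 - r - 1) * (g \<bullet> (- g)) + c * norm g < 0"
  proof -
    have "c1 * f z powr r * norm g \<le> norm g * norm g"
      using R(2)[OF zR] by (intro mult_right_mono) (auto simp: g_def)
    then have "f z powr (- r) * (c1 * f z powr r * norm g) \<le> f z powr (- r) * (g \<bullet> g)"
      by (intro mult_left_mono) (auto simp: dot_square_norm power2_eq_square)
    then have "c1 * norm g \<le> f z powr (- r) * (g \<bullet> g)"
      using fz by (simp add: powr_minus field_simps)
    then have "(1 - r) * (c1 * norm g) \<le> (1 - r) * (f z powr (- r) * (g \<bullet> g))"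
      using r by (intro mult_left_mono) auto
    moreover have "c * norm g < (1 - r) * (c1 * norm g)"
      using r c1 g0 by (simp add: c_def)
    ultimately show ?thesis by simp
  qed
  ultimately have "\<exists>d>0. \<forall>h>0. h < d \<longrightarrow> \<kappa> (0 + h) < \<kappa> 0" by (rule DERIV_neg_dec_right)
  then obtain d where d: "0 < d" "\<And>h. 0 < h \<Longrightarrow> h < d \<Longrightarrow> \<kappa> h < \<kappa> 0" by auto
  \<comment> \<open>Small enough for \<open>\<kappa>\<close> to decrease and for the moved point to
    stay in the ball where \<open>z\<close> is minimal.\<close>
  define h where "h = min (d / 2) ((\<rho> - norm (z - x1)) / norm g)"
  have h: "0 < h" "h < d" using d zx g0 by (auto simp: h_def)
  have "h * norm g \<le> \<rho> - norm (z - x1)"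
    using g0 by (auto simp: h_def min_def field_simps)
  moreover have tri: "norm (z + h *\<^sub>R (- g) - x1) \<le> norm (z - x1) + h * norm g"
    using norm_triangle_ineq4[of "z - x1" "h *\<^sub>R g"] h by (simp add: algebra_simps)
  ultimately have "z + h *\<^sub>R (- g) \<in> cball x1 \<rho>"
    by (simp add: dist_norm norm_minus_commute)
  then have "\<Psi> z \<le> \<Psi> (z + h *\<^sub>R (- g))" by (rule z)
  also have "\<dots> \<le> f (z + h *\<^sub>R (- g)) powr (1 - r) + c * (norm (z - x1) + h * norm g)"
    unfolding \<Psi>_def using tri c by (intro add_left_mono mult_left_mono) auto
  also have "\<dots> = \<kappa> h + c * norm (z - x1)" by (simp add: \<kappa>_def algebra_simps)
  also have "\<dots> < \<kappa> 0 + c * norm (z - x1)" using d(2)[OF h] by simp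
  also have "\<dots> = \<Psi> z" by (simp add: \<kappa>_def \<Psi>_def)
  finally show False by simp
qed

end

section \<open>Gradient growth of Kurdyka--Lojasiewicz type\<close>

text \<open>For \<open>r = 0\<close> the profile \<open>(1 + t\<^sup>2) powr ((1 - 2 * r) / 2)\<close> of part (iii) is convex, so it does not
  satisfy the concavity demanded by \<^const>\<open>H_phi\<close>. The smaller profile below is concave for every
  \<open>r\<close> and has the same growth.\<close>

definition KL_profile :: "real \<Rightarrow> real \<Rightarrow> real" where
  "KL_profile r t = ((1 + t) / 2) powr (1 - 2 * r)"

lemma half_line_powr_deriv:
  assumes "0 \<le> t"
  shows "((\<lambda>t. c * ((1 + t) / 2) powr q) has_real_derivative
    (c * q / 2) * ((1 + t) / 2) powr (q - 1)) (at t within {0..})"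
  using assms by (auto intro!: derivative_eq_intros)

lemma KL_profile_half_deriv:
  assumes "0 \<le> t"
  shows "half_deriv (KL_profile r) t = (1 - 2 * r) / 2 * ((1 + t) / 2) powr (- 2 * r)"
    and "half_deriv (half_deriv (KL_profile r)) t =
      - (2 * r * (1 - 2 * r) / 4 * ((1 + t) / 2) powr (- 2 * r - 1))"
    and "(KL_profile r has_real_derivative half_deriv (KL_profile r) t) (at t within {0..})"
    and "(half_deriv (KL_profile r) has_real_derivative half_deriv (half_deriv (KL_profile r)) t)
      (at t within {0..})"
proof -
  have d1: "(KL_profile r has_real_derivative (1 - 2 * r) / 2 * ((1 + s) / 2) powr (- 2 * r)) (at s within {0..})"
    if "0 \<le> s" for s
    using half_line_powr_deriv[OF that, of 1 "1 - 2 * r"] by (simp add: KL_profile_def[abs_def])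
  have e1: "half_deriv (KL_profile r) s = (1 - 2 * r) / 2 * ((1 + s) / 2) powr (- 2 * r)" if "0 \<le> s" for s
    by (rule half_deriv_eqI[OF d1[OF that] that])
  have "((\<lambda>s. (1 - 2 * r) / 2 * ((1 + s) / 2) powr (- 2 * r)) has_real_derivative
      - (2 * r * (1 - 2 * r) / 4 * ((1 + t) / 2) powr (- 2 * r - 1))) (at t within {0..})"
    using half_line_powr_deriv[OF assms, of "(1 - 2 * r) / 2" "- 2 * r"] by (simp add: mult_ac)
  then have d2: "(half_deriv (KL_profile r) has_real_derivative
      - (2 * r * (1 - 2 * r) / 4 * ((1 + t) / 2) powr (- 2 * r - 1))) (at t within {0..})"
    by (rule has_field_derivative_transform_within[OF _ zero_less_one]) (use e1 assms in auto)
  show e2: "half_deriv (half_deriv (KL_profile r)) t =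
      - (2 * r * (1 - 2 * r) / 4 * ((1 + t) / 2) powr (- 2 * r - 1))"
    by (rule half_deriv_eqI[OF d2 assms])
  show "half_deriv (KL_profile r) t = (1 - 2 * r) / 2 * ((1 + t) / 2) powr (- 2 * r)"
    by (rule e1[OF assms])
  show "(KL_profile r has_real_derivative half_deriv (KL_profile r) t) (at t within {0..})"
    unfolding e1[OF assms] by (rule d1[OF assms])
  show "(half_deriv (KL_profile r) has_real_derivative half_deriv (half_deriv (KL_profile r)) t)
      (at t within {0..})"
    unfolding e2 by (rule d2)
qed

lemma KL_profile_continuous: "continuous_on {0..} (KL_profile r)"
  using KL_profile_half_deriv(3) by (intro DERIV_continuous_on) auto

lemma KL_profile_regular:
  assumes "0 \<le> r" "r \<le> 1 / 2"
  shows "C2_half_line (KL_profile r)" "\<forall>t\<ge>0. KL_profile r t \<ge> 0" "mono_on {0..} (KL_profile r)"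
    "\<forall>t\<ge>0. half_deriv (half_deriv (KL_profile r)) t \<le> 0"
proof -
  have "continuous_on {0..} (\<lambda>t::real. - (2 * r * (1 - 2 * r) / 4 * ((1 + t) / 2) powr (- 2 * r - 1)))"
    by (intro continuous_intros) auto
  then have "continuous_on {0..} (half_deriv (half_deriv (KL_profile r)))"
    by (rule continuous_on_eq) (simp add: KL_profile_half_deriv(2))
  moreover have "KL_profile r differentiable (at t within {0..})"
    "half_deriv (KL_profile r) differentiable (at t within {0..})" if "0 \<le> t" for t
    by (rule real_differentiable_def[THEN iffD2, OF exI, OF KL_profile_half_deriv(3)[OF that]]
        real_differentiable_def[THEN iffD2, OF exI, OF KL_profile_half_deriv(4)[OF that]])+
  ultimately show "C2_half_line (KL_profile r)"
    unfolding C2_half_line_def differentiable_on_def by auto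
  show "\<forall>t\<ge>0. KL_profile r t \<ge> 0" by (simp add: KL_profile_def)
  show "mono_on {0..} (KL_profile r)"
    using assms by (auto simp: mono_on_def KL_profile_def intro!: powr_mono2)
  show "\<forall>t\<ge>0. half_deriv (half_deriv (KL_profile r)) t \<le> 0"
    using assms by (auto simp: KL_profile_half_deriv(2))
qed

text \<open>The division by 2 in the profile is made for this: \<open>(1 + t)\<^sup>2\<close> can
  exceed \<open>1 + t\<^sup>2\<close>, but its quarter cannot.\<close>

lemma KL_profile_le:
  assumes "0 \<le> r" "r \<le> 1 / 2" "0 \<le> t"
  shows "KL_profile r t \<le> (1 + t\<^sup>2) powr ((1 - 2 * r) / 2)"
proof -
  have "((1 + t) / 2)\<^sup>2 \<le> 1 + t\<^sup>2"
    using sum_squares_bound[of 1 t] assms by (simp add: power2_eq_square field_simps)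
  then have "(((1 + t) / 2)\<^sup>2) powr ((1 - 2 * r) / 2) \<le> (1 + t\<^sup>2) powr ((1 - 2 * r) / 2)"
    using assms by (intro powr_mono2) auto
  moreover have "(((1 + t) / 2)\<^sup>2) powr ((1 - 2 * r) / 2) = KL_profile r t"
  proof -
    have "(((1 + t) / 2)\<^sup>2) powr ((1 - 2 * r) / 2) = (((1 + t) / 2) powr 2) powr ((1 - 2 * r) / 2)"
      using assms by simp
    also have "\<dots> = ((1 + t) / 2) powr (2 * ((1 - 2 * r) / 2))" by (rule powr_powr)
    also have "2 * ((1 - 2 * r) / 2) = 1 - 2 * r" by simp
    finally show ?thesis by (simp only: KL_profile_def)
  qed
  ultimately show ?thesis by simp
qed

context objective
begin

lemma H_KL_bounds:
  assumes "H_KL f \<theta>s r"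
  shows "\<exists>c1 c2 R. 0 < c1 \<and> norm \<theta>s < R \<and> 1 \<le> R \<and> (\<forall>x. R \<le> norm x \<longrightarrow>
    1 \<le> f x \<and> c1 * f x powr r \<le> norm (grad f x) \<and> norm (grad f x) \<le> c2 * f x powr r)"
proof -
  let ?q = "\<lambda>x. f x powr (- r) * norm (grad f x)"
  obtain c1 where c1: "0 < ereal c1" "ereal c1 < Liminf at_infinity (\<lambda>x. ereal (?q x))"
    using assms ereal_dense2[of 0] unfolding H_KL_def by auto
  obtain c2 where c2: "Limsup at_infinity (\<lambda>x. ereal (?q x)) < ereal c2"
    using assms ereal_dense2[of _ \<infinity>] unfolding H_KL_def by auto
  have "\<forall>\<^sub>F x in at_infinity. c1 < ?q x" using less_LiminfD[OF c1(2)] by simp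
  moreover have "\<forall>\<^sub>F x in at_infinity. ?q x < c2" using Limsup_lessD[OF c2] by simp
  ultimately have "\<forall>\<^sub>F x in at_infinity. c1 < ?q x \<and> ?q x < c2" by (rule eventually_conj)
  then obtain R1 where R1: "\<And>x. R1 \<le> norm x \<Longrightarrow> c1 < ?q x \<and> ?q x < c2"
    unfolding eventually_at_infinity by blast
  obtain R2 where R2: "\<And>x. R2 \<le> norm x \<Longrightarrow> 1 \<le> f x" using f_ge_at_infinity by blast
  define R where "R = max (max R1 R2) (max 1 (norm \<theta>s + 1))"
  have "1 \<le> f x \<and> c1 * f x powr r \<le> norm (grad f x) \<and> norm (grad f x) \<le> c2 * f x powr r"
    if "R \<le> norm x" for x
  proof -
    have f1: "1 \<le> f x" and q: "c1 < ?q x" "?q x < c2" using R1[of x] R2[of x] that by (auto simp: R_def)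
    have "c1 * f x powr r \<le> ?q x * f x powr r" "?q x * f x powr r \<le> c2 * f x powr r"
      using q by (auto intro!: mult_right_mono)
    moreover have "?q x * f x powr r = norm (grad f x)" using f1 by (simp add: powr_minus field_simps)
    ultimately show ?thesis using f1 by simp
  qed
  moreover have "norm \<theta>s < R" "1 \<le> R" by (auto simp: R_def le_max_iff_disj)
  ultimately show ?thesis using c1 by (intro exI[of _ c1] exI[of _ c2] exI[of _ R]) auto
qed

text \<open>Near \<open>\<theta>s\<close> both numerator and denominator are comparable to the
  squared distance, by \<open>grad_lower_near\<close> and \<open>f_upper\<close>. Away from it the
  gradient is bounded below and \<open>f\<close> above.\<close>

lemma local_KL_lower: "\<exists>c>0. \<forall>x. x \<noteq> \<theta>s \<longrightarrow> norm x \<le> R \<longrightarrow> c \<le> (norm (grad f x))\<^sup>2 / f x"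
proof -
  obtain c \<delta> where c: "0 < c" "0 < \<delta>"
    and near: "\<And>x. norm (x - \<theta>s) < \<delta> \<Longrightarrow> c * norm (x - \<theta>s) \<le> norm (grad f x)"
    using grad_lower_near by blast
  obtain \<mu> where \<mu>: "0 < \<mu>" "\<And>x. norm x \<le> R \<Longrightarrow> \<delta> \<le> norm (x - \<theta>s) \<Longrightarrow> \<mu> \<le> norm (grad f x)"
    using positive_lower_bound[of "\<lambda>x. norm (grad f x)" \<delta> R,
        OF continuous_on_norm[OF grad_cont[OF continuous_on_id]] _ c(2)] crit by auto
  define W where "W = L * (\<bar>R\<bar> + norm \<theta>s)\<^sup>2 + 1"
  have W: "0 < W" using L_pos by (auto simp: W_def intro: add_nonneg_pos)
  define c' where "c' = min (c\<^sup>2 / L) (\<mu>\<^sup>2 / W)"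
  have "c' \<le> (norm (grad f x))\<^sup>2 / f x" if x: "x \<noteq> \<theta>s" "norm x \<le> R" for x
  proof (cases "norm (x - \<theta>s) < \<delta>")
    case True
    have "c\<^sup>2 / L * f x \<le> c\<^sup>2 / L * (L * (norm (x - \<theta>s))\<^sup>2)"
      using f_upper L_pos by (intro mult_left_mono) auto
    also have "\<dots> = (c * norm (x - \<theta>s))\<^sup>2" using L_pos by (simp add: power_mult_distrib)
    also have "\<dots> \<le> (norm (grad f x))\<^sup>2" using near[OF True] c by (intro power_mono) auto
    finally have "c\<^sup>2 / L \<le> (norm (grad f x))\<^sup>2 / f x" using f_pos[OF x(1)] by (simp add: pos_le_divide_eq)
    then show ?thesis by (simp add: c'_def min_le_iff_disj)
  next
    case False
    have "norm (x - \<theta>s) \<le> \<bar>R\<bar> + norm \<theta>s" using norm_triangle_ineq4[of x \<theta>s] x by linarith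
    then have "L * (norm (x - \<theta>s))\<^sup>2 \<le> L * (\<bar>R\<bar> + norm \<theta>s)\<^sup>2"
      using L_pos by (intro mult_left_mono power_mono) auto
    then have "f x \<le> W" using f_upper[of x] by (simp add: W_def)
    moreover have "\<mu>\<^sup>2 \<le> (norm (grad f x))\<^sup>2" using \<mu>(2)[OF x(2)] \<mu>(1) False by (intro power_mono) auto
    ultimately have "\<mu>\<^sup>2 / W \<le> (norm (grad f x))\<^sup>2 / f x"
      using f_pos[OF x(1)] by (intro frac_le) auto
    then show ?thesis by (simp add: c'_def min_le_iff_disj)
  qed
  moreover have "0 < c'" using c L_pos \<mu> W by (auto simp: c'_def)
  ultimately show ?thesis by blast
qed

text \<open>Far out, for \<open>r < 1 / 2\<close>, \<open>\<phi>' (f x)\<close> behaves like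
  \<open>f x powr (- 2 * r)\<close> and cancels the squared gradient, so the first summand gives the
  lower bound. For \<open>r = 1 / 2\<close> the profile is constant and the second summand takes
  over. On the ball, \<open>local_KL_lower\<close> applies.\<close>

lemma H_KL_imp_H_phi:
  assumes KL: "H_KL f \<theta>s r" and r: "0 \<le> r" "r \<le> 1 / 2"
  shows "H_phi f \<theta>s (KL_profile r)"
proof -
  obtain c1 c2 R where R: "0 < c1" "\<And>x. R \<le> norm x \<Longrightarrow>
    1 \<le> f x \<and> c1 * f x powr r \<le> norm (grad f x) \<and> norm (grad f x) \<le> c2 * f x powr r"
    using H_KL_bounds[OF KL] by blast
  obtain c where c: "0 < c" "\<And>x. x \<noteq> \<theta>s \<Longrightarrow> norm x \<le> R \<Longrightarrow> c \<le> (norm (grad f x))\<^sup>2 / f x"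
    using local_KL_lower by blast
  have "bounded (grad f ` cball 0 R)"
    by (intro compact_imp_bounded compact_continuous_image grad_cont continuous_on_id compact_cball)
  then obtain G where "\<forall>y\<in>grad f ` cball 0 R. norm y \<le> G"
    unfolding bounded_iff ..
  then have G: "norm (grad f x) \<le> G" if "norm x \<le> R" for x using that by auto
  define \<phi>' where "\<phi>' = half_deriv (KL_profile r)"
  have \<phi>': "\<phi>' t = (1 - 2 * r) / 2 * ((1 + t) / 2) powr (- 2 * r)" if "0 \<le> t" for t
    using KL_profile_half_deriv(1)[OF that] by (simp add: \<phi>'_def)
  have \<phi>'0: "0 \<le> \<phi>' t" if "0 \<le> t" for t using r by (simp add: \<phi>'[OF that])
  define M where "M = max (c2\<^sup>2) (G\<^sup>2) + 4 * L"
  define m where "m = (if r < 1 / 2 then min c ((1 - 2 * r) / 2 * c1\<^sup>2) else min c (c1\<^sup>2))"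
  have "m \<le> \<phi>' (f x) * (norm (grad f x))\<^sup>2 + (norm (grad f x))\<^sup>2 / f x \<and>
    \<phi>' (f x) * (norm (grad f x))\<^sup>2 + (norm (grad f x))\<^sup>2 / f x \<le> M" if x: "x \<noteq> \<theta>s" for x
  proof -
    let ?g = "norm (grad f x)" and ?a = "\<phi>' (f x) * (norm (grad f x))\<^sup>2" and ?b = "(norm (grad f x))\<^sup>2 / f x"
    have fx: "0 < f x" by (rule f_pos[OF x])
    have nn: "0 \<le> ?a" "0 \<le> ?b" using \<phi>'0[of "f x"] fx by auto
    have b: "?b \<le> 4 * L" using grad_sq_le[of x] fx by (simp add: pos_divide_le_eq)
    show ?thesis
    proof (cases "norm x \<le> R")
      case True
      have "\<phi>' (f x) \<le> 1"
      proof -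
        have "((1 + f x) / 2) powr (- 2 * r) \<le> (1 / 2) powr (- 2 * r)"
          using fx r by (intro powr_mono2') auto
        also have "\<dots> = 2 powr (2 * r)" by (simp add: powr_minus_divide powr_divide)
        also have "\<dots> \<le> 2 powr 1" using r by (intro powr_mono) auto
        finally have "(1 - 2 * r) / 2 * ((1 + f x) / 2) powr (- 2 * r) \<le> (1 / 2) * 2"
          using r by (intro mult_mono) auto
        then show ?thesis using fx by (simp add: \<phi>')
      qed
      then have "?a \<le> 1 * G\<^sup>2" using G[OF True] \<phi>'0[of "f x"] fx by (intro mult_mono power_mono) auto
      moreover have "m \<le> c" by (simp add: m_def)
      ultimately show ?thesis using c(2)[OF x True] nn b by (auto simp: M_def)
    next
      case False
      then have f1: "1 \<le> f x" and lo: "c1 * f x powr r \<le> ?g" and hi: "?g \<le> c2 * f x powr r"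
        using R(2)[of x] by auto
      have fr2: "(f x powr r)\<^sup>2 = f x powr (2 * r)" using fx by (simp add: powr_power)
      have lo2: "c1\<^sup>2 * f x powr (2 * r) \<le> ?g\<^sup>2"
        using power_mono[OF lo, of 2] R(1) by (simp add: power_mult_distrib fr2)
      have hi2: "?g\<^sup>2 \<le> c2\<^sup>2 * f x powr (2 * r)"
        using power_mono[OF hi, of 2] by (simp add: power_mult_distrib fr2)
      \<comment> \<open>Since \<open>f x \<ge> 1\<close>, the quotient of \<open>f x\<close> by
        \<open>(1 + f x) / 2\<close> lies between 1 and 2, and so does
        \<open>A * f x powr (2 * r)\<close>.\<close>
      define A where "A = ((1 + f x) / 2) powr (- 2 * r)"
      have \<phi>'A: "\<phi>' (f x) = (1 - 2 * r) / 2 * A" using \<phi>'[of "f x"] fx by (simp add: A_def)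
      have A: "1 \<le> A * f x powr (2 * r)" "A * f x powr (2 * r) \<le> 2"
      proof -
        have e: "A * f x powr (2 * r) = (f x / ((1 + f x) / 2)) powr (2 * r)"
          using fx by (simp add: A_def powr_minus powr_divide powr_mult field_simps)
        have "1 \<le> f x / ((1 + f x) / 2)" using f1 by (simp add: field_simps)
        then show "1 \<le> A * f x powr (2 * r)" unfolding e using r by (intro ge_one_powr_ge_zero) auto
        have "(f x / ((1 + f x) / 2)) powr (2 * r) \<le> 2 powr (2 * r)"
          using fx r by (intro powr_mono2) (auto simp: field_simps)
        also have "\<dots> \<le> 2 powr 1" using r by (intro powr_mono) auto
        finally show "A * f x powr (2 * r) \<le> 2" unfolding e by simp
      qed
      have A0: "0 \<le> A" by (simp add: A_def)
      have "?a \<le> (1 - 2 * r) / 2 * (A * (c2\<^sup>2 * f x powr (2 * r)))"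
        unfolding \<phi>'A mult.assoc using hi2 r A0 by (intro mult_left_mono) auto
      also have "\<dots> = (1 - 2 * r) / 2 * (c2\<^sup>2 * (A * f x powr (2 * r)))" by (simp only: mult_ac)
      also have "\<dots> \<le> 1 / 2 * (c2\<^sup>2 * 2)" using r A A0 by (intro mult_mono mult_left_mono) auto
      finally have "?a \<le> c2\<^sup>2" by simp
      moreover have "m \<le> ?a + ?b"
      proof (cases "r < 1 / 2")
        case True
        have "m \<le> (1 - 2 * r) / 2 * (c1\<^sup>2 * 1)" using True by (simp add: m_def)
        also have "\<dots> \<le> (1 - 2 * r) / 2 * (c1\<^sup>2 * (A * f x powr (2 * r)))"
          using True A by (intro mult_left_mono) auto
        also have "\<dots> = (1 - 2 * r) / 2 * (A * (c1\<^sup>2 * f x powr (2 * r)))" by (simp only: mult_ac)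
        also have "\<dots> \<le> ?a"
          unfolding \<phi>'A mult.assoc using lo2 r A0 by (intro mult_left_mono) auto
        finally show ?thesis using nn by simp
      next
        case False
        then have "2 * r = 1" using r by simp
        then have "f x powr (2 * r) = f x" using fx by (simp only: powr_one less_imp_le)
        then have "c1\<^sup>2 \<le> ?b" using lo2 fx by (simp add: pos_le_divide_eq)
        moreover have "m \<le> c1\<^sup>2" using False by (simp add: m_def)
        ultimately show ?thesis using nn by linarith
      qed
      ultimately show ?thesis using b by (auto simp: M_def)
    qed
  qed
  moreover have "0 < m" using c R(1) by (auto simp: m_def)
  moreover have "0 < M" using L_pos by (auto simp: M_def max_def intro!: add_nonneg_pos)
  ultimately have "\<exists>m M. 0 < m \<and> 0 < M \<and> (\<forall>x. x \<noteq> \<theta>s \<longrightarrow>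
      m \<le> half_deriv (KL_profile r) (f x) * (norm (grad f x))\<^sup>2 + (norm (grad f x))\<^sup>2 / f x \<and>
      half_deriv (KL_profile r) (f x) * (norm (grad f x))\<^sup>2 + (norm (grad f x))\<^sup>2 / f x \<le> M)"
    unfolding \<phi>'_def by blast
  moreover have "\<exists>x0\<ge>0. \<forall>x\<ge>x0. half_deriv (half_deriv (KL_profile r)) x \<le> 0"
    using KL_profile_regular(4)[OF r] by blast
  ultimately show ?thesis
    using KL KL_profile_regular[OF r] unfolding H_phi_def H_KL_def by blast
qed

text \<open>By \<open>growth_from_gradient\<close>, \<open>norm x powr (2 * p)\<close> is at most a
  constant times \<open>f x powr (2 * p * (1 - r))\<close>, that is \<open>f x powr p\<close> times
  the \<open>p\<close>-th power of \<open>f x powr (1 - 2 * r)\<close>. The latter is at most twice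
  the profile, so the exponential dominates its power.\<close>

lemma H_KL_imp_growth:
  assumes KL: "H_KL f \<theta>s r" and r: "0 \<le> r" "r \<le> 1 / 2" and p: "1 \<le> p"
  shows "Liminf at_infinity (\<lambda>x. ereal (norm x powr (- 2 * p) * (f x powr p * exp (KL_profile r (f x))))) > 0"
proof -
  obtain c1 c2 R where R: "0 < c1" "norm \<theta>s < R" "1 \<le> R" "\<And>x. R \<le> norm x \<Longrightarrow>
    1 \<le> f x \<and> c1 * f x powr r \<le> norm (grad f x) \<and> norm (grad f x) \<le> c2 * f x powr r"
    using H_KL_bounds[OF KL] by blast
  \<comment> \<open>Half the constant of \<open>growth_from_gradient\<close>, because
    \<open>norm x - R \<ge> norm x / 2\<close> once \<open>norm x \<ge> 2 * R\<close>.\<close>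
  define c where "c = (1 - r) * c1 / 4"
  have c: "0 < c" using r R(1) by (simp add: c_def)
  define d where "d = c powr (2 * p) / (2 * p) powr p"
  have d: "0 < d" using c p by (simp add: d_def)
  have "d \<le> norm x powr (- 2 * p) * (f x powr p * exp (KL_profile r (f x)))" if x: "2 * R \<le> norm x" for x
  proof -
    have nx: "R < norm x" "0 < norm x" using x R(3) by auto
    then have f1: "1 \<le> f x" using R(4)[of x] by auto
    have "c * norm x = (1 - r) * c1 / 2 * (norm x / 2)" by (simp add: c_def)
    also have "\<dots> \<le> (1 - r) * c1 / 2 * (norm x - R)" using x r R(1) by (intro mult_left_mono) auto
    also have "\<dots> \<le> f x powr (1 - r)"
      by (rule growth_from_gradient) (use r R nx in auto)
    finally have "(c * norm x) powr (2 * p) \<le> (f x powr (1 - r)) powr (2 * p)"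
      using c p by (intro powr_mono2) auto
    also have "\<dots> = f x powr p * (f x powr (1 - 2 * r)) powr p"
    proof -
      have "(1 - r) * (2 * p) = p + (1 - 2 * r) * p" by (simp add: algebra_simps)
      then show ?thesis by (simp only: powr_powr powr_add)
    qed
    also have "(f x powr (1 - 2 * r)) powr p \<le> (2 * p) powr p * exp (KL_profile r (f x))"
    proof -
      define s where "s = KL_profile r (f x)"
      have "f x powr (1 - 2 * r) \<le> (2 * ((1 + f x) / 2)) powr (1 - 2 * r)"
        using f1 r by (intro powr_mono2) auto
      also have "\<dots> = 2 powr (1 - 2 * r) * s"
        by (subst powr_mult) (use f1 in \<open>auto simp: s_def KL_profile_def\<close>)
      also have "\<dots> \<le> 2 powr 1 * s" using r by (intro mult_right_mono powr_mono) (auto simp: s_def KL_profile_def)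
      finally have "f x powr (1 - 2 * r) \<le> 2 * s" by simp
      also have "\<dots> \<le> 2 * p * exp (s / p)"
        using exp_ge_add_one_self[of "s / p"] p by (simp add: field_simps)
      finally have "(f x powr (1 - 2 * r)) powr p \<le> (2 * p * exp (s / p)) powr p"
        using p by (intro powr_mono2) auto
      also have "\<dots> = (2 * p) powr p * exp s" using p by (simp add: powr_mult exp_powr_real)
      finally show ?thesis by (simp add: s_def)
    qed
    finally have "(c * norm x) powr (2 * p) \<le> f x powr p * ((2 * p) powr p * exp (KL_profile r (f x)))"
      by (simp add: mult_left_mono)
    then have le: "c powr (2 * p) * norm x powr (2 * p) \<le>
        (f x powr p * exp (KL_profile r (f x))) * (2 * p) powr p"
      by (simp only: powr_mult mult_ac)
    have pos: "0 < norm x powr (2 * p)" "0 < (2 * p) powr p" using nx p by auto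
    have "d * norm x powr (2 * p) \<le> f x powr p * exp (KL_profile r (f x))"
      using le pos(2) by (simp add: d_def pos_divide_le_eq)
    moreover have "norm x powr (- 2 * p) = inverse (norm x powr (2 * p))"
      using powr_minus[of "norm x" "2 * p"] by simp
    ultimately show ?thesis using pos(1) by (simp add: inverse_eq_divide pos_le_divide_eq)
  qed
  then have "\<forall>\<^sub>F x in at_infinity. ereal d \<le> ereal (norm x powr (- 2 * p) * (f x powr p * exp (KL_profile r (f x))))"
    unfolding eventually_at_infinity by auto
  then have "ereal d \<le> Liminf at_infinity (\<lambda>x. ereal (norm x powr (- 2 * p) * (f x powr p * exp (KL_profile r (f x)))))"
    by (rule Liminf_bounded)
  then show ?thesis using d less_le_trans[of 0 "ereal d"] by simp
qed

end

theorem theorem3: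
  fixes f :: "real ^ 'd \<Rightarrow> real" and \<theta>s \<theta>0 :: "real ^ 'd"
    and P :: "'w measure"
    and \<Lambda> :: "(real ^ 'd) \<times> (real ^ 'k) \<Rightarrow> real ^ 'd"
    and Z :: "nat \<Rightarrow> 'w \<Rightarrow> real ^ 'k"
    and \<gamma> :: "nat \<Rightarrow> real" and \<gamma>0 \<beta> p :: real
    and \<theta> \<Delta>M :: "nat \<Rightarrow> 'w \<Rightarrow> real ^ 'd"
  assumes f_C2: "C2 f"
    and f_coercive: "filterlim f at_top at_infinity"
    and f_crit: "{x. grad f x = 0} = {\<theta>s}"
    and f_min: "f \<theta>s = 0"
    and P: "prob_space P"
    and \<Lambda>_meas: "\<Lambda> \<in> borel_measurable (borel \<Otimes>\<^sub>M borel)"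
    and Z_indep: "prob_space.indep_vars P (\<lambda>_. borel) Z {1..}"
    and Z_ident: "\<And>n. n \<ge> 1 \<Longrightarrow> distr P borel (Z n) = distr P borel (Z 1)"
    and \<Lambda>_integrable: "\<And>x. integrable P (\<lambda>\<omega>. \<Lambda> (x, Z 1 \<omega>))"
    and \<Lambda>_mean: "\<And>x. grad f x = (\<integral>\<omega>. \<Lambda> (x, Z 1 \<omega>) \<partial>P)"
    and step: "\<And>n. n \<ge> 1 \<Longrightarrow> \<gamma> n = \<gamma>0 * real n powr (- \<beta>)"
    and step_const: "\<gamma>0 > 0" and step_exp: "0 < \<beta>" "\<beta> < 1"
    and \<theta>_init: "\<And>\<omega>. \<omega> \<in> space P \<Longrightarrow> \<theta> 0 \<omega> = \<theta>0"
    and \<theta>_rec: "\<And>n \<omega>. \<omega> \<in> space P \<Longrightarrow>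
      \<theta> (Suc n) \<omega> = \<theta> n \<omega> - \<gamma> (Suc n) *\<^sub>R \<Lambda> (\<theta> n \<omega>, Z (Suc n) \<omega>)"
    and \<Delta>M: "\<And>n \<omega>. \<omega> \<in> space P \<Longrightarrow>
      \<Delta>M (Suc n) \<omega> = grad f (\<theta> n \<omega>) - \<Lambda> (\<theta> n \<omega>, Z (Suc n) \<omega>)"
    and p: "p \<ge> 1"
  shows
    "(\<forall>\<phi>. H_phi f \<theta>s \<phi> \<and> H_Sigma P \<theta> \<Delta>M \<phi> p \<longrightarrow>
        (\<exists>C. \<forall>n\<ge>1. (\<integral>\<^sup>+ \<omega>. ennreal (f (\<theta> n \<omega>) powr p * exp (\<phi> (f (\<theta> n \<omega>)))) \<partial>P)
           \<le> ennreal (C * \<gamma> n powr p))) \<and>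
     (\<forall>\<phi>. H_phi f \<theta>s \<phi> \<and> H_Sigma P \<theta> \<Delta>M \<phi> p \<and>
        Liminf at_infinity
          (\<lambda>x. ereal (norm x powr (- 2 * p) * (f x powr p * exp (\<phi> (f x))))) > 0 \<longrightarrow>
        L2p_consistent P p \<gamma> \<theta> \<theta>s) \<and>
     (\<forall>r. 0 \<le> r \<and> r \<le> 1 / 2 \<and> H_KL f \<theta>s r \<and>
        H_Sigma P \<theta> \<Delta>M (\<lambda>t. (1 + t\<^sup>2) powr ((1 - 2 * r) / 2)) p \<longrightarrow>
        L2p_consistent P p \<gamma> \<theta> \<theta>s)"
proof -
  have f_meas: "f \<in> borel_measurable borel" and grad_meas: "grad f \<in> borel_measurable borel"
    using f_C2 unfolding C2_def
    by (auto intro!: borel_measurable_continuous_onI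
        simp: continuous_on_eq_continuous_at differentiable_imp_continuous_within)
  interpret prob_space P by (rule P)
  interpret sgd P f \<Lambda> Z \<gamma> \<theta> \<Delta>M \<theta>0
    by unfold_locales (fact \<Lambda>_meas Z_indep Z_ident \<Lambda>_integrable \<Lambda>_mean \<theta>_init \<theta>_rec \<Delta>M f_meas grad_meas)+
  have i: "\<exists>C. \<forall>n\<ge>1. (\<integral>\<^sup>+ \<omega>. ennreal (f (\<theta> n \<omega>) powr p * exp (\<phi> (f (\<theta> n \<omega>)))) \<partial>P)
      \<le> ennreal (C * \<gamma> n powr p)"
    if H: "H_phi f \<theta>s \<phi>" "H_Sigma P \<theta> \<Delta>M \<phi> p" for \<phi>
  proof -
    obtain L where "objective f \<theta>s L"
      using objective_exists[OF _ f_coercive f_crit f_min] H(1) by (auto simp: H_phi_def)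
    then interpret objective f \<theta>s L .
    obtain x0 where x0: "0 \<le> x0" "\<forall>x\<ge>x0. half_deriv (half_deriv \<phi>) x \<le> 0"
      using H(1) by (auto simp: H_phi_def)
    obtain \<Phi> K where "profile \<phi> (half_deriv \<phi>) (half_deriv (half_deriv \<phi>)) x0 \<Phi> K"
      using profile_exists[OF _ _ _ x0] H(1) unfolding H_phi_def by blast
    then interpret profile \<phi> "half_deriv \<phi>" "half_deriv (half_deriv \<phi>)" x0 \<Phi> K .
    obtain m M where mM: "0 < m" "0 < M" "\<And>x. x \<noteq> \<theta>s \<Longrightarrow>
        m \<le> half_deriv \<phi> (f x) * (norm (grad f x))\<^sup>2 + (norm (grad f x))\<^sup>2 / f x \<and>
        half_deriv \<phi> (f x) * (norm (grad f x))\<^sup>2 + (norm (grad f x))\<^sup>2 / f x \<le> M"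
      using H(1) unfolding H_phi_def by blast
    interpret sgd_phi P f \<Lambda> Z \<gamma> \<theta> \<Delta>M \<theta>0 \<theta>s L \<phi> "half_deriv \<phi>" "half_deriv (half_deriv \<phi>)" x0 \<Phi> K m M p \<gamma>0 \<beta>
      by unfold_locales (use mM p H(2) step step_const step_exp in auto)
    show ?thesis by (rule lyap_moment_bound)
  qed
  have ii: "L2p_consistent P p \<gamma> \<theta> \<theta>s"
    if H: "H_phi f \<theta>s \<phi>" "H_Sigma P \<theta> \<Delta>M \<phi> p"
      and lim: "Liminf at_infinity (\<lambda>x. ereal (norm x powr (- 2 * p) * (f x powr p * exp (\<phi> (f x))))) > 0" for \<phi>
  proof -
    obtain L where "objective f \<theta>s L"
      using objective_exists[OF _ f_coercive f_crit f_min] H(1) by (auto simp: H_phi_def)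
    then interpret objective f \<theta>s L .
    obtain K where K: "0 \<le> K" "\<And>x. norm (x - \<theta>s) powr (2 * p) \<le> K * (f x powr p * exp (\<phi> (f x)))"
      using moment_comparison[OF _ _ lim] p H(1) by (auto simp: H_phi_def)
    obtain C where C: "\<And>n. n \<ge> 1 \<Longrightarrow> (\<integral>\<^sup>+ \<omega>. ennreal (f (\<theta> n \<omega>) powr p * exp (\<phi> (f (\<theta> n \<omega>)))) \<partial>P)
      \<le> ennreal (C * \<gamma> n powr p)" using i[OF H] by blast
    have "continuous_on {0..} \<phi>"
      using H(1) by (auto simp: H_phi_def C2_half_line_def differentiable_imp_continuous_on)
    then have "continuous_on UNIV (\<lambda>x. \<phi> (f x))"
      by (rule continuous_on_compose2) (auto intro!: f_cont continuous_on_id f_minimum)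
    then have [measurable]: "(\<lambda>x. \<phi> (f x)) \<in> borel_measurable borel" by (rule borel_measurable_continuous_onI)
    have "(\<integral>\<^sup>+ \<omega>. ennreal (norm (\<theta> n \<omega> - \<theta>s) powr (2 * p)) \<partial>P) \<le> ennreal (K * C * \<gamma> n powr p)"
      if n: "n \<ge> 1" for n
    proof -
      have "(\<lambda>x. f x powr p * exp (\<phi> (f x))) \<in> borel_measurable borel" by measurable
      then have meas: "(\<lambda>\<omega>. f (\<theta> n \<omega>) powr p * exp (\<phi> (f (\<theta> n \<omega>)))) \<in> borel_measurable P"
        by (rule measurable_compose[OF \<theta>_measurable])
      have "(\<integral>\<^sup>+ \<omega>. ennreal (norm (\<theta> n \<omega> - \<theta>s) powr (2 * p)) \<partial>P) \<le>
          (\<integral>\<^sup>+ \<omega>. ennreal K * ennreal (f (\<theta> n \<omega>) powr p * exp (\<phi> (f (\<theta> n \<omega>)))) \<partial>P)"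
        using K by (intro nn_integral_mono) (auto simp flip: ennreal_mult intro!: ennreal_leI)
      also have "\<dots> = ennreal K * (\<integral>\<^sup>+ \<omega>. ennreal (f (\<theta> n \<omega>) powr p * exp (\<phi> (f (\<theta> n \<omega>)))) \<partial>P)"
        using meas by (intro nn_integral_cmult) measurable
      also have "\<dots> \<le> ennreal K * ennreal (C * \<gamma> n powr p)"
        by (intro mult_left_mono C n) auto
      also have "\<dots> = ennreal (K * C * \<gamma> n powr p)"
        using K by (simp add: ennreal_mult' mult.assoc)
      finally show ?thesis .
    qed
    then show ?thesis unfolding L2p_consistent_def by blast
  qed
  have iii: "L2p_consistent P p \<gamma> \<theta> \<theta>s"
    if r: "0 \<le> r" "r \<le> 1 / 2" and KL: "H_KL f \<theta>s r"
      and Sig: "H_Sigma P \<theta> \<Delta>M (\<lambda>t. (1 + t\<^sup>2) powr ((1 - 2 * r) / 2)) p" for r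
  proof -
    obtain L where "objective f \<theta>s L"
      using objective_exists[OF _ f_coercive f_crit f_min] KL by (auto simp: H_KL_def)
    then interpret objective f \<theta>s L .
    have "continuous_on {0..} (\<lambda>t::real. (1 + t\<^sup>2) powr ((1 - 2 * r) / 2))"
      by (intro continuous_intros) (auto simp: add_nonneg_eq_0_iff)
    \<comment> \<open>All conditions are transferred to the concave profile; the conclusion does not
      mention the profile, so part (ii) for \<open>KL_profile r\<close> is enough.\<close>
    then have "H_Sigma P \<theta> \<Delta>M (KL_profile r) p"
      by (intro H_Sigma_antimono[OF Sig] KL_profile_le r KL_profile_continuous)
    then show ?thesis
      by (rule ii[OF H_KL_imp_H_phi[OF KL r] _ H_KL_imp_growth[OF KL r p]])
  qed
  show ?thesis using i ii iii by blast
qed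

end
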